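(* Let $R$ be an ordinary standard differential ring of finite Krull dimension. If, for some positive integer $n$, $\dim^{\Delta}R\{z_1,\dots,z_n\}>n$, then $d_R>1$.
   Context: All rings are commutative with identity. A differential ring is a ring with finitely many pairwise commuting derivations; it is ordinary if it has exactly one distinguished derivation. An ideal is differential if it is stable under the derivations; $\operatorname{Spec}^{\Delta}R$ is the set of differential prime ideals of $R$, assumed nonempty. $R\{z_1,\dots,z_n\}$ is the ring of differential polynomials in $n$ differential indeterminates over $R$. $R$ is standard if for every differential prime $\mathfrak p$ of $R$ the residue field $R_{\mathfrak p}/\mathfrak pR_{\mathfrak p}$ has characteristic zero. The number $d_R$: for a ring $R$ of finite Krull dimension, the sequence $d_n=\dim R[x_1,\dots,x_n]-\dim R[x_1,\dots,x_{n-1}]$ (Krull dimensions of ordinary polynomial rings) is eventually constant (a theorem of Jaffard); $d_R$ denotes its eventual value. Gap measure: for $X\subseteq\operatorname{Spec}^{\Delta}R$ there is a unique function $\mu$ with values in $\mathbb Z\cup\{\infty\}$ on pairs $(\mathfrak p,\mathfrak p')$ of elements of $X$ with $\mathfrak p\supseteq\mathfrak p'$ such that: (1) $\mu(\mathfrak p,\mathfrak p')\ge 0$; (2) $\mu(\mathfrak p,\mathfrak p')=0$ iff $\mathfrak p=\mathfrak p'$ or there is no infinite strictly descending chain $\mathfrak p=\mathfrak p_0\supsetneq\mathfrak p_1\supsetneq\cdots\supseteq\mathfrak p'$ in $X$; (3) for an integer $d>0$, $\mu(\mathfrak p,\mathfrak p')\ge d$ iff $\mathfrak p\ne\mathfrak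 p'$ and there is an infinite strictly descending sequence $\mathfrak p=\mathfrak p_0\supsetneq\mathfrak p_1\supsetneq\cdots\supseteq\mathfrak p'$ in $X$ (all terms containing $\mathfrak p'$) with $\mu(\mathfrak p_{i-1},\mathfrak p_i)\ge d-1$ for all $i\ge 1$. The differential type $\operatorname{type}^{\Delta}R$ is the supremum of all $\mu(\mathfrak p,\mathfrak p')$ with $\mathfrak p\supseteq\mathfrak p'$ in $X=\operatorname{Spec}^{\Delta}R$. The differential dimension $\dim^{\Delta}R$ is the supremum of the integers $k\ge 0$ such that there is a chain $\mathfrak p_0\supsetneq\cdots\supsetneq\mathfrak p_k$ in $\operatorname{Spec}^{\Delta}R$ with $\mu(\mathfrak p_{i-1},\mathfrak p_i)=\operatorname{type}^{\Delta}R$ for $i=1,\dots,k$. These definitions are applied to the ring $R\{z_1,\dots,z_n\}$. *)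

theory Defs
  imports
    "HOL-Algebra.QuotRing"
    "HOL-Algebra.Algebraic_Closure_Type"
    "HOL-Library.Poly_Mapping"
    "HOL-Library.Extended_Nat"
begin

section \<open>Rings and polynomial rings\<close>

text \<open>
  The base ring \<open>R\<close> is the carrier of a type of class \<^class>\<open>comm_ring_1\<close>.
  Polynomials over it in indeterminates named by \<open>'i\<close> are the finitely supported
  functions of type \<open>('i \<Rightarrow>\<^sub>0 nat) \<Rightarrow>\<^sub>0 'a\<close>, with monomials of type \<open>'i \<Rightarrow>\<^sub>0 nat\<close>;
  the polynomials in the indeterminates from a set \<open>I\<close> form a subring of that type.
\<close>

definition polys_in :: "'i set \<Rightarrow> (('i \<Rightarrow>\<^sub>0 nat) \<Rightarrow>\<^sub>0 'a::comm_ring_1) set"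
  where "polys_in I = {p. \<forall>m\<in>Poly_Mapping.keys p. Poly_Mapping.keys m \<subseteq> I}"

definition poly_ring :: "'i set \<Rightarrow> (('i \<Rightarrow>\<^sub>0 nat) \<Rightarrow>\<^sub>0 'a::comm_ring_1) ring"
  where "poly_ring I = ring_of_type_algebra\<lparr>carrier := polys_in I\<rparr>"

lemma polys_in_add: "p \<in> polys_in I \<Longrightarrow> q \<in> polys_in I \<Longrightarrow> p + q \<in> polys_in I"
  using keys_add[of p q] unfolding polys_in_def by blast

lemma polys_in_mult: "p \<in> polys_in I \<Longrightarrow> q \<in> polys_in I \<Longrightarrow> p * q \<in> polys_in I"
proof -
  assume *: "p \<in> polys_in I" "q \<in> polys_in I"
  show ?thesis
    unfolding polys_in_def
  proof clarify
    fix m v assume m: "m \<in> Poly_Mapping.keys (p * q)" and v: "v \<in> Poly_Mapping.keys m"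
    from m obtain a b where ab: "m = a + b" "a \<in> Poly_Mapping.keys p" "b \<in> Poly_Mapping.keys q"
      using keys_mult[of p q] by blast
    then show "v \<in> I" using v keys_add[of a b] * unfolding polys_in_def by blast
  qed
qed

lemma polys_in_uminus: "p \<in> polys_in I \<Longrightarrow> - p \<in> polys_in I"
  by (auto simp: polys_in_def in_keys_iff)

lemma polys_in_0: "0 \<in> polys_in I" and polys_in_1: "1 \<in> polys_in I"
  by (auto simp: polys_in_def)

lemma poly_ring_simps:
  "carrier (poly_ring I) = polys_in I"
  "x \<otimes>\<^bsub>poly_ring I\<^esub> y = x * y" "\<one>\<^bsub>poly_ring I\<^esub> = 1"
  "x \<oplus>\<^bsub>poly_ring I\<^esub> y = x + y" "\<zero>\<^bsub>poly_ring I\<^esub> = 0"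
  by (simp_all add: poly_ring_def ring_of_type_algebra_def)

lemma cring_poly_ring: "cring (poly_ring I :: (('i \<Rightarrow>\<^sub>0 nat) \<Rightarrow>\<^sub>0 'a::comm_ring_1) ring)"
proof (rule cringI)
  show "abelian_group (poly_ring I :: (('i \<Rightarrow>\<^sub>0 nat) \<Rightarrow>\<^sub>0 'a) ring)"
  proof (rule abelian_groupI, unfold poly_ring_simps)
    show "\<exists>y\<in>polys_in I. y + x = 0" if "x \<in> polys_in I" for x :: "('i \<Rightarrow>\<^sub>0 nat) \<Rightarrow>\<^sub>0 'a"
      using polys_in_uminus[OF that] by (rule rev_bexI) simp
  qed (simp_all add: polys_in_add polys_in_0 ac_simps)
  show "comm_monoid (poly_ring I :: (('i \<Rightarrow>\<^sub>0 nat) \<Rightarrow>\<^sub>0 'a) ring)"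
    by (rule comm_monoidI, unfold poly_ring_simps) (simp_all add: polys_in_mult polys_in_1 ac_simps)
qed (simp add: poly_ring_simps distrib_right)

definition krull_dim :: "('a, 'm) ring_scheme \<Rightarrow> enat"
  where "krull_dim A =
    (SUP k \<in> {k. \<exists>c :: nat \<Rightarrow> 'a set. (\<forall>i\<le>k. primeideal (c i) A) \<and> (\<forall>i<k. c i \<subset> c (Suc i))}. enat k)"

text \<open>
  \<open>dim_growth\<close> is \<open>d\<^sub>n = dim R[x\<^sub>1,\<dots>,x\<^sub>n] - dim R[x\<^sub>1,\<dots>,x\<^bsub>n-1\<^esub>]\<close>, to be read for \<open>n \<ge> 1\<close>.  When \<open>R\<close> has
  finite Krull dimension both terms are finite and increasing in \<open>n\<close>, so that the
  subtraction on \<^typ>\<open>enat\<close> is the usual one; by Jaffard's theorem the sequence is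
  then eventually constant, and \<open>eventual_dim_growth\<close> is the number \<open>d\<^sub>R\<close>.
\<close>

definition dim_growth :: "'a::comm_ring_1 itself \<Rightarrow> nat \<Rightarrow> enat"
  where "dim_growth _ n =
    krull_dim (poly_ring {..<n} :: ((nat \<Rightarrow>\<^sub>0 nat) \<Rightarrow>\<^sub>0 'a) ring) -
    krull_dim (poly_ring {..<n - 1} :: ((nat \<Rightarrow>\<^sub>0 nat) \<Rightarrow>\<^sub>0 'a) ring)"

definition eventual_dim_growth :: "'a::comm_ring_1 itself \<Rightarrow> enat"
  where "eventual_dim_growth R = (THE d. eventually (\<lambda>n. dim_growth R n = d) sequentially)"


section \<open>Residue fields\<close>

definition local_rel :: "'a::comm_ring_1 set \<Rightarrow> (('a \<times> 'a) \<times> ('a \<times> 'a)) set"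
  where "local_rel P =
    {((a, s), (b, t)). s \<notin> P \<and> t \<notin> P \<and> (\<exists>u. u \<notin> P \<and> u * (a * t - b * s) = 0)}"

definition local_frac :: "'a::comm_ring_1 set \<Rightarrow> 'a \<Rightarrow> 'a \<Rightarrow> ('a \<times> 'a) set"
  where "local_frac P a s = local_rel P `` {(a, s)}"

definition localization :: "'a::comm_ring_1 set \<Rightarrow> ('a \<times> 'a) set ring"
  where "localization P =
    \<lparr> carrier = (UNIV \<times> - P) // local_rel P,
      monoid.mult = (\<lambda>x y. \<Union>(a, s)\<in>x. \<Union>(b, t)\<in>y. local_frac P (a * b) (s * t)),
      monoid.one = local_frac P 1 1,
      ring.zero = local_frac P 0 1,
      ring.add = (\<lambda>x y. \<Union>(a, s)\<in>x. \<Union>(b, t)\<in>y. local_frac P (a * t + b * s) (s * t)) \<rparr>"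

definition residue_field :: "'a::comm_ring_1 set \<Rightarrow> ('a \<times> 'a) set set ring"
  where "residue_field P =
    localization P Quot (Idl\<^bsub>localization P\<^esub> ((\<lambda>a. local_frac P a 1) ` P))"

definition char_zero :: "('a, 'm) ring_scheme \<Rightarrow> bool"
  where "char_zero A \<longleftrightarrow> (\<forall>n::nat. n > 0 \<longrightarrow> [n] \<cdot>\<^bsub>A\<^esub> \<one>\<^bsub>A\<^esub> \<noteq> \<zero>\<^bsub>A\<^esub>)"

lemma primeideal_typeD:
  fixes P :: "'a::comm_ring_1 set"
  assumes "primeideal P (ring_of_type_algebra :: 'a ring)"
  shows "1 \<notin> P" "0 \<in> P" "\<And>a b. a * b \<in> P \<Longrightarrow> a \<in> P \<or> b \<in> P"
    "\<And>a b. a \<in> P \<Longrightarrow> a * b \<in> P" "\<And>a b. a \<in> P \<Longrightarrow> b * a \<in> P" "\<And>a b. a \<in> P \<Longrightarrow> b \<in> P \<Longrightarrow> a + b \<in> P"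
    "\<And>a. a \<in> P \<Longrightarrow> - a \<in> P"
proof -
  interpret primeideal P "ring_of_type_algebra :: 'a ring" by fact
  show m: "a * b \<in> P" "b * a \<in> P" if "a \<in> P" for a b
    using I_r_closed[OF that, of b] I_l_closed[OF that, of b] by (auto simp: ring_of_type_algebra_def)
  show "1 \<notin> P" using I_notcarr m[of 1] by (auto simp: ring_of_type_algebra_def)
  show "0 \<in> P" using additive_subgroup.zero_closed[OF is_additive_subgroup] by (simp add: ring_of_type_algebra_def)
  show "a \<in> P \<or> b \<in> P" if "a * b \<in> P" for a b
    using I_prime[of a b] that by (simp add: ring_of_type_algebra_def)
  show "a + b \<in> P" if "a \<in> P" "b \<in> P" for a b
    using additive_subgroup.a_closed[OF is_additive_subgroup that] by (simp add: ring_of_type_algebra_def)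
  show "- a \<in> P" if "a \<in> P" for a using m[OF that, of "-1"] by simp
qed

context
  fixes P :: "'a::comm_ring_1 set"
  assumes P: "primeideal P (ring_of_type_algebra :: 'a ring)"
begin

lemma mult_notin: "s \<notin> P \<Longrightarrow> t \<notin> P \<Longrightarrow> s * t \<notin> P"
  using primeideal_typeD(3)[OF P, of s t] by blast

lemma local_rel_iff: "((a, s), (b, t)) \<in> local_rel P \<longleftrightarrow>
    s \<notin> P \<and> t \<notin> P \<and> (\<exists>u. u \<notin> P \<and> u * (a * t - b * s) = 0)"
  unfolding local_rel_def by simp

lemma local_relI: "s \<notin> P \<Longrightarrow> t \<notin> P \<Longrightarrow> u \<notin> P \<Longrightarrow> u * (a * t - b * s) = 0 \<Longrightarrow> ((a, s), (b, t)) \<in> local_rel P"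
  unfolding local_rel_iff by blast

lemma local_relE:
  assumes "((a, s), (b, t)) \<in> local_rel P"
  obtains u where "s \<notin> P" "t \<notin> P" "u \<notin> P" "u * (a * t - b * s) = 0"
  using assms unfolding local_rel_iff by blast

lemma equiv_local_rel: "equiv (UNIV \<times> - P) (local_rel P)"
proof (rule equivI)
  show "local_rel P \<subseteq> (UNIV \<times> - P) \<times> UNIV \<times> - P" unfolding local_rel_def by auto
  show "refl_on (UNIV \<times> - P) (local_rel P)"
    using primeideal_typeD(1)[OF P] by (intro refl_onI) (auto intro!: local_relI[of _ _ 1])
  show "sym (local_rel P)"
  proof (rule symI, clarify, erule local_relE)
    fix a s b t u assume "s \<notin> P" "t \<notin> P" "u \<notin> P" and 0: "u * (a * t - b * s) = 0"
    moreover have "u * (b * s - a * t) = - (u * (a * t - b * s))" by (simp add: algebra_simps)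
    ultimately show "((b, t), a, s) \<in> local_rel P"
      by (intro local_relI[of _ _ u]) auto
  qed
  show "trans (local_rel P)"
  proof (rule transI, clarify, elim local_relE)
    fix a s b t c w u v
    assume *: "s \<notin> P" "t \<notin> P" "w \<notin> P" "u \<notin> P" "u * (a * t - b * s) = 0"
      "v \<notin> P" "v * (b * w - c * t) = 0"
    have "u * v * t * (a * w - c * s) = v * w * (u * (a * t - b * s)) + u * s * (v * (b * w - c * t))"
      by (simp add: algebra_simps)
    also have "\<dots> = 0" by (simp only: *) simp
    finally show "((a, s), c, w) \<in> local_rel P"
      using * by (intro local_relI[of _ _ "u * v * t"] mult_notin)
  qed
qed

lemma local_frac_eq_iff:
  assumes "s \<notin> P" "t \<notin> P"
  shows "local_frac P a s = local_frac P b t \<longleftrightarrow> (\<exists>u. u \<notin> P \<and> u * (a * t - b * s) = 0)"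
  using eq_equiv_class_iff[OF equiv_local_rel, of "(a, s)" "(b, t)"] assms
  by (auto simp: local_frac_def local_rel_def)

lemma carrier_localization: "carrier (localization P) = {local_frac P a s | a s. s \<notin> P}"
  by (auto simp: localization_def quotient_def local_frac_def)

lemma mem_local_frac: "(b, t) \<in> local_frac P a s \<longleftrightarrow> s \<notin> P \<and> t \<notin> P \<and> local_frac P b t = local_frac P a s"
  using local_frac_eq_iff[of s t a b] by (auto simp: local_frac_def[of P a s] local_rel_def)

lemma local_frac_mem: "s \<notin> P \<Longrightarrow> (a, s) \<in> local_frac P a s"
  by (simp add: mem_local_frac)

lemma UN_const2:
  assumes "(a, s) \<in> A" "(b, t) \<in> B"
    "\<And>a' s' b' t'. (a', s') \<in> A \<Longrightarrow> (b', t') \<in> B \<Longrightarrow> f a' s' b' t' = f a s b t"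
  shows "(\<Union>(a, s)\<in>A. \<Union>(b, t)\<in>B. f a s b t) = f a s b t"
  using assms by fast

lemma localization_mult:
  assumes "s \<notin> P" "t \<notin> P"
  shows "local_frac P a s \<otimes>\<^bsub>localization P\<^esub> local_frac P b t = local_frac P (a * b) (s * t)"
  unfolding localization_def monoid.simps
proof (rule UN_const2)
  fix a' s' b' t' assume *: "(a', s') \<in> local_frac P a s" "(b', t') \<in> local_frac P b t"
  then obtain u v where u: "u \<notin> P" "u * (a' * s - a * s') = 0" and v: "v \<notin> P" "v * (b' * t - b * t') = 0"
    and st: "s' \<notin> P" "t' \<notin> P"
    unfolding mem_local_frac using local_frac_eq_iff by metis
  have "u * v * (a' * b' * (s * t) - a * b * (s' * t')) =
    v * b' * t * (u * (a' * s - a * s')) + u * a * s' * (v * (b' * t - b * t'))"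
    by (simp add: algebra_simps)
  also have "\<dots> = 0" using u v by simp
  finally show "local_frac P (a' * b') (s' * t') = local_frac P (a * b) (s * t)"
    using u v st assms by (subst local_frac_eq_iff) (auto simp: mult_notin intro!: exI[of _ "u * v"])
qed (auto simp: local_frac_mem assms)

lemma localization_add:
  assumes "s \<notin> P" "t \<notin> P"
  shows "local_frac P a s \<oplus>\<^bsub>localization P\<^esub> local_frac P b t = local_frac P (a * t + b * s) (s * t)"
  unfolding localization_def ring.simps
proof (rule UN_const2)
  fix a' s' b' t' assume *: "(a', s') \<in> local_frac P a s" "(b', t') \<in> local_frac P b t"
  then obtain u v where u: "u \<notin> P" "u * (a' * s - a * s') = 0" and v: "v \<notin> P" "v * (b' * t - b * t') = 0"
    and st: "s' \<notin> P" "t' \<notin> P"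
    unfolding mem_local_frac using local_frac_eq_iff by metis
  have "u * v * ((a' * t' + b' * s') * (s * t) - (a * t + b * s) * (s' * t')) =
    v * t * t' * (u * (a' * s - a * s')) + u * s * s' * (v * (b' * t - b * t'))"
    by (simp add: algebra_simps)
  also have "\<dots> = 0" using u v by simp
  finally show "local_frac P (a' * t' + b' * s') (s' * t') = local_frac P (a * t + b * s) (s * t)"
    using u v st assms by (subst local_frac_eq_iff) (auto simp: mult_notin intro!: exI[of _ "u * v"])
qed (auto simp: local_frac_mem assms)

lemma localization_zero_one:
  "\<zero>\<^bsub>localization P\<^esub> = local_frac P 0 1" "\<one>\<^bsub>localization P\<^esub> = local_frac P 1 1"
  by (simp_all add: localization_def)

lemma one_notin: "1 \<notin> P" by (rule primeideal_typeD(1)[OF P])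

lemma local_fracI:
  assumes "s \<notin> P" "t \<notin> P" "a * t = b * s"
  shows "local_frac P a s = local_frac P b t"
  using assms one_notin by (subst local_frac_eq_iff) (auto intro!: exI[of _ 1])

lemma localization_cases:
  assumes "x \<in> carrier (localization P)"
  obtains a s where "x = local_frac P a s" "s \<notin> P"
  using assms unfolding carrier_localization by blast

lemma localization_closed: "s \<notin> P \<Longrightarrow> local_frac P a s \<in> carrier (localization P)"
  unfolding carrier_localization by blast

lemma cring_localization: "cring (localization P)"
proof -
  note s = localization_mult localization_add localization_zero_one localization_closed mult_notin one_notin
  have "abelian_group (localization P)"
  proof (rule abelian_groupI)
    fix x assume "x \<in> carrier (localization P)"
    then obtain a t where x: "x = local_frac P a t" "t \<notin> P" by (rule localization_cases)
    show "\<zero>\<^bsub>localization P\<^esub> \<oplus>\<^bsub>localization P\<^esub> x = x"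
      using x by (simp add: s)
    have "local_frac P (- a) t \<oplus>\<^bsub>localization P\<^esub> x = \<zero>\<^bsub>localization P\<^esub>"
      using x by (simp add: s) (rule local_fracI, simp_all add: s)
    then show "\<exists>y\<in>carrier (localization P). y \<oplus>\<^bsub>localization P\<^esub> x = \<zero>\<^bsub>localization P\<^esub>"
      using x by (blast intro: localization_closed)
    fix y assume "y \<in> carrier (localization P)"
    then obtain b u where y: "y = local_frac P b u" "u \<notin> P" by (rule localization_cases)
    show "x \<oplus>\<^bsub>localization P\<^esub> y \<in> carrier (localization P)" using x y by (simp add: s)
    show "x \<oplus>\<^bsub>localization P\<^esub> y = y \<oplus>\<^bsub>localization P\<^esub> x" using x y by (simp add: s ac_simps)
    fix z assume "z \<in> carrier (localization P)"
    then obtain c v where z: "z = local_frac P c v" "v \<notin> P" by (rule localization_cases)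
    show "x \<oplus>\<^bsub>localization P\<^esub> y \<oplus>\<^bsub>localization P\<^esub> z = x \<oplus>\<^bsub>localization P\<^esub> (y \<oplus>\<^bsub>localization P\<^esub> z)"
      using x y z by (simp add: s algebra_simps)
  qed (simp add: s)
  moreover have "comm_monoid (localization P)"
  proof (rule comm_monoidI)
    fix x assume "x \<in> carrier (localization P)"
    then obtain a t where x: "x = local_frac P a t" "t \<notin> P" by (rule localization_cases)
    show "\<one>\<^bsub>localization P\<^esub> \<otimes>\<^bsub>localization P\<^esub> x = x"
      using x by (simp add: s)
    fix y assume "y \<in> carrier (localization P)"
    then obtain b u where y: "y = local_frac P b u" "u \<notin> P" by (rule localization_cases)
    show "x \<otimes>\<^bsub>localization P\<^esub> y \<in> carrier (localization P)" using x y by (simp add: s)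
    show "x \<otimes>\<^bsub>localization P\<^esub> y = y \<otimes>\<^bsub>localization P\<^esub> x" using x y by (simp add: s ac_simps)
    fix z assume "z \<in> carrier (localization P)"
    then obtain c v where z: "z = local_frac P c v" "v \<notin> P" by (rule localization_cases)
    show "x \<otimes>\<^bsub>localization P\<^esub> y \<otimes>\<^bsub>localization P\<^esub> z = x \<otimes>\<^bsub>localization P\<^esub> (y \<otimes>\<^bsub>localization P\<^esub> z)"
      using x y z by (simp add: s ac_simps)
  qed (simp add: s)
  ultimately show ?thesis
  proof (rule cringI)
    fix x y z assume "x \<in> carrier (localization P)" "y \<in> carrier (localization P)" "z \<in> carrier (localization P)"
    then obtain a t b u c v where x: "x = local_frac P a t" "t \<notin> P" 
      and y: "y = local_frac P b u" "u \<notin> P" and z: "z = local_frac P c v" "v \<notin> P"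
      by (metis localization_cases)
    show "(x \<oplus>\<^bsub>localization P\<^esub> y) \<otimes>\<^bsub>localization P\<^esub> z =
        x \<otimes>\<^bsub>localization P\<^esub> z \<oplus>\<^bsub>localization P\<^esub> y \<otimes>\<^bsub>localization P\<^esub> z"
      unfolding x y z using x y z by (simp add: s) (rule local_fracI, simp_all add: s algebra_simps)
  qed
qed

lemma localization_add_pow: "[n] \<cdot>\<^bsub>localization P\<^esub> \<one>\<^bsub>localization P\<^esub> = local_frac P (of_nat n) 1"
proof (induction n)
  interpret cring "localization P" by (rule cring_localization)
  case 0 show ?case by (simp only: add.nat_pow_0 localization_zero_one of_nat_0)
next
  interpret cring "localization P" by (rule cring_localization)
  case (Suc n) then show ?case
    by (simp only: add.nat_pow_Suc) (simp add: localization_zero_one localization_add one_notin ac_simps)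
qed

lemma genideal_localization:
  "Idl\<^bsub>localization P\<^esub> ((\<lambda>a. local_frac P a 1) ` P) = {local_frac P a s | a s. a \<in> P \<and> s \<notin> P}"
proof -
  interpret cring "localization P" by (rule cring_localization)
  define I where "I = Idl\<^bsub>localization P\<^esub> ((\<lambda>a. local_frac P a 1) ` P)"
  define M where "M = {local_frac P a s | a s. a \<in> P \<and> s \<notin> P}"
  note PP = primeideal_typeD[OF P]
  have memM: "local_frac P a t \<in> M" if "a \<in> P" "t \<notin> P" for a t using that M_def by blast
  have memME: thesis if "x \<in> M" "\<And>a t. x = local_frac P a t \<Longrightarrow> a \<in> P \<Longrightarrow> t \<notin> P \<Longrightarrow> thesis" for x thesis
    using that M_def by blast
  have "ideal M (localization P)"
  proof (rule idealI)
    show "subgroup M (add_monoid (localization P))"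
    proof (rule group.subgroupI[OF add.is_group])
      show "M \<subseteq> carrier (add_monoid (localization P))"
        by (auto elim!: memME intro: localization_closed)
      show "M \<noteq> {}" using memM[OF PP(2) one_notin] by blast
      fix x assume "x \<in> M"
      then obtain a t where x: "x = local_frac P a t" "a \<in> P" "t \<notin> P" by (rule memME)
      have "local_frac P (-a) t \<oplus>\<^bsub>localization P\<^esub> x = \<zero>\<^bsub>localization P\<^esub>"
        unfolding x(1) localization_add[OF x(3) x(3)] localization_zero_one
        by (rule local_fracI) (simp_all add: x one_notin mult_notin)
      then have "\<ominus>\<^bsub>localization P\<^esub> x = local_frac P (-a) t"
        using x by (intro minus_equality) (simp_all add: localization_closed)
      then show "inv\<^bsub>add_monoid (localization P)\<^esub> x \<in> M"
        using memM[OF PP(7)[OF x(2)] x(3)] unfolding a_inv_def by simp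
      fix y assume "y \<in> M"
      then obtain b u where y: "y = local_frac P b u" "b \<in> P" "u \<notin> P" by (rule memME)
      have "local_frac P (a * u + b * t) (t * u) \<in> M"
        using x y by (intro memM PP(6) PP(4) mult_notin)
      then show "x \<otimes>\<^bsub>add_monoid (localization P)\<^esub> y \<in> M" using x y by (simp add: localization_add)
    qed
    fix x y assume "x \<in> M" and y: "y \<in> carrier (localization P)"
    from \<open>x \<in> M\<close> obtain a t where x: "x = local_frac P a t" "a \<in> P" "t \<notin> P" by (rule memME)
    from y obtain b u where y: "y = local_frac P b u" "u \<notin> P" by (rule localization_cases)
    show "x \<otimes>\<^bsub>localization P\<^esub> y \<in> M"
      unfolding x(1) y(1) localization_mult[OF x(3) y(2)] using x y by (intro memM PP(4) mult_notin)
    show "y \<otimes>\<^bsub>localization P\<^esub> x \<in> M"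
      unfolding x(1) y(1) localization_mult[OF y(2) x(3)] using x y by (intro memM PP(5) mult_notin)
  qed (rule ring_axioms)
  then have "I \<subseteq> M" unfolding I_def
    by (rule genideal_minimal) (use memM one_notin in blast)
  have sub: "(\<lambda>a. local_frac P a 1) ` P \<subseteq> carrier (localization P)"
    using localization_closed[OF one_notin] by blast
  have "M \<subseteq> I"
  proof (rule subsetI, erule memME)
    fix x a t assume a: "x = local_frac P a t" "a \<in> P" "t \<notin> P"
    interpret I: ideal I "localization P" unfolding I_def by (rule genideal_ideal[OF sub])
    have "local_frac P a 1 \<in> I" using genideal_self[OF sub] a unfolding I_def by blast
    then have "local_frac P 1 t \<otimes>\<^bsub>localization P\<^esub> local_frac P a 1 \<in> I"
      by (rule I.I_l_closed) (rule localization_closed[OF a(3)])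
    then show "x \<in> I" unfolding a(1) localization_mult[OF a(3) one_notin] by simp
  qed
  with \<open>I \<subseteq> M\<close> show ?thesis unfolding I_def M_def by (rule equalityI)
qed

lemma char_zero_residue_field_iff: "char_zero (residue_field P) \<longleftrightarrow> (\<forall>n>0. of_nat n \<notin> P)"
proof -
  interpret cring "localization P" by (rule cring_localization)
  let ?I = "Idl\<^bsub>localization P\<^esub> ((\<lambda>a. local_frac P a 1) ` P)"
  have sub: "(\<lambda>a. local_frac P a 1) ` P \<subseteq> carrier (localization P)"
    using one_notin by (auto intro: localization_closed)
  interpret I: ideal ?I "localization P" by (rule genideal_ideal[OF sub])
  have pw: "[n] \<cdot>\<^bsub>residue_field P\<^esub> \<one>\<^bsub>residue_field P\<^esub> = ?I +>\<^bsub>localization P\<^esub> local_frac P (of_nat n) 1" for n :: nat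
  proof -
    interpret h: ring_hom_ring "localization P" "residue_field P" "(+>\<^bsub>localization P\<^esub>) ?I"
      unfolding residue_field_def by (rule I.rcos_ring_hom_ring)
    show ?thesis unfolding localization_add_pow[symmetric]
    proof (induction n)
      case 0 show ?case by (metis h.S.add.nat_pow_0 h.hom_zero add.nat_pow_0)
    next
      case (Suc n)
      then show ?case by (simp add: h.hom_add h.hom_one)
    qed
  qed
  have "?I +>\<^bsub>localization P\<^esub> x = \<zero>\<^bsub>residue_field P\<^esub> \<longleftrightarrow> x \<in> ?I" if "x \<in> carrier (localization P)" for x
    unfolding residue_field_def FactRing_def using that I.a_rcos_const[of x] I.a_rcos_self[of x] by auto
  moreover have "local_frac P (of_nat n) 1 \<in> ?I \<longleftrightarrow> of_nat n \<in> P" for n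
  proof
    assume "local_frac P (of_nat n) 1 \<in> ?I"
    then obtain a t where a: "a \<in> P" "t \<notin> P" "local_frac P (of_nat n) 1 = local_frac P a t"
      unfolding genideal_localization by blast
    then obtain u where u: "u \<notin> P" "u * (of_nat n * t - a) = 0"
      using one_notin by (auto simp: local_frac_eq_iff)
    then have "u * t * of_nat n = u * a" by (simp add: algebra_simps)
    then have "u * t * of_nat n \<in> P" using primeideal_typeD(5)[OF P a(1)] by simp
    then show "of_nat n \<in> P" using primeideal_typeD(3)[OF P] u(1) a(2) by blast
  qed (use one_notin in \<open>auto simp: genideal_localization\<close>)
  ultimately show ?thesis
    unfolding char_zero_def pw using localization_closed[OF one_notin] by blast
qed

end


section \<open>Differential rings\<close>

definition derivation :: "('a::comm_ring_1 \<Rightarrow> 'a) \<Rightarrow> bool"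
  where "derivation D \<longleftrightarrow>
    (\<forall>a b. D (a + b) = D a + D b) \<and> (\<forall>a b. D (a * b) = D a * b + a * D b)"

definition diff_spec :: "('a, 'm) ring_scheme \<Rightarrow> ('a \<Rightarrow> 'a) \<Rightarrow> 'a set set"
  where "diff_spec A D = {P. primeideal P A \<and> D ` P \<subseteq> P}"

definition standard_diff_ring :: "('a::comm_ring_1 \<Rightarrow> 'a) \<Rightarrow> bool"
  where "standard_diff_ring D \<longleftrightarrow> (\<forall>P\<in>diff_spec ring_of_type_algebra D. char_zero (residue_field P))"

text \<open>
  The indeterminate \<open>(i, j)\<close> stands for the \<open>j\<close>-th derivative of the \<open>i\<close>-th differential
  indeterminate.  \<open>diff_poly_deriv D\<close> is the derivation that extends \<open>D\<close> on
  the coefficients and sends \<open>(i, j)\<close> to \<open>(i, j + 1)\<close>: a term \<open>c m\<close> goes to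
  \<open>D(c) m + \<Sum>\<^sub>v c (\<partial>m/\<partial>v) v'\<close>, where \<open>v\<close> runs through the indeterminates in \<open>m\<close>.
\<close>

definition diff_poly_ring :: "nat \<Rightarrow> ((nat \<times> nat \<Rightarrow>\<^sub>0 nat) \<Rightarrow>\<^sub>0 'a::comm_ring_1) ring"
  where "diff_poly_ring n = poly_ring ({..<n} \<times> UNIV)"

definition diff_poly_deriv ::
  "('a::comm_ring_1 \<Rightarrow> 'a) \<Rightarrow> ((nat \<times> nat \<Rightarrow>\<^sub>0 nat) \<Rightarrow>\<^sub>0 'a) \<Rightarrow> ((nat \<times> nat \<Rightarrow>\<^sub>0 nat) \<Rightarrow>\<^sub>0 'a)"
  where "diff_poly_deriv D p = (\<Sum>m\<in>Poly_Mapping.keys p.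
    Poly_Mapping.single m (D (Poly_Mapping.lookup p m)) +
    (\<Sum>(i, j)\<in>Poly_Mapping.keys m.
      Poly_Mapping.single
        (m - Poly_Mapping.single (i, j) 1 + Poly_Mapping.single (i, Suc j) 1)
        (of_nat (Poly_Mapping.lookup m (i, j)) * Poly_Mapping.lookup p m)))"

definition term_deriv where "term_deriv D m c =  Poly_Mapping.single m (D c) +
    (\<Sum>(i, j)\<in>Poly_Mapping.keys m.
      Poly_Mapping.single
        (m - Poly_Mapping.single (i, j) 1 + Poly_Mapping.single (i, Suc j) 1)
        (of_nat (Poly_Mapping.lookup m (i, j)) * c))"

lemma diff_poly_deriv_eq: "diff_poly_deriv D p = (\<Sum>m\<in>Poly_Mapping.keys p. term_deriv D m (Poly_Mapping.lookup p m))"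
  by (simp add: diff_poly_deriv_def term_deriv_def)

context fixes D :: "'a::comm_ring_1 \<Rightarrow> 'a" assumes D: "derivation D"
begin

lemma D_zero: "D 0 = 0" and D_add: "D (a + b) = D a + D b" and D_mult: "D (a * b) = D a * b + a * D b" and D_one: "D 1 = 0"
proof -
  show a: "D (a + b) = D a + D b" for a b using D by (simp add: derivation_def)
  show m: "D (a * b) = D a * b + a * D b" for a b using D by (simp add: derivation_def)
  show "D 0 = 0" using a[of 0 0] by simp
  show "D 1 = 0" using m[of 1 1] by simp
qed

lemma term_deriv_0: "term_deriv D m 0 = 0" by (simp add: term_deriv_def D_zero split_def)
lemma coeff_term_deriv_add: "term_deriv D m (a + b) = term_deriv D m a + term_deriv D m b"
  by (simp add: term_deriv_def D_add single_add algebra_simps split_def sum.distrib)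

lemma diff_poly_deriv_superset: assumes "finite A" "Poly_Mapping.keys p \<subseteq> A"
  shows "diff_poly_deriv D p = (\<Sum>m\<in>A. term_deriv D m (Poly_Mapping.lookup p m))"
  unfolding diff_poly_deriv_eq using assms by (intro sum.mono_neutral_left) (auto simp: in_keys_iff term_deriv_0)

lemma diff_poly_deriv_add: "diff_poly_deriv D (p + q) = diff_poly_deriv D p + diff_poly_deriv D q"
proof -
  let ?A = "Poly_Mapping.keys p \<union> Poly_Mapping.keys q"
  have A: "Poly_Mapping.keys (p + q) \<subseteq> ?A" by (rule keys_add)
  show ?thesis
    by (simp add: diff_poly_deriv_superset[of ?A] A lookup_add coeff_term_deriv_add sum.distrib)
qed

lemma diff_poly_deriv_single: "diff_poly_deriv D (Poly_Mapping.single m c) = term_deriv D m c"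
  by (subst diff_poly_deriv_superset[of "{m}"]) auto

lemma diff_poly_deriv_const: "diff_poly_deriv D (Poly_Mapping.single 0 c) = Poly_Mapping.single 0 (D c)"
  by (simp add: diff_poly_deriv_single term_deriv_def)

lemma diff_poly_deriv_indet: "diff_poly_deriv D (Poly_Mapping.single (Poly_Mapping.single (i, j) 1) 1) = 
   Poly_Mapping.single (Poly_Mapping.single (i, Suc j) 1) 1"
  by (simp add: diff_poly_deriv_single term_deriv_def D_one)

lemma term_deriv_superset: assumes "finite A" "Poly_Mapping.keys m \<subseteq> A"
  shows "term_deriv D m c = Poly_Mapping.single m (D c) + (\<Sum>(i, j)\<in>A. Poly_Mapping.single (m - Poly_Mapping.single (i, j) 1 + Poly_Mapping.single (i, Suc j) 1) (of_nat (Poly_Mapping.lookup m (i, j)) * c))"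
  unfolding term_deriv_def using assms by (intro arg_cong2[where f="(+)"] refl sum.mono_neutral_left) (auto simp: in_keys_iff)

lemma minus_single_add:
  fixes m m' :: "'i \<Rightarrow>\<^sub>0 nat"
  assumes "Poly_Mapping.lookup m v \<noteq> 0"
  shows "m + m' - Poly_Mapping.single v 1 = (m - Poly_Mapping.single v 1) + m'"
  using assms by (intro poly_mapping_eqI) (auto simp: lookup_add lookup_minus lookup_single when_def)

definition indet_part :: "(nat \<times> nat \<Rightarrow>\<^sub>0 nat) \<Rightarrow> nat \<times> nat \<Rightarrow> 'a \<Rightarrow> ((nat \<times> nat \<Rightarrow>\<^sub>0 nat) \<Rightarrow>\<^sub>0 'a)" where "indet_part m v c = Poly_Mapping.single (m - Poly_Mapping.single v 1 + Poly_Mapping.single (fst v, Suc (snd v)) 1) (of_nat (Poly_Mapping.lookup m v) * c)"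

lemma term_deriv_eq: fixes A :: "(nat \<times> nat) set" shows "finite A \<Longrightarrow> Poly_Mapping.keys m \<subseteq> A \<Longrightarrow> term_deriv D m c = Poly_Mapping.single m (D c) + (\<Sum>v\<in>A. indet_part m v c)"
  by (simp add: term_deriv_superset indet_part_def split_def)

lemma indet_part_mult: fixes v :: "nat \<times> nat" shows "indet_part (m + m') v (a * b) = indet_part m v a * Poly_Mapping.single m' b + Poly_Mapping.single m a * indet_part m' v b"
proof -
  have *: "Poly_Mapping.single (m + m' - Poly_Mapping.single v 1 + Poly_Mapping.single (fst v, Suc (snd v)) 1) (of_nat (Poly_Mapping.lookup m v) * (a * b)) = indet_part m v a * Poly_Mapping.single m' b" 
    for m m' :: "nat \<times> nat \<Rightarrow>\<^sub>0 nat" and a b :: 'a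
  proof (cases "Poly_Mapping.lookup m v = 0")
    case False
    show ?thesis
      unfolding indet_part_def mult_single minus_single_add[OF False] by (simp only: ac_simps)
  qed (simp add: indet_part_def)
  have "indet_part (m + m') v (a * b) = Poly_Mapping.single (m + m' - Poly_Mapping.single v 1 + Poly_Mapping.single (fst v, Suc (snd v)) 1) (of_nat (Poly_Mapping.lookup m v) * (a * b))
     + Poly_Mapping.single (m' + m - Poly_Mapping.single v 1 + Poly_Mapping.single (fst v, Suc (snd v)) 1) (of_nat (Poly_Mapping.lookup m' v) * (b * a))"
    unfolding indet_part_def add.commute[of m' m] lookup_add of_nat_add distrib_right single_add by (simp only: mult.commute[of b a])
  then show ?thesis unfolding * by (simp only: ac_simps)
qed

lemma term_deriv_mult: fixes m m' :: "nat \<times> nat \<Rightarrow>\<^sub>0 nat" shows "term_deriv D (m + m') (a * b) = term_deriv D m a * Poly_Mapping.single m' b + Poly_Mapping.single m a * term_deriv D m' b"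
proof -
  let ?A = "Poly_Mapping.keys m \<union> Poly_Mapping.keys m'"
  have sup: "finite ?A" "Poly_Mapping.keys m \<subseteq> ?A" "Poly_Mapping.keys m' \<subseteq> ?A" "Poly_Mapping.keys (m + m') \<subseteq> ?A"
    using keys_add[of m m'] by auto
  show ?thesis
    unfolding term_deriv_eq[OF sup(1,2)] term_deriv_eq[OF sup(1,3)] term_deriv_eq[OF sup(1,4)] indet_part_mult
      distrib_left distrib_right sum.distrib sum_distrib_left sum_distrib_right mult_single D_mult single_add
    by (simp only: ac_simps)
qed

lemma poly_single_sum: "p = (\<Sum>m\<in>Poly_Mapping.keys p. Poly_Mapping.single m (Poly_Mapping.lookup p m))"
proof (rule poly_mapping_eqI)
  fix k
  have "Poly_Mapping.lookup (\<Sum>m\<in>Poly_Mapping.keys p. Poly_Mapping.single m (Poly_Mapping.lookup p m)) k = (\<Sum>m\<in>Poly_Mapping.keys p. if m = k then Poly_Mapping.lookup p m else 0)"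
    unfolding lookup_sum lookup_single when_def ..
  also have "\<dots> = Poly_Mapping.lookup p k" by (subst sum.delta) (auto simp: in_keys_iff)
  finally show "Poly_Mapping.lookup p k = Poly_Mapping.lookup (\<Sum>m\<in>Poly_Mapping.keys p. Poly_Mapping.single m (Poly_Mapping.lookup p m)) k" ..
qed

lemma diff_poly_deriv_sum: "diff_poly_deriv D (sum f A) = (\<Sum>x\<in>A. diff_poly_deriv D (f x))"
  by (induction A rule: infinite_finite_induct) (auto simp: diff_poly_deriv_add diff_poly_deriv_eq[of _ 0])

lemma derivation_diff_poly_deriv: "derivation (diff_poly_deriv D)"
  unfolding derivation_def
proof (intro conjI allI)
  fix p q
  show "diff_poly_deriv D (p + q) = diff_poly_deriv D p + diff_poly_deriv D q" by (rule diff_poly_deriv_add)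
  let ?P = "Poly_Mapping.keys p" and ?Q = "Poly_Mapping.keys q"
  have "p * q = (\<Sum>m\<in>?P. \<Sum>m'\<in>?Q. Poly_Mapping.single (m + m') (Poly_Mapping.lookup p m * Poly_Mapping.lookup q m'))"
    by (subst poly_single_sum[of p], subst poly_single_sum[of q]) (simp only: sum_product mult_single)
  then have "diff_poly_deriv D (p * q) = (\<Sum>m\<in>?P. \<Sum>m'\<in>?Q.
     term_deriv D m (Poly_Mapping.lookup p m) * Poly_Mapping.single m' (Poly_Mapping.lookup q m') + Poly_Mapping.single m (Poly_Mapping.lookup p m) * term_deriv D m' (Poly_Mapping.lookup q m'))"
    by (simp only: diff_poly_deriv_sum diff_poly_deriv_single term_deriv_mult)
  also have "\<dots> = diff_poly_deriv D p * (\<Sum>m'\<in>?Q. Poly_Mapping.single m' (Poly_Mapping.lookup q m')) +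
     (\<Sum>m\<in>?P. Poly_Mapping.single m (Poly_Mapping.lookup p m)) * diff_poly_deriv D q"
    by (simp only: sum_product diff_poly_deriv_eq sum.distrib)
  finally show "diff_poly_deriv D (p * q) = diff_poly_deriv D p * q + p * diff_poly_deriv D q"
    unfolding poly_single_sum[of p, symmetric] poly_single_sum[of q, symmetric] .
qed

lemma diff_poly_deriv_closed: assumes "p \<in> polys_in (I \<times> UNIV)" shows "diff_poly_deriv D p \<in> polys_in (I \<times> UNIV)"
proof -
  have sum: "sum f A \<in> polys_in J" if "\<And>x. x \<in> A \<Longrightarrow> f x \<in> polys_in J" for f :: "'x \<Rightarrow> ('j \<Rightarrow>\<^sub>0 nat) \<Rightarrow>\<^sub>0 'a" and A J
    using that by (induction A rule: infinite_finite_induct) (auto simp: polys_in_add polys_in_0)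
  have keys_minus: "Poly_Mapping.keys (m - m') \<subseteq> Poly_Mapping.keys m" for m m' :: "'j \<Rightarrow>\<^sub>0 nat"
    by (auto simp: in_keys_iff lookup_minus)
  have t: "term_deriv D m c \<in> polys_in (I \<times> UNIV)" if m: "Poly_Mapping.keys m \<subseteq> I \<times> UNIV" for m c
    unfolding term_deriv_def
  proof (intro polys_in_add sum)
    show "Poly_Mapping.single m (D c) \<in> polys_in (I \<times> UNIV)" using m by (auto simp: polys_in_def)
    fix v assume "v \<in> Poly_Mapping.keys m"
    then have "Poly_Mapping.keys (m - Poly_Mapping.single v 1 + Poly_Mapping.single (fst v, Suc (snd v)) 1) \<subseteq> I \<times> UNIV"
      using keys_add[of "m - Poly_Mapping.single v 1" "Poly_Mapping.single (fst v, Suc (snd v)) 1"] keys_minus[of m "Poly_Mapping.single v 1"] m by (force split: if_splits)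
    then show "(case v of (i, j) \<Rightarrow> Poly_Mapping.single (m - Poly_Mapping.single (i, j) 1 + Poly_Mapping.single (i, Suc j) 1) (of_nat (Poly_Mapping.lookup m (i, j)) * c)) \<in> polys_in (I \<times> UNIV)"
      by (auto simp: polys_in_def split_def)
  qed
  have k: "Poly_Mapping.keys m \<subseteq> I \<times> UNIV" if "m \<in> Poly_Mapping.keys p" for m
    using assms that unfolding polys_in_def by blast
  show ?thesis unfolding diff_poly_deriv_eq by (intro sum t k)
qed
end


section \<open>The gap measure, differential type and differential dimension\<close>

definition descending :: "'a set set \<Rightarrow> 'a set \<Rightarrow> 'a set \<Rightarrow> (nat \<Rightarrow> 'a set) \<Rightarrow> bool"
  where "descending S p p' c \<longleftrightarrow>
    c 0 = p \<and> (\<forall>i. c i \<in> S \<and> c (Suc i) \<subset> c i \<and> p' \<subseteq> c i)"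

text \<open>
  The values of a gap measure are nonnegative by typing.  Outside its domain, the pairs
  \<open>p \<supseteq> p'\<close> in \<open>S\<close>, it is set to \<open>0\<close>, so that it is unique as a total function.
\<close>

definition is_gap_measure :: "'a set set \<Rightarrow> ('a set \<Rightarrow> 'a set \<Rightarrow> enat) \<Rightarrow> bool"
  where "is_gap_measure S \<mu> \<longleftrightarrow>
    (\<forall>p p'. \<not> (p \<in> S \<and> p' \<in> S \<and> p' \<subseteq> p) \<longrightarrow> \<mu> p p' = 0) \<and>
    (\<forall>p\<in>S. \<forall>p'\<in>S. p' \<subseteq> p \<longrightarrow>
      (\<mu> p p' = 0 \<longleftrightarrow> p = p' \<or> \<not> (\<exists>c. descending S p p' c)) \<and>
      (\<forall>d::nat. d > 0 \<longrightarrow>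
        (\<mu> p p' \<ge> enat d \<longleftrightarrow>
          p \<noteq> p' \<and> (\<exists>c. descending S p p' c \<and> (\<forall>i\<ge>1. \<mu> (c (i - 1)) (c i) \<ge> enat (d - 1))))))"

definition gap_measure :: "'a set set \<Rightarrow> 'a set \<Rightarrow> 'a set \<Rightarrow> enat"
  where "gap_measure S = (THE \<mu>. is_gap_measure S \<mu>)"

fun gap_ge :: "nat \<Rightarrow> 'a set set \<Rightarrow> 'a set \<Rightarrow> 'a set \<Rightarrow> bool" where
  "gap_ge 0 S p p' = True"
| "gap_ge (Suc d) S p p' \<longleftrightarrow> p \<noteq> p' \<and> (\<exists>c. descending S p p' c \<and> (\<forall>i. gap_ge d S (c i) (c (Suc i))))"

lemma gap_ge_antimono: "gap_ge e S p p'" if "gap_ge d S p p'" "e \<le> d"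
proof -
  have *: "gap_ge (Suc d) S p p' \<Longrightarrow> gap_ge d S p p'" for d p p'
  proof (induction d arbitrary: p p')
    case (Suc d)
    from Suc.prems obtain c where "p \<noteq> p'" "descending S p p' c"
      "\<forall>i. gap_ge (Suc d) S (c i) (c (Suc i))" by auto
    moreover from this Suc.IH have "\<forall>i. gap_ge d S (c i) (c (Suc i))" by blast
    ultimately show ?case by auto
  qed simp
  from that(2,1) show ?thesis
    by (induction rule: inc_induct) (simp, blast intro: *)
qed

lemma enat_le_Sup_iff:
  assumes "\<And>d e. P d \<Longrightarrow> e \<le> d \<Longrightarrow> P e" "P 0"
  shows "enat d \<le> (SUP k\<in>{k. P k}. enat k) \<longleftrightarrow> P d"
proof
  assume *: "enat d \<le> (SUP k\<in>{k. P k}. enat k)"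
  show "P d"
  proof (rule ccontr)
    assume "\<not> P d"
    then have lt: "k < d" if "P k" for k using assms(1)[OF that] by (meson not_less)
    with assms(2) have "0 < d" by blast
    have "(SUP k\<in>{k. P k}. enat k) \<le> enat (d - 1)"
      using lt by (intro SUP_least) (force simp: less_eq_Suc_le)
    with * \<open>0 < d\<close> show False using order.trans by fastforce
  qed
qed (auto intro: SUP_upper)

lemma all_ge1_iff: "(\<forall>i\<ge>Suc 0. Q (i - Suc 0) i) \<longleftrightarrow> (\<forall>i. Q i (Suc i))"
  by (metis Suc_le_D diff_Suc_Suc diff_zero le_add1 plus_1_eq_Suc One_nat_def)

lemma gap_measure_ge_iff:
  assumes "is_gap_measure S \<mu>" "p \<in> S" "p' \<in> S" "p' \<subseteq> p"
  shows "\<mu> p p' \<ge> enat d \<longleftrightarrow> gap_ge d S p p'"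
  using assms(2-4)
proof (induction d arbitrary: p p')
  case 0
  then show ?case by (simp flip: zero_enat_def)
next
  case (Suc d)
  have gm: "\<forall>p\<in>S. \<forall>p'\<in>S. p' \<subseteq> p \<longrightarrow> (\<forall>d::nat. d > 0 \<longrightarrow>
        (\<mu> p p' \<ge> enat d \<longleftrightarrow>
          p \<noteq> p' \<and> (\<exists>c. descending S p p' c \<and> (\<forall>i\<ge>1. \<mu> (c (i - 1)) (c i) \<ge> enat (d - 1)))))"
    using assms(1) unfolding is_gap_measure_def by blast
  have "\<mu> p p' \<ge> enat (Suc d) \<longleftrightarrow> p \<noteq> p' \<and>
      (\<exists>c. descending S p p' c \<and> (\<forall>i\<ge>1. \<mu> (c (i - 1)) (c i) \<ge> enat d))"
    using gm[rule_format, OF Suc.prems, of "Suc d"] by simp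
  also have "\<dots> \<longleftrightarrow> p \<noteq> p' \<and>
      (\<exists>c. descending S p p' c \<and> (\<forall>i. \<mu> (c i) (c (Suc i)) \<ge> enat d))"
    unfolding One_nat_def by (subst all_ge1_iff) simp
  also have "\<dots> \<longleftrightarrow> p \<noteq> p' \<and> (\<exists>c. descending S p p' c \<and> (\<forall>i. gap_ge d S (c i) (c (Suc i))))"
  proof -
    have "\<mu> (c i) (c (Suc i)) \<ge> enat d \<longleftrightarrow> gap_ge d S (c i) (c (Suc i))"
      if "descending S p p' c" for c i
      using that by (intro Suc.IH) (auto simp: descending_def)
    then show ?thesis by (metis (no_types))
  qed
  finally show ?case by simp
qed

lemma enat_leI: "x \<le> y" if "\<And>d. enat d \<le> x \<Longrightarrow> enat d \<le> y"
proof (cases x)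
  case (enat n)
  then show ?thesis using that[of n] by simp
next
  case infinity
  then show ?thesis using that[of "Suc (the_enat y)"] by (cases y) auto
qed

lemma ex1_gap_measure: "\<exists>!\<mu>. is_gap_measure S \<mu>"
proof
  define \<nu> where
    "\<nu> p p' = (if p \<in> S \<and> p' \<in> S \<and> p' \<subseteq> p then (SUP k\<in>{k. gap_ge k S p p'}. enat k) else 0)" for p p'
  have ge: "enat d \<le> \<nu> p p' \<longleftrightarrow> gap_ge d S p p'" if "p \<in> S" "p' \<in> S" "p' \<subseteq> p" for d p p'
    using that enat_le_Sup_iff[of "\<lambda>k. gap_ge k S p p'", OF gap_ge_antimono] by (simp add: \<nu>_def)
  have step: "enat d \<le> \<nu> p p' \<longleftrightarrow> p \<noteq> p' \<and>
      (\<exists>c. descending S p p' c \<and> (\<forall>i\<ge>1. enat (d - 1) \<le> \<nu> (c (i - 1)) (c i)))"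
    if p: "p \<in> S" "p' \<in> S" "p' \<subseteq> p" and d: "d > 0" for d p p'
  proof -
    have c: "(\<forall>i\<ge>1. enat (d - 1) \<le> \<nu> (c (i - 1)) (c i)) \<longleftrightarrow> (\<forall>i. gap_ge (d - 1) S (c i) (c (Suc i)))"
      if "descending S p p' c" for c
    proof -
      have "(\<forall>i\<ge>1. enat (d - 1) \<le> \<nu> (c (i - 1)) (c i)) \<longleftrightarrow> (\<forall>i. enat (d - 1) \<le> \<nu> (c i) (c (Suc i)))"
        unfolding One_nat_def by (rule all_ge1_iff)
      also have "\<dots> \<longleftrightarrow> (\<forall>i. gap_ge (d - 1) S (c i) (c (Suc i)))"
        using that by (intro all_cong1 ge) (auto simp: descending_def)
      finally show ?thesis .
    qed
    have "gap_ge d S p p' \<longleftrightarrow> p \<noteq> p' \<and> (\<exists>c. descending S p p' c \<and> (\<forall>i. gap_ge (d - 1) S (c i) (c (Suc i))))"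
      using d by (cases d) auto
    also have "\<dots> \<longleftrightarrow> p \<noteq> p' \<and>
        (\<exists>c. descending S p p' c \<and> (\<forall>i\<ge>1. enat (d - 1) \<le> \<nu> (c (i - 1)) (c i)))"
      using c by (metis (no_types))
    finally show ?thesis using ge[OF p] by simp
  qed
  have zero: "\<nu> p p' = 0 \<longleftrightarrow> p = p' \<or> \<not> (\<exists>c. descending S p p' c)"
    if p: "p \<in> S" "p' \<in> S" "p' \<subseteq> p" for p p'
  proof -
    have "\<nu> p p' = 0 \<longleftrightarrow> \<not> enat 1 \<le> \<nu> p p'"
      by (simp add: Suc_ile_eq flip: zero_enat_def)
    with ge[OF p, of 1] show ?thesis by auto
  qed
  show "is_gap_measure S \<nu>"
    unfolding is_gap_measure_def
  proof (intro conjI ballI impI)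
    show "\<forall>p p'. \<not> (p \<in> S \<and> p' \<in> S \<and> p' \<subseteq> p) \<longrightarrow> \<nu> p p' = 0"
      unfolding \<nu>_def by (intro allI impI) (rule if_not_P)
    fix p p' assume p: "p \<in> S" "p' \<in> S" "p' \<subseteq> p"
    show "\<nu> p p' = 0 \<longleftrightarrow> p = p' \<or> \<not> (\<exists>c. descending S p p' c)"
      by (rule zero[OF p])
    show "\<forall>d::nat. d > 0 \<longrightarrow> (\<nu> p p' \<ge> enat d \<longleftrightarrow>
        p \<noteq> p' \<and> (\<exists>c. descending S p p' c \<and> (\<forall>i\<ge>1. \<nu> (c (i - 1)) (c i) \<ge> enat (d - 1))))"
      by (intro allI impI step[OF p])
  qed
  show "\<mu> = \<nu>" if "is_gap_measure S \<mu>" for \<mu>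
  proof (intro ext)
    fix p p'
    show "\<mu> p p' = \<nu> p p'"
    proof (cases "p \<in> S \<and> p' \<in> S \<and> p' \<subseteq> p")
      case True
      then have p: "p \<in> S" "p' \<in> S" "p' \<subseteq> p" by auto
      show ?thesis
        by (rule order_antisym; rule enat_leI)
           (simp_all only: ge[OF p] gap_measure_ge_iff[OF that p])
    next
      case False
      then have "\<mu> p p' = 0" using that unfolding is_gap_measure_def by blast
      moreover have "\<nu> p p' = 0" unfolding \<nu>_def using False by (rule if_not_P)
      ultimately show ?thesis by simp
    qed
  qed
qed

lemma is_gap_measure_gap_measure: "is_gap_measure S (gap_measure S)"
  unfolding gap_measure_def by (rule theI'[OF ex1_gap_measure])

definition diff_type :: "('a, 'm) ring_scheme \<Rightarrow> ('a \<Rightarrow> 'a) \<Rightarrow> enat"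
  where "diff_type A D = Sup {gap_measure (diff_spec A D) p p' | p p'.
    p \<in> diff_spec A D \<and> p' \<in> diff_spec A D \<and> p' \<subseteq> p}"

definition diff_dim :: "('a, 'm) ring_scheme \<Rightarrow> ('a \<Rightarrow> 'a) \<Rightarrow> enat"
  where "diff_dim A D =
    (SUP k \<in> {k. \<exists>c :: nat \<Rightarrow> 'a set. (\<forall>i\<le>k. c i \<in> diff_spec A D) \<and>
        (\<forall>i\<in>{1..k}. c i \<subset> c (i - 1) \<and>
          gap_measure (diff_spec A D) (c (i - 1)) (c i) = diff_type A D)}. enat k)"

end

theory Submission
  imports Defs
begin

text \<open>
  For primes \<open>Q \<subseteq> Q'\<close> of a polynomial ring over \<open>R\<close>, lying over \<open>q \<subseteq> p\<close>, and a finite set \<open>V\<close> of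
  indeterminates, the transcendence degree of \<open>V\<close> modulo \<open>Q'\<close> over the residue field of \<open>p\<close> may exceed
  the one modulo \<open>Q\<close> over the residue field of \<open>q\<close>, say by \<open>h\<close>. As for Abhyankar's inequality, one
  then finds \<open>h\<close> fractions over \<open>R/q\<close> that are algebraically independent modulo some prime over \<open>p\<close>
  (the predicate \<open>gain q p h\<close>). Counting transcendence degrees along chains of primes expresses
  \<open>dim R[x\<^sub>1,\<dots>,x\<^sub>n]\<close> through the possible gains. It follows that \<open>d\<^sub>R = 1 + e\<close>, where \<open>e\<close> is the largest
  number of steps with arbitrarily large gain in one chain of primes of \<open>R\<close>.

  For a differential prime \<open>Q\<close> of \<open>R{z\<^sub>1,\<dots>,z\<^sub>n}\<close>, the transcendence degree of the indeterminates of
  order \<open>< k\<close> modulo \<open>Q\<close> is \<open>d k + c\<close> for large \<open>k\<close>, where \<open>d \<le> n\<close>. An infinite descending chain of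
  differential primes becomes constant on \<open>R\<close>, and from there on the transcendence degrees of large
  order increase strictly, so that \<open>d\<close> is larger for the intersection. If all gains were bounded, \<open>d\<close>
  would never decrease when one passes to a smaller differential prime. A chain of \<open>n + 1\<close> gaps would
  thus give a differential prime with \<open>d > n\<close>. Hence the gains are unbounded, and \<open>e \<ge> 1\<close>.
\<close>

text \<open>An inequality like the one behind \<open>gain\<close> is usually proved with a valuation
  that dominates the larger prime. Here finitely many elements of \<open>R\<close> suffice. Let
  \<open>b\<close> be the rank of \<open>V\<close> modulo \<open>Q\<close>. Any \<open>b + 1\<close>
  elements of \<open>V\<close> satisfy a relation modulo \<open>Q\<close>, and \<open>E\<close>
  collects the products of one coefficient from each relation. Division by an \<open>e\<close> in
  \<open>E\<close> that plays the part of an element of least value normalises all relations at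
  once: the coefficients become fractions in \<open>E/e\<close>, one of them is 1, and no relation
  becomes trivial modulo a prime over \<open>Q'\<close>. Such an \<open>e\<close> belongs to a chart
  of the blow-up of the ideal generated by \<open>E\<close>: if the fibre over \<open>Q'\<close>
  were empty in every chart, Nakayama's lemma would put a power of that ideal into \<open>Q\<close>.
  The linear growth of the transcendence degree rests on characteristic zero, where the derivative
  of a minimal relation does not vanish, so that derivatives of algebraic elements are algebraic.
  The differential type of \<open>R{z_1,...,z_n}\<close> is never computed. It is at least 1, so
  each gap counted by the differential dimension contains an infinite descending chain.\<close>

abbreviation (input) lookup :: "('a \<Rightarrow>\<^sub>0 'b::zero) \<Rightarrow> 'a \<Rightarrow> 'b" where "lookup \<equiv> Poly_Mapping.lookup"
abbreviation (input) keys :: "('a \<Rightarrow>\<^sub>0 'b::zero) \<Rightarrow> 'a set" where "keys \<equiv> Poly_Mapping.keys"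
abbreviation (input) single :: "'a \<Rightarrow> 'b::zero \<Rightarrow> ('a \<Rightarrow>\<^sub>0 'b)" where "single \<equiv> Poly_Mapping.single"
abbreviation (input) degree :: "'a::zero poly \<Rightarrow> nat" where "degree \<equiv> Polynomial.degree"

section \<open>Prime ideals and ring maps\<close>

text \<open>Primes are subsets of a whole type, without a carrier. Those of
  \<open>poly_ring V\<close> are later extended to the full polynomial type and compared on
  \<open>polys_in V\<close>.\<close>

locale prime_id =
  fixes Q :: "'b::comm_ring_1 set"
  assumes zero: "0 \<in> Q" and one: "1 \<notin> Q"
    and add: "a \<in> Q \<Longrightarrow> b \<in> Q \<Longrightarrow> a + b \<in> Q"
    and multr: "a \<in> Q \<Longrightarrow> a * b \<in> Q"
    and prime: "a * b \<in> Q \<Longrightarrow> a \<in> Q \<or> b \<in> Q"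
begin

lemma multl: "b \<in> Q \<Longrightarrow> a * b \<in> Q"
  using multr[of b a] by (simp add: mult.commute)

lemma uminus: "a \<in> Q \<Longrightarrow> - a \<in> Q"
  using multr[of a "-1"] by simp

lemma diff: "a \<in> Q \<Longrightarrow> b \<in> Q \<Longrightarrow> a - b \<in> Q"
  using add[of a "- b"] uminus[of b] by simp

lemma mult_notin: "a \<notin> Q \<Longrightarrow> b \<notin> Q \<Longrightarrow> a * b \<notin> Q"
  using prime by blast

lemma sum: "(\<And>x. x \<in> A \<Longrightarrow> f x \<in> Q) \<Longrightarrow> sum f A \<in> Q"
  by (induction A rule: infinite_finite_induct) (auto simp: zero add)

lemma prod_notin: "(\<And>x. x \<in> A \<Longrightarrow> f x \<notin> Q) \<Longrightarrow> prod f A \<notin> Q"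
  by (induction A rule: infinite_finite_induct) (auto simp: one dest: prime)

lemma power_notin: "a \<notin> Q \<Longrightarrow> a ^ n \<notin> Q"
  by (induction n) (auto simp: one dest: prime)

lemma add_cancel: "a \<in> Q \<Longrightarrow> a + b \<in> Q \<longleftrightarrow> b \<in> Q"
  using add diff[of "a + b" a] by auto

lemma diff_cong: "a - b \<in> Q \<Longrightarrow> a \<in> Q \<longleftrightarrow> b \<in> Q"
  using add_cancel[of "a - b" b] by simp

end

locale ring_map =
  fixes f :: "'b::comm_ring_1 \<Rightarrow> 'c::comm_ring_1"
  assumes map_one: "f 1 = 1"
    and map_add: "f (a + b) = f a + f b" and map_mult: "f (a * b) = f a * f b"
begin

lemma map_zero: "f 0 = 0"
  using map_add[of 0 0] by simp

lemma map_uminus: "f (- a) = - f a"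
  using map_add[of a "- a"] by (simp add: map_zero eq_neg_iff_add_eq_0 add.commute)

lemma map_diff: "f (a - b) = f a - f b"
  using map_add[of a "- b"] by (simp add: map_uminus)

lemma map_sum: "f (sum g A) = (\<Sum>x\<in>A. f (g x))"
  by (induction A rule: infinite_finite_induct) (auto simp: map_zero map_add)

lemma map_power: "f (a ^ n) = f a ^ n"
  by (induction n) (auto simp: map_one map_mult)

lemma prime_vimage: "prime_id Q \<Longrightarrow> prime_id (f -` Q)"
  unfolding prime_id_def by (auto simp: map_zero map_one map_add map_mult)

end

lemma ring_map_id: "ring_map (\<lambda>x. x)"
  by unfold_locales auto

lemma ring_map_comp: "ring_map f \<Longrightarrow> ring_map g \<Longrightarrow> ring_map (\<lambda>x. g (f x))"
  unfolding ring_map_def by auto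

lemma primeideal_type_iff:
  "primeideal P (ring_of_type_algebra :: 'b::comm_ring_1 ring) \<longleftrightarrow> prime_id P"
proof
  assume P: "primeideal P (ring_of_type_algebra :: 'b ring)"
  then show "prime_id P"
    using primeideal_typeD[OF P] unfolding prime_id_def by blast
next
  assume "prime_id P"
  then interpret prime_id P .
  let ?R = "ring_of_type_algebra :: 'b ring"
  interpret R: cring ?R by (rule cring_from_type_algebra)
  note s = ring_of_type_algebra_def
  show "primeideal P ?R"
  proof (rule primeidealI)
    show "ideal P ?R"
    proof (rule idealI)
      show "subgroup P (add_monoid ?R)"
      proof (rule group.subgroupI[OF R.add.is_group])
        fix a assume a: "a \<in> P"
        have "inv\<^bsub>add_monoid ?R\<^esub> a = \<ominus>\<^bsub>?R\<^esub> a" by (simp add: a_inv_def)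
        also have "\<dots> = - a"
          by (rule R.minus_equality) (simp_all add: s)
        finally show "inv\<^bsub>add_monoid ?R\<^esub> a \<in> P" using uminus[OF a] by simp
      qed (use zero in \<open>auto simp: s add\<close>)
    qed (auto simp: s multl multr R.ring_axioms[unfolded s])
  qed (use one in \<open>auto simp: s prime R.cring_axioms[unfolded s]\<close>)
qed

lemma prime_id_Inter_chain:
  fixes c :: "nat \<Rightarrow> 'b::comm_ring_1 set"
  assumes c: "\<And>i. prime_id (c i)" and dec: "\<And>i. c (Suc i) \<subseteq> c i"
  shows "prime_id (\<Inter>i. c i)"
proof
  fix a b assume ab: "a * b \<in> (\<Inter>i. c i)"
  show "a \<in> (\<Inter>i. c i) \<or> b \<in> (\<Inter>i. c i)"
  proof (rule ccontr)
    assume "\<not> ?thesis"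
    then obtain i j where "a \<notin> c i" "b \<notin> c j" by auto
    moreover have "c (max i j) \<subseteq> c i" "c (max i j) \<subseteq> c j"
      using lift_Suc_antimono_le[of c] dec by auto
    ultimately have "a \<notin> c (max i j)" "b \<notin> c (max i j)" by blast+
    then show False using ab prime_id.prime[OF c] by blast
  qed
qed (use c in \<open>auto simp: prime_id.zero prime_id.one prime_id.add prime_id.multr\<close>)

text \<open>An ideal maximal among those that contain \<open>J\<close> and miss \<open>M\<close> is
  prime: adjoining an element outside it meets \<open>M\<close>, and the product of two such
  meetings would lie in the ideal if the product of the two elements did.\<close>

lemma ex_prime_avoiding:
  fixes J M :: "'b::comm_ring_1 set"
  assumes J: "0 \<in> J" "\<And>a b. a \<in> J \<Longrightarrow> b \<in> J \<Longrightarrow> a + b \<in> J" "\<And>a b. a \<in> J \<Longrightarrow> a * b \<in> J"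
    and M: "1 \<in> M" "\<And>a b. a \<in> M \<Longrightarrow> b \<in> M \<Longrightarrow> a * b \<in> M"
    and JM: "J \<inter> M = {}"
  obtains P where "prime_id P" "J \<subseteq> P" "P \<inter> M = {}"
proof -
  define ideals where "ideals = {I. J \<subseteq> I \<and> I \<inter> M = {} \<and>
    (\<forall>a\<in>I. \<forall>b\<in>I. a + b \<in> I) \<and> (\<forall>a\<in>I. \<forall>b. a * b \<in> I)}"
  have "J \<in> ideals" using J JM by (auto simp: ideals_def)
  have "\<exists>P\<in>ideals. \<forall>L\<in>ideals. P \<subseteq> L \<longrightarrow> L = P"
  proof (rule subset_Zorn_nonempty)
    fix C assume C: "C \<noteq> {}" "subset.chain ideals C"
    have "a + b \<in> \<Union>C" if ab: "a \<in> \<Union>C" "b \<in> \<Union>C" for a b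
    proof -
      from ab obtain L Y where LY: "L \<in> C" "Y \<in> C" "a \<in> L" "b \<in> Y" by blast
      with C have "L \<subseteq> Y \<or> Y \<subseteq> L" unfolding subset.chain_def by blast
      then obtain Z where Z: "Z \<in> C" "a \<in> Z" "b \<in> Z" using LY by blast
      then have "Z \<in> ideals" using C unfolding subset.chain_def by blast
      then show ?thesis using Z unfolding ideals_def by blast
    qed
    moreover have "C \<subseteq> ideals" using C unfolding subset.chain_def by blast
    ultimately show "\<Union>C \<in> ideals" using C(1) unfolding ideals_def by blast
  qed (use \<open>J \<in> ideals\<close> in blast)
  then obtain P where P: "P \<in> ideals" and maxP: "\<And>L. L \<in> ideals \<Longrightarrow> P \<subseteq> L \<Longrightarrow> L = P" by blast
  have Padd: "a + b \<in> P" if "a \<in> P" "b \<in> P" for a b using P that by (auto simp: ideals_def)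
  have Pmult: "a * b \<in> P" "b * a \<in> P" if "a \<in> P" for a b
    using P that by (auto simp: ideals_def mult.commute[of b])
  have P0: "0 \<in> P" using P J(1) by (auto simp: ideals_def)
  have meet: "\<exists>p\<in>P. \<exists>r. p + a * r \<in> M" if a: "a \<notin> P" for a
  proof (rule ccontr)
    assume no: "\<not> ?thesis"
    define L where "L = {p + a * r | p r. p \<in> P}"
    have PL: "P \<subseteq> L" unfolding L_def by (force intro: exI[of _ 0])
    moreover have "a \<in> L" unfolding L_def using P0 by (force intro: exI[of _ 1])
    moreover have "L \<in> ideals"
      unfolding ideals_def mem_Collect_eq
    proof (intro conjI ballI allI)
      show "J \<subseteq> L" using PL P by (auto simp: ideals_def)
      show "L \<inter> M = {}" using no unfolding L_def by blast
      fix x assume "x \<in> L"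
      then obtain p r where x: "x = p + a * r" "p \<in> P" unfolding L_def by blast
      show "x * b \<in> L" for b
      proof -
        have "x * b = p * b + a * (r * b)" unfolding x by (simp add: algebra_simps)
        then show ?thesis unfolding L_def using Pmult[OF x(2)] by blast
      qed
      fix y assume "y \<in> L"
      then obtain q s where y: "y = q + a * s" "q \<in> P" unfolding L_def by blast
      have "x + y = (p + q) + a * (r + s)" unfolding x y by (simp add: algebra_simps)
      then show "x + y \<in> L" unfolding L_def using Padd[OF x(2) y(2)] by blast
    qed
    ultimately show False using maxP[of L] a by blast
  qed
  have "prime_id P"
  proof
    show "1 \<notin> P" using P M(1) by (auto simp: ideals_def)
    fix a b assume ab: "a * b \<in> P"
    show "a \<in> P \<or> b \<in> P"
    proof (rule ccontr)
      assume "\<not> ?thesis"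
      then obtain p r q s where p: "p \<in> P" "p + a * r \<in> M" and q: "q \<in> P" "q + b * s \<in> M"
        using meet[of a] meet[of b] by blast
      have "(p + a * r) * (q + b * s) = p * (q + b * s) + (q * (a * r) + (a * b) * (r * s))"
        by (simp add: algebra_simps)
      also have "\<dots> \<in> P" by (intro Padd Pmult p q ab)
      finally show False using M(2)[OF p(2) q(2)] P by (auto simp: ideals_def)
    qed
  qed (use P0 Padd Pmult in blast)+
  then show ?thesis using that P by (auto simp: ideals_def)
qed


section \<open>Algebraic elements modulo a prime ideal\<close>

locale subring_set =
  fixes A :: "'b::comm_ring_1 set"
  assumes zero_mem: "0 \<in> A" and one_mem: "1 \<in> A"
    and add_mem: "a \<in> A \<Longrightarrow> b \<in> A \<Longrightarrow> a + b \<in> A"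
    and mult_mem: "a \<in> A \<Longrightarrow> b \<in> A \<Longrightarrow> a * b \<in> A"
    and uminus_mem: "a \<in> A \<Longrightarrow> - a \<in> A"
begin

lemma diff_mem: "a \<in> A \<Longrightarrow> b \<in> A \<Longrightarrow> a - b \<in> A"
  using add_mem[of a "- b"] uminus_mem[of b] by simp

lemma sum_mem: "(\<And>x. x \<in> B \<Longrightarrow> f x \<in> A) \<Longrightarrow> sum f B \<in> A"
  by (induction B rule: infinite_finite_induct) (auto simp: zero_mem add_mem)

lemma power_mem: "a \<in> A \<Longrightarrow> a ^ n \<in> A"
  by (induction n) (auto simp: one_mem mult_mem)

end

definition coeffs_in :: "'b::zero set \<Rightarrow> 'b poly set"
  where "coeffs_in A = {g. \<forall>i. coeff g i \<in> A}"

text \<open>For a subring \<open>A\<close> and a prime \<open>Q\<close> this is algebraicity over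
  the fraction field of \<open>A\<close> modulo \<open>Q\<close>, written without fractions. The
  coefficient outside \<open>Q\<close> need not be the leading one, so the degree of
  \<open>g\<close> can exceed that of the relation modulo \<open>Q\<close>.\<close>

definition algebraic_mod :: "'b::comm_ring_1 set \<Rightarrow> 'b set \<Rightarrow> 'b \<Rightarrow> bool"
  where "algebraic_mod Q A x \<longleftrightarrow> (\<exists>g\<in>coeffs_in A. g \<notin> coeffs_in Q \<and> poly g x \<in> Q)"

lemma algebraic_mod_mono: "algebraic_mod Q A x \<Longrightarrow> A \<subseteq> B \<Longrightarrow> algebraic_mod Q B x"
  unfolding algebraic_mod_def coeffs_in_def by blast

lemma algebraic_mod_self:
  assumes "prime_id Q" "subring_set A" "x \<in> A" shows "algebraic_mod Q A x"
proof -
  interpret prime_id Q by fact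
  interpret subring_set A by fact
  show ?thesis
    unfolding algebraic_mod_def
  proof (intro bexI conjI)
    show "[:- x, 1:] \<in> coeffs_in A"
      using assms(3) by (auto simp: coeffs_in_def coeff_pCons zero_mem one_mem uminus_mem split: nat.split)
    show "[:- x, 1:] \<notin> coeffs_in Q"
      using one by (auto simp: coeffs_in_def intro!: exI[of _ 1])
    show "poly [:- x, 1:] x \<in> Q" using zero by simp
  qed
qed

lemma (in subring_set) coeffs_in_subring: "subring_set (coeffs_in A)"
  by unfold_locales
    (auto simp: coeffs_in_def zero_mem add_mem uminus_mem one_mem coeff_mult sum_mem mult_mem
      coeff_1)

lemma (in subring_set) poly_ring_adjoin: "subring_set {poly g y | g. g \<in> coeffs_in A}"
proof -
  interpret C: subring_set "coeffs_in A" by (rule coeffs_in_subring)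
  show ?thesis
  proof
    fix a b assume "a \<in> {poly g y | g. g \<in> coeffs_in A}" "b \<in> {poly g y | g. g \<in> coeffs_in A}"
    then obtain g h where *: "a = poly g y" "g \<in> coeffs_in A" "b = poly h y" "h \<in> coeffs_in A" by blast
    show "a + b \<in> {poly g y | g. g \<in> coeffs_in A}"
      using * C.add_mem[of g h] by (auto intro!: exI[of _ "g + h"])
    show "a * b \<in> {poly g y | g. g \<in> coeffs_in A}"
      using * C.mult_mem[of g h] by (auto intro!: exI[of _ "g * h"])
  next
    fix a assume "a \<in> {poly g y | g. g \<in> coeffs_in A}"
    then obtain g where *: "a = poly g y" "g \<in> coeffs_in A" by blast
    show "- a \<in> {poly g y | g. g \<in> coeffs_in A}"
      using * C.uminus_mem[of g] by (auto intro!: exI[of _ "- g"])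
  qed (use C.zero_mem C.one_mem in \<open>force intro: exI[of _ 0] exI[of _ 1]\<close>)+
qed

text \<open>If \<open>i\<close> and \<open>j\<close> are the lowest degrees of coefficients outside
  \<open>Q\<close>, all summands but one of the coefficient of degree \<open>i + j\<close> of the
  product lie in \<open>Q\<close>.\<close>

lemma (in prime_id) prime_coeffs_in: "prime_id (coeffs_in Q)"
proof
  fix f g assume fg: "f * g \<in> coeffs_in Q"
  show "f \<in> coeffs_in Q \<or> g \<in> coeffs_in Q"
  proof (rule ccontr)
    assume "\<not> ?thesis"
    then obtain i0 j0 where ij: "coeff f i0 \<notin> Q" "coeff g j0 \<notin> Q" by (auto simp: coeffs_in_def)
    define i where "i = (LEAST i. coeff f i \<notin> Q)"
    define j where "j = (LEAST j. coeff g j \<notin> Q)"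
    have i: "coeff f i \<notin> Q" and j: "coeff g j \<notin> Q"
      unfolding i_def j_def by (rule LeastI, rule ij)+
    have lti: "coeff f k \<in> Q" if "k < i" for k using not_less_Least[of k] that unfolding i_def by blast
    have ltj: "coeff g k \<in> Q" if "k < j" for k using not_less_Least[of k] that unfolding j_def by blast
    have "coeff (f * g) (i + j) = (\<Sum>k\<in>{..i+j}. coeff f k * coeff g (i + j - k))"
      by (rule coeff_mult)
    also have "\<dots> = coeff f i * coeff g j + (\<Sum>k\<in>{..i+j}-{i}. coeff f k * coeff g (i + j - k))"
      by (subst sum.remove[of _ i]) auto
    finally have eq: "coeff f i * coeff g j = coeff (f * g) (i + j) -
      (\<Sum>k\<in>{..i+j}-{i}. coeff f k * coeff g (i + j - k))" by simp
    have "coeff f k * coeff g (i + j - k) \<in> Q" if "k \<in> {..i+j}-{i}" for k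
    proof (cases "k < i")
      case False
      with that have "i + j - k < j" by auto
      then show ?thesis using ltj multl by blast
    qed (use lti multr in blast)
    then have "coeff f i * coeff g j \<in> Q"
      unfolding eq using fg by (intro diff sum) (auto simp: coeffs_in_def)
    then show False using i j prime by blast
  qed
qed (auto simp: coeffs_in_def zero one add coeff_mult coeff_1 intro!: sum multr intro: exI[of _ 0])

section \<open>Linear algebra over the fractions of \<open>A\<close> modulo \<open>Q\<close>\<close>

locale prime_over = prime_id Q + subring_set A
  for Q A :: "'b::comm_ring_1 set"
begin

text \<open>Gaussian elimination by cross-multiplication: \<open>K\<close> indexes the vectors and
  \<open>J\<close> their coordinates. The entry at \<open>k0\<close>, \<open>j0\<close> is the pivot
  that clears the coordinate \<open>j0\<close>.\<close>

lemma ex_linear_dependence: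
  assumes "finite J" "finite K" "card J < card K"
    and "\<And>k j. k \<in> K \<Longrightarrow> j \<in> J \<Longrightarrow> w k j \<in> A"
  shows "\<exists>c. (\<forall>k\<in>K. c k \<in> A) \<and> (\<exists>k\<in>K. c k \<notin> Q) \<and> (\<forall>j\<in>J. (\<Sum>k\<in>K. c k * w k j) \<in> Q)"
  using assms
proof (induction J arbitrary: K w rule: finite_induct)
  case empty
  then obtain k where "k \<in> K" by fastforce
  then show ?case using one one_mem by (auto intro!: exI[of _ "\<lambda>_. 1"])
next
  case (insert j0 J)
  show ?case
  proof (cases "\<forall>k\<in>K. w k j0 \<in> Q")
    case True
    have "\<exists>c. (\<forall>k\<in>K. c k \<in> A) \<and> (\<exists>k\<in>K. c k \<notin> Q) \<and> (\<forall>j\<in>J. (\<Sum>k\<in>K. c k * w k j) \<in> Q)"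
      using insert.hyps insert.prems by (intro insert.IH) auto
    with True show ?thesis by (auto intro!: sum multl)
  next
    case False
    then obtain k0 where k0: "k0 \<in> K" "w k0 j0 \<notin> Q" by blast
    define K' where "K' = K - {k0}"
    have K: "K = insert k0 K'" "k0 \<notin> K'" "finite K'" using k0 insert.prems by (auto simp: K'_def)
    define w' where "w' k j = w k0 j0 * w k j - w k j0 * w k0 j" for k j
    have "\<exists>c. (\<forall>k\<in>K'. c k \<in> A) \<and> (\<exists>k\<in>K'. c k \<notin> Q) \<and> (\<forall>j\<in>J. (\<Sum>k\<in>K'. c k * w' k j) \<in> Q)"
      using insert.hyps insert.prems K by (intro insert.IH) (auto simp: w'_def intro!: diff_mem mult_mem)
    then obtain c where c: "\<And>k. k \<in> K' \<Longrightarrow> c k \<in> A" "\<exists>k\<in>K'. c k \<notin> Q"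
      "\<And>j. j \<in> J \<Longrightarrow> (\<Sum>k\<in>K'. c k * w' k j) \<in> Q" by blast
    \<comment> \<open>The pivot lies outside \<open>Q\<close>, so scaling by it keeps a nontrivial
      dependence nontrivial; the coefficient at \<open>k0\<close> is what cancels the coordinate
      \<open>j0\<close>.\<close>
    define d where "d k = (if k = k0 then - (\<Sum>k\<in>K'. c k * w k j0) else c k * w k0 j0)" for k
    have dsum: "(\<Sum>k\<in>K. d k * w k j) = (\<Sum>k\<in>K'. c k * w' k j)" for j
    proof -
      have "(\<Sum>k\<in>K'. d k * w k j) = (\<Sum>k\<in>K'. c k * w k0 j0 * w k j)"
        using K(2) by (intro sum.cong) (auto simp: d_def)
      then have "(\<Sum>k\<in>K. d k * w k j) = (\<Sum>k\<in>K'. c k * w k0 j0 * w k j) - (\<Sum>k\<in>K'. c k * w k j0) * w k0 j"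
        unfolding K(1) using K(2,3) by (simp add: d_def)
      also have "\<dots> = (\<Sum>k\<in>K'. c k * w' k j)"
        by (simp add: w'_def sum_distrib_left sum_subtractf algebra_simps)
      finally show ?thesis .
    qed
    have "(\<Sum>k\<in>K. d k * w k j) \<in> Q" if "j \<in> insert j0 J" for j
    proof (cases "j = j0")
      case True
      then show ?thesis unfolding dsum using zero by (simp add: w'_def mult.commute)
    next
      case False
      then show ?thesis unfolding dsum using c(3) that by blast
    qed
    moreover have "\<forall>k\<in>K. d k \<in> A"
      unfolding K(1) d_def using K(1) c(1) insert.prems(3) by (auto intro!: uminus_mem sum_mem mult_mem)
    moreover have "\<exists>k\<in>K. d k \<notin> Q"
    proof -
      from c(2) obtain k where k: "k \<in> K'" "c k \<notin> Q" by blast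
      then have "d k \<notin> Q" using K(2) k0(2) by (auto simp: d_def dest: prime)
      then show ?thesis using k K(1) by blast
    qed
    ultimately show ?thesis by blast
  qed
qed

text \<open>
  Modulo \<open>Q\<close>, this is the subspace spanned by \<open>\<Gamma>\<close> over the field of fractions of \<open>A\<close>.
\<close>

definition fspan :: "'b set \<Rightarrow> 'b set"
  where "fspan \<Gamma> = {x. \<exists>a\<in>A - Q. \<exists>c. (\<forall>\<gamma>\<in>\<Gamma>. c \<gamma> \<in> A) \<and> a * x - (\<Sum>\<gamma>\<in>\<Gamma>. c \<gamma> * \<gamma>) \<in> Q}"

lemma fspanI:
  "a \<in> A \<Longrightarrow> a \<notin> Q \<Longrightarrow> (\<And>\<gamma>. \<gamma> \<in> \<Gamma> \<Longrightarrow> c \<gamma> \<in> A) \<Longrightarrow> a * x - (\<Sum>\<gamma>\<in>\<Gamma>. c \<gamma> * \<gamma>) \<in> Q \<Longrightarrow> x \<in> fspan \<Gamma>"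
  unfolding fspan_def by blast

lemma fspanE:
  assumes "x \<in> fspan \<Gamma>"
  obtains a c where "a \<in> A" "a \<notin> Q" "\<forall>\<gamma>\<in>\<Gamma>. c \<gamma> \<in> A" "a * x - (\<Sum>\<gamma>\<in>\<Gamma>. c \<gamma> * \<gamma>) \<in> Q"
  using assms unfolding fspan_def by blast

lemma fspan_base: "finite \<Gamma> \<Longrightarrow> \<gamma> \<in> \<Gamma> \<Longrightarrow> \<gamma> \<in> fspan \<Gamma>"
  by (rule fspanI[of 1 _ "\<lambda>\<delta>. if \<delta> = \<gamma> then 1 else 0"])
    (auto simp: one one_mem zero_mem if_distrib[of "\<lambda>x. x * _"] zero cong: if_cong)

lemma fspan_Q: "x \<in> Q \<Longrightarrow> x \<in> fspan \<Gamma>"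
  by (rule fspanI[of 1 _ "\<lambda>_. 0"]) (auto simp: one one_mem zero_mem)

lemma fspan_add:
  assumes "x \<in> fspan \<Gamma>" "y \<in> fspan \<Gamma>"
  shows "x + y \<in> fspan \<Gamma>"
proof -
  from assms obtain a c b d where
    a: "a \<in> A" "a \<notin> Q" "\<forall>\<gamma>\<in>\<Gamma>. c \<gamma> \<in> A" "a * x - (\<Sum>\<gamma>\<in>\<Gamma>. c \<gamma> * \<gamma>) \<in> Q" and
    b: "b \<in> A" "b \<notin> Q" "\<forall>\<gamma>\<in>\<Gamma>. d \<gamma> \<in> A" "b * y - (\<Sum>\<gamma>\<in>\<Gamma>. d \<gamma> * \<gamma>) \<in> Q"
    unfolding fspan_def by blast
  show ?thesis
  proof (rule fspanI[of "a * b" _ "\<lambda>\<gamma>. b * c \<gamma> + a * d \<gamma>"])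
    have "a * b * (x + y) - (\<Sum>\<gamma>\<in>\<Gamma>. (b * c \<gamma> + a * d \<gamma>) * \<gamma>) =
      b * (a * x - (\<Sum>\<gamma>\<in>\<Gamma>. c \<gamma> * \<gamma>)) + a * (b * y - (\<Sum>\<gamma>\<in>\<Gamma>. d \<gamma> * \<gamma>))"
      by (simp add: algebra_simps sum.distrib sum_distrib_left)
    also have "\<dots> \<in> Q" using a b by (intro add multl)
    finally show "a * b * (x + y) - (\<Sum>\<gamma>\<in>\<Gamma>. (b * c \<gamma> + a * d \<gamma>) * \<gamma>) \<in> Q" .
  qed (use a b in \<open>auto intro: mult_mem add_mem dest: prime\<close>)
qed

lemma fspan_scale:
  assumes "x \<in> fspan \<Gamma>" "b \<in> A"
  shows "b * x \<in> fspan \<Gamma>"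
proof -
  from assms(1) obtain a c where
    a: "a \<in> A" "a \<notin> Q" "\<forall>\<gamma>\<in>\<Gamma>. c \<gamma> \<in> A" "a * x - (\<Sum>\<gamma>\<in>\<Gamma>. c \<gamma> * \<gamma>) \<in> Q" by (rule fspanE)
  show ?thesis
  proof (rule fspanI[of a _ "\<lambda>\<gamma>. b * c \<gamma>"])
    have "a * (b * x) - (\<Sum>\<gamma>\<in>\<Gamma>. (b * c \<gamma>) * \<gamma>) = b * (a * x - (\<Sum>\<gamma>\<in>\<Gamma>. c \<gamma> * \<gamma>))"
      by (simp add: algebra_simps sum_distrib_left)
    also have "\<dots> \<in> Q" by (rule multl[OF a(4)])
    finally show "a * (b * x) - (\<Sum>\<gamma>\<in>\<Gamma>. (b * c \<gamma>) * \<gamma>) \<in> Q" .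
  qed (use a assms(2) in \<open>auto intro: mult_mem\<close>)
qed

lemma fspan_cong:
  assumes "x \<in> fspan \<Gamma>" "x - y \<in> Q"
  shows "y \<in> fspan \<Gamma>"
  using fspan_add[OF assms(1) fspan_Q[OF uminus[OF assms(2)]]] by simp

lemma fspan_sum: "(\<And>i. i \<in> I \<Longrightarrow> f i \<in> fspan \<Gamma>) \<Longrightarrow> sum f I \<in> fspan \<Gamma>"
  by (induction I rule: infinite_finite_induct) (auto simp: fspan_Q zero fspan_add)

lemma fspan_unscale:
  assumes "b * x \<in> fspan \<Gamma>" "b \<in> A" "b \<notin> Q"
  shows "x \<in> fspan \<Gamma>"
proof -
  from assms(1) obtain a c where
    a: "a \<in> A" "a \<notin> Q" "\<forall>\<gamma>\<in>\<Gamma>. c \<gamma> \<in> A" "a * (b * x) - (\<Sum>\<gamma>\<in>\<Gamma>. c \<gamma> * \<gamma>) \<in> Q" by (rule fspanE)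
  then show ?thesis
    using assms(2,3) by (intro fspanI[of "a * b" _ c]) (auto intro: mult_mem simp: mult.assoc dest: prime)
qed

lemma fspan_mult_closed:
  assumes z: "\<And>\<gamma>. \<gamma> \<in> \<Gamma> \<Longrightarrow> z * \<gamma> \<in> fspan \<Gamma>" and x: "x \<in> fspan \<Gamma>"
  shows "z * x \<in> fspan \<Gamma>"
proof -
  from x obtain a c where
    a: "a \<in> A" "a \<notin> Q" "\<forall>\<gamma>\<in>\<Gamma>. c \<gamma> \<in> A" "a * x - (\<Sum>\<gamma>\<in>\<Gamma>. c \<gamma> * \<gamma>) \<in> Q" by (rule fspanE)
  have "(\<Sum>\<gamma>\<in>\<Gamma>. c \<gamma> * (z * \<gamma>)) \<in> fspan \<Gamma>"
    by (rule fspan_sum, rule fspan_scale) (use a z in auto)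
  moreover have "(\<Sum>\<gamma>\<in>\<Gamma>. c \<gamma> * (z * \<gamma>)) - a * (z * x) \<in> Q"
  proof -
    have "(\<Sum>\<gamma>\<in>\<Gamma>. c \<gamma> * (z * \<gamma>)) - a * (z * x) = - (z * (a * x - (\<Sum>\<gamma>\<in>\<Gamma>. c \<gamma> * \<gamma>)))"
      by (simp add: algebra_simps sum_distrib_left)
    also have "\<dots> \<in> Q" by (rule uminus[OF multl[OF a(4)]])
    finally show ?thesis .
  qed
  ultimately have "a * (z * x) \<in> fspan \<Gamma>" by (rule fspan_cong)
  then show ?thesis by (rule fspan_unscale) (use a in auto)
qed

lemma fspan_adjoin_closed:
  assumes y: "\<And>\<gamma>. \<gamma> \<in> \<Gamma> \<Longrightarrow> y * \<gamma> \<in> fspan \<Gamma>" and g: "g \<in> coeffs_in A" and x: "x \<in> fspan \<Gamma>"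
  shows "poly g y * x \<in> fspan \<Gamma>"
proof -
  have pow: "y ^ n * x \<in> fspan \<Gamma>" for n
    by (induction n) (auto simp: x mult.assoc intro: fspan_mult_closed y)
  have "poly g y * x = (\<Sum>i\<le>degree g. coeff g i * (y ^ i * x))"
    unfolding poly_altdef by (simp add: sum_distrib_right mult.assoc)
  also have "\<dots> \<in> fspan \<Gamma>" using g by (auto intro!: fspan_sum fspan_scale pow simp: coeffs_in_def)
  finally show ?thesis .
qed

text \<open>The \<open>card \<Gamma> + 1\<close> powers of \<open>s\<close> with exponents up to
  \<open>card \<Gamma>\<close> lie in a space spanned by \<open>card \<Gamma>\<close> elements.
  Their linear dependence is the polynomial relation.\<close>

lemma algebraic_mod_if_fspan:
  assumes fin: "finite \<Gamma>" and one_in: "1 \<in> fspan \<Gamma>" and stable: "\<And>\<gamma>. \<gamma> \<in> \<Gamma> \<Longrightarrow> s * \<gamma> \<in> fspan \<Gamma>"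
  shows "algebraic_mod Q A s"
proof -
  have "s ^ k \<in> fspan \<Gamma>" for k
    by (induction k) (auto simp: one_in intro: fspan_mult_closed stable)
  then have "\<forall>k. \<exists>a c. a \<in> A \<and> a \<notin> Q \<and> (\<forall>\<gamma>\<in>\<Gamma>. c \<gamma> \<in> A) \<and> a * s ^ k - (\<Sum>\<gamma>\<in>\<Gamma>. c \<gamma> * \<gamma>) \<in> Q"
    unfolding fspan_def by blast
  from choice[OF this] obtain a where "\<forall>k. \<exists>c. a k \<in> A \<and> a k \<notin> Q \<and> (\<forall>\<gamma>\<in>\<Gamma>. c \<gamma> \<in> A) \<and>
      a k * s ^ k - (\<Sum>\<gamma>\<in>\<Gamma>. c \<gamma> * \<gamma>) \<in> Q" by blast
  from choice[OF this] obtain c where ac: "\<forall>k. a k \<in> A \<and> a k \<notin> Q \<and> (\<forall>\<gamma>\<in>\<Gamma>. c k \<gamma> \<in> A) \<and>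
      a k * s ^ k - (\<Sum>\<gamma>\<in>\<Gamma>. c k \<gamma> * \<gamma>) \<in> Q" by blast
  have a: "\<And>k. a k \<in> A" "\<And>k. a k \<notin> Q"
    and c: "\<And>k \<gamma>. \<gamma> \<in> \<Gamma> \<Longrightarrow> c k \<gamma> \<in> A" "\<And>k. a k * s ^ k - (\<Sum>\<gamma>\<in>\<Gamma>. c k \<gamma> * \<gamma>) \<in> Q"
    using ac by auto
  have "\<exists>d. (\<forall>k\<in>{..card \<Gamma>}. d k \<in> A) \<and> (\<exists>k\<in>{..card \<Gamma>}. d k \<notin> Q) \<and>
      (\<forall>\<gamma>\<in>\<Gamma>. (\<Sum>k\<in>{..card \<Gamma>}. d k * c k \<gamma>) \<in> Q)"
    by (rule ex_linear_dependence) (use fin c in auto)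
  then obtain d k0 where d: "\<And>k. k \<le> card \<Gamma> \<Longrightarrow> d k \<in> A" "k0 \<le> card \<Gamma>" "d k0 \<notin> Q"
    "\<And>\<gamma>. \<gamma> \<in> \<Gamma> \<Longrightarrow> (\<Sum>k\<le>card \<Gamma>. d k * c k \<gamma>) \<in> Q" by auto
  define g where "g = (\<Sum>k\<le>card \<Gamma>. monom (d k * a k) k)"
  have g: "coeff g k = (if k \<le> card \<Gamma> then d k * a k else 0)" for k
    by (simp add: g_def coeff_sum)
  show ?thesis
    unfolding algebraic_mod_def
  proof (intro bexI conjI)
    show "g \<in> coeffs_in A" using d(1) a by (auto simp: coeffs_in_def g mult_mem zero_mem)
    show "g \<notin> coeffs_in Q" using d(2,3) a(2)[of k0] prime by (auto simp: coeffs_in_def g)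
    have "poly g s = (\<Sum>k\<le>card \<Gamma>. d k * (a k * s ^ k - (\<Sum>\<gamma>\<in>\<Gamma>. c k \<gamma> * \<gamma>))) +
        (\<Sum>k\<le>card \<Gamma>. \<Sum>\<gamma>\<in>\<Gamma>. d k * c k \<gamma> * \<gamma>)"
      by (simp add: g_def poly_sum poly_monom right_diff_distrib sum_subtractf sum_distrib_left mult.assoc)
    also have "(\<Sum>k\<le>card \<Gamma>. \<Sum>\<gamma>\<in>\<Gamma>. d k * c k \<gamma> * \<gamma>) = (\<Sum>\<gamma>\<in>\<Gamma>. (\<Sum>k\<le>card \<Gamma>. d k * c k \<gamma>) * \<gamma>)"
      by (subst sum.swap) (simp add: sum_distrib_right)
    finally show "poly g s \<in> Q" by (simp add: add sum multl multr c d)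
  qed
qed

lemma algebraic_mod_relation:
  assumes "algebraic_mod Q A y"
  obtains a e h where "a \<in> A" "a \<notin> Q" "e > 0" "\<forall>i<e. h i \<in> A" "a * y ^ e - (\<Sum>i<e. h i * y ^ i) \<in> Q"
proof -
  from assms obtain g where g: "g \<in> coeffs_in A" "g \<notin> coeffs_in Q" "poly g y \<in> Q"
    unfolding algebraic_mod_def by blast
  \<comment> \<open>The terms beyond the last coefficient outside \<open>Q\<close> vanish modulo
    \<open>Q\<close>, so \<open>e\<close> is the degree of the relation modulo \<open>Q\<close>. If
    \<open>e\<close> were 0, that coefficient itself would be in \<open>Q\<close>.\<close>
  define e where "e = (GREATEST i. coeff g i \<notin> Q)"
  from g(2) obtain i0 where i0: "coeff g i0 \<notin> Q" by (auto simp: coeffs_in_def)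
  have bound: "i \<le> degree g" if "coeff g i \<notin> Q" for i
    using that zero by (auto intro: le_degree)
  have e: "coeff g e \<notin> Q" unfolding e_def by (rule GreatestI_nat[of "\<lambda>i. coeff g i \<notin> Q", OF i0 bound])
  have le: "i \<le> e" if "coeff g i \<notin> Q" for i
    unfolding e_def by (rule Greatest_le_nat[of "\<lambda>i. coeff g i \<notin> Q", OF that bound])
  have ed: "e \<le> degree g" using bound e by blast
  have "poly g y = (\<Sum>i\<le>degree g. coeff g i * y ^ i)" by (rule poly_altdef)
  also have "\<dots> = (\<Sum>i\<in>{..e}. coeff g i * y ^ i) + (\<Sum>i\<in>{..degree g} - {..e}. coeff g i * y ^ i)"
    using ed by (subst add.commute, intro sum.subset_diff) auto
  finally have "poly g y - (\<Sum>i\<in>{..e}. coeff g i * y ^ i) \<in> Q"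
    using le by (auto intro!: sum multr)
  with g(3) have "(\<Sum>i\<in>{..e}. coeff g i * y ^ i) \<in> Q" using diff_cong by blast
  then have *: "coeff g e * y ^ e + (\<Sum>i<e. coeff g i * y ^ i) \<in> Q"
    by (simp add: lessThan_Suc_atMost[symmetric] add.commute)
  have "e > 0"
  proof (rule ccontr)
    assume "\<not> e > 0"
    with * e show False by simp
  qed
  show thesis
  proof (rule that[of "coeff g e" e "\<lambda>i. - coeff g i"])
    show "coeff g e * y ^ e - (\<Sum>i<e. - coeff g i * y ^ i) \<in> Q" using * by (simp add: sum_negf)
  qed (use g(1) e \<open>e > 0\<close> in \<open>auto simp: coeffs_in_def uminus_mem\<close>)
qed

lemma ex_inverse_mod:
  assumes alg: "algebraic_mod Q A y" and B: "subring_set B" "A \<subseteq> B" "y \<in> B" and y: "y \<notin> Q"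
  obtains a z where "a \<in> A" "a \<notin> Q" "z \<in> B" "z * y - a \<in> Q"
proof -
  interpret B: subring_set B by fact
  from alg obtain g where g: "g \<in> coeffs_in A" "g \<notin> coeffs_in Q" "poly g y \<in> Q"
    unfolding algebraic_mod_def by blast
  then have "\<exists>a z. a \<in> A \<and> a \<notin> Q \<and> z \<in> B \<and> z * y - a \<in> Q"
  proof (induction g)
    case (pCons a g)
    have mem: "a \<in> A" "g \<in> coeffs_in A"
      using pCons.prems(1) by (auto simp: coeffs_in_def coeff_pCons split: nat.splits)
    have z: "poly g y \<in> B"
      unfolding poly_altdef using mem B by (auto intro!: B.sum_mem B.mult_mem B.power_mem simp: coeffs_in_def)
    have eq: "a + y * poly g y \<in> Q" using pCons.prems(3) by simp
    show ?case
    proof (cases "a \<in> Q")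
      case True
      with pCons.prems(2) have "g \<notin> coeffs_in Q"
        unfolding coeffs_in_def mem_Collect_eq not_all
        by (metis coeff_pCons_0 coeff_pCons_Suc not0_implies_Suc)
      moreover from True eq have "y * poly g y \<in> Q" using add_cancel by blast
      then have "poly g y \<in> Q" using y prime by blast
      ultimately show ?thesis using pCons.IH mem by blast
    next
      case False
      have "(- poly g y) * y - a = - (a + y * poly g y)" by (simp add: algebra_simps)
      with eq have "(- poly g y) * y - a \<in> Q" using uminus by metis
      then show ?thesis using False mem z B.uminus_mem by blast
    qed
  qed (auto simp: coeffs_in_def zero)
  then show thesis using that by blast
qed

text \<open>The products \<open>y ^ i * x ^ j\<close> with exponents below the two degrees span a
  space stable under \<open>x\<close>. The leading coefficient \<open>c\<close> of the relation for
  \<open>x\<close> lies only in \<open>A[y]\<close>; since it is algebraic over \<open>A\<close>,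
  \<open>ex_inverse_mod\<close> trades it for an element of \<open>A\<close>.\<close>

lemma algebraic_mod_trans:
  assumes y: "algebraic_mod Q A y" and x: "algebraic_mod Q {poly g y | g. g \<in> coeffs_in A} x"
  shows "algebraic_mod Q A x"
proof -
  define B where "B = {poly g y | g. g \<in> coeffs_in A}"
  interpret B: subring_set B unfolding B_def by (rule poly_ring_adjoin)
  interpret QB: prime_over Q B by unfold_locales
  have AB: "A \<subseteq> B"
    unfolding B_def using zero_mem by (force simp: coeffs_in_def coeff_pCons split: nat.splits intro: exI[of _ "[:_:]"])
  have yB: "y \<in> B"
    unfolding B_def mem_Collect_eq by (rule exI[of _ "[:0, 1:]"])
      (auto simp: coeffs_in_def coeff_pCons zero_mem one_mem split: nat.splits)
  obtain a e h where a: "a \<in> A" "a \<notin> Q" "e > 0" and h: "\<forall>i<e. h i \<in> A"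
    and ye: "a * y ^ e - (\<Sum>i<e. h i * y ^ i) \<in> Q" using algebraic_mod_relation[OF y] by blast
  obtain c d k where c: "c \<in> B" "c \<notin> Q" "d > 0" and k: "\<forall>j<d. k j \<in> B"
    and xd: "c * x ^ d - (\<Sum>j<d. k j * x ^ j) \<in> Q" using QB.algebraic_mod_relation[OF x[folded B_def]] by blast
  note h = h[rule_format] and k = k[rule_format]
  have alg_B: "algebraic_mod Q A z" if "z \<in> B" for z
  proof -
    define \<Gamma> where "\<Gamma> = (\<lambda>i. y ^ i) ` {..<e}"
    have fin: "finite \<Gamma>" by (simp add: \<Gamma>_def)
    have base: "y ^ i \<in> fspan \<Gamma>" if "i < e" for i
      using that by (intro fspan_base fin) (auto simp: \<Gamma>_def)
    have "(\<Sum>i<e. h i * y ^ i) \<in> fspan \<Gamma>" by (auto intro!: fspan_sum fspan_scale h base)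
    moreover have "(\<Sum>i<e. h i * y ^ i) - a * y ^ e \<in> Q" using uminus[OF ye] by simp
    ultimately have "a * y ^ e \<in> fspan \<Gamma>" by (rule fspan_cong)
    then have top: "y ^ e \<in> fspan \<Gamma>" by (rule fspan_unscale) (use a in auto)
    have ystable: "y * \<gamma> \<in> fspan \<Gamma>" if "\<gamma> \<in> \<Gamma>" for \<gamma>
    proof -
      from that obtain i where i: "i < e" "\<gamma> = y ^ i" by (auto simp: \<Gamma>_def)
      have "y * \<gamma> = y ^ Suc i" by (simp add: i)
      then show ?thesis using i(1) top base[of "Suc i"] by (cases "Suc i = e") auto
    qed
    have Bstable: "b * \<gamma> \<in> fspan \<Gamma>" if "b \<in> B" "\<gamma> \<in> fspan \<Gamma>" for b \<gamma>
      using that fspan_adjoin_closed[OF ystable] unfolding B_def by blast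
    show ?thesis
      using base[of 0] a(3) that by (intro algebraic_mod_if_fspan[OF fin]) (auto intro: Bstable fspan_base fin)
  qed
  define \<Gamma> where "\<Gamma> = (\<lambda>(i, j). y ^ i * x ^ j) ` ({..<e} \<times> {..<d})"
  have fin: "finite \<Gamma>" by (simp add: \<Gamma>_def)
  have base: "y ^ i * x ^ j \<in> fspan \<Gamma>" if "i < e" "j < d" for i j
    using that by (intro fspan_base fin) (auto simp: \<Gamma>_def)
  have top: "y ^ e * x ^ j \<in> fspan \<Gamma>" if "j < d" for j
  proof -
    have "(\<Sum>i<e. h i * (y ^ i * x ^ j)) \<in> fspan \<Gamma>" using that by (auto intro!: fspan_sum fspan_scale h base)
    moreover have "(\<Sum>i<e. h i * (y ^ i * x ^ j)) - a * (y ^ e * x ^ j) \<in> Q"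
      using uminus[OF multr[OF ye, of "x ^ j"]] by (simp add: algebra_simps sum_distrib_left)
    ultimately have "a * (y ^ e * x ^ j) \<in> fspan \<Gamma>" by (rule fspan_cong)
    then show ?thesis by (rule fspan_unscale) (use a in auto)
  qed
  have ystable: "y * \<gamma> \<in> fspan \<Gamma>" if "\<gamma> \<in> \<Gamma>" for \<gamma>
  proof -
    from that obtain i j where i: "i < e" "j < d" "\<gamma> = y ^ i * x ^ j" by (auto simp: \<Gamma>_def)
    have "y * \<gamma> = y ^ Suc i * x ^ j" by (simp add: i mult.assoc)
    then show ?thesis using i(1,2) top base[of "Suc i" j] by (cases "Suc i = e") auto
  qed
  have Bstable: "b * \<gamma> \<in> fspan \<Gamma>" if "b \<in> B" "\<gamma> \<in> fspan \<Gamma>" for b \<gamma>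
    using that fspan_adjoin_closed[OF ystable] unfolding B_def by blast
  have xd_in: "x ^ d \<in> fspan \<Gamma>"
  proof -
    obtain u z where u: "u \<in> A" "u \<notin> Q" and z: "z \<in> B" "z * c - u \<in> Q"
      using ex_inverse_mod[OF alg_B[OF c(1)] B.subring_set_axioms AB c(1,2)] by blast
    have "x ^ j \<in> fspan \<Gamma>" if "j < d" for j using base[OF a(3) that] by simp
    then have "(\<Sum>j<d. k j * x ^ j) \<in> fspan \<Gamma>" by (auto intro!: fspan_sum Bstable k)
    then have "z * (\<Sum>j<d. k j * x ^ j) \<in> fspan \<Gamma>" using Bstable z(1) by simp
    moreover have "z * (\<Sum>j<d. k j * x ^ j) - u * x ^ d \<in> Q"
    proof -
      have "z * (\<Sum>j<d. k j * x ^ j) - u * x ^ d =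
          (z * c - u) * x ^ d - z * (c * x ^ d - (\<Sum>j<d. k j * x ^ j))" by (simp add: algebra_simps)
      also have "\<dots> \<in> Q" by (rule diff[OF multr[OF z(2)] multl[OF xd]])
      finally show ?thesis .
    qed
    ultimately have "u * x ^ d \<in> fspan \<Gamma>" by (rule fspan_cong)
    then show ?thesis using u by (rule fspan_unscale)
  qed
  show ?thesis
  proof (rule algebraic_mod_if_fspan[OF fin])
    show "1 \<in> fspan \<Gamma>" using base[of 0 0] a(3) c(3) by simp
    fix \<gamma> assume "\<gamma> \<in> \<Gamma>"
    then obtain i j where i: "i < e" "j < d" "\<gamma> = y ^ i * x ^ j" by (auto simp: \<Gamma>_def)
    have "x * \<gamma> = y ^ i * x ^ Suc j" by (simp add: i mult_ac)
    then show "x * \<gamma> \<in> fspan \<Gamma>" using i(1,2) Bstable[OF B.power_mem[OF yB] xd_in, of i] base[of i "Suc j"] by (cases "Suc j = d") auto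
  qed
qed

end

section \<open>Polynomials in arbitrarily many indeterminates\<close>

type_synonym ('i, 'a) mpol = "('i \<Rightarrow>\<^sub>0 nat) \<Rightarrow>\<^sub>0 'a"

definition pconst :: "'a \<Rightarrow> ('i, 'a::comm_ring_1) mpol"
  where "pconst c = single 0 c"

definition pvar :: "'i \<Rightarrow> ('i, 'a::comm_ring_1) mpol"
  where "pvar v = single (single v 1) 1"

text \<open>\<open>T m c\<close> is the prescribed value at the term with monomial \<open>m\<close>
  and coefficient \<open>c\<close>. Evaluation and \<open>to_poly\<close> are both of this
  form.\<close>

definition lin_ext :: "(('i \<Rightarrow>\<^sub>0 nat) \<Rightarrow> 'a \<Rightarrow> 'b) \<Rightarrow> ('i, 'a::comm_ring_1) mpol \<Rightarrow> 'b::comm_ring_1"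
  where "lin_ext T F = (\<Sum>m\<in>keys F. T m (lookup F m))"

lemma mpol_eq_sum_single:
  "F = (\<Sum>m\<in>keys F. single m (lookup F m))"
  by (rule poly_mapping_eqI) (auto simp: lookup_sum lookup_single when_def in_keys_iff)

context
  fixes T :: "('i \<Rightarrow>\<^sub>0 nat) \<Rightarrow> 'a::comm_ring_1 \<Rightarrow> 'b::comm_ring_1"
  assumes T_add: "\<And>m a b. T m (a + b) = T m a + T m b"
begin

lemma lin_ext_superset:
  assumes "finite M" "keys F \<subseteq> M"
  shows "lin_ext T F = (\<Sum>m\<in>M. T m (lookup F m))"
proof -
  have "T m 0 = 0" for m using T_add[of m 0 0] by simp
  then show ?thesis
    unfolding lin_ext_def using assms by (intro sum.mono_neutral_left) (auto simp: in_keys_iff)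
qed

lemma lin_ext_add: "lin_ext T (F + G) = lin_ext T F + lin_ext T G"
proof -
  let ?M = "keys F \<union> keys G"
  have "keys (F + G) \<subseteq> ?M" by (rule keys_add)
  then show ?thesis
    by (simp add: lin_ext_superset[of ?M] lookup_add T_add sum.distrib)
qed

lemma lin_ext_single: "lin_ext T (single m c) = T m c"
  by (subst lin_ext_superset[of "{m}"]) auto

lemma ring_map_lin_ext:
  assumes mult: "\<And>m m' a b. T (m + m') (a * b) = T m a * T m' b" and one: "T 0 1 = 1"
  shows "ring_map (lin_ext T)"
proof
  show "lin_ext T 1 = 1" using lin_ext_single[of 0 1] one by simp
  show "lin_ext T (F + G) = lin_ext T F + lin_ext T G" for F G by (rule lin_ext_add)
  have lsum: "lin_ext T (sum f N) = (\<Sum>x\<in>N. lin_ext T (f x))" for f :: "'x \<Rightarrow> ('i, 'a) mpol" and N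
    using lin_ext_add[of 0 0] by (induction N rule: infinite_finite_induct) (auto simp: lin_ext_add)
  show "lin_ext T (F * G) = lin_ext T F * lin_ext T G" for F G
  proof -
    let ?s = "\<lambda>F m. single m (lookup F m)"
    have "F * G = (\<Sum>m\<in>keys F. \<Sum>m'\<in>keys G. ?s F m * ?s G m')"
      by (subst mpol_eq_sum_single[of F], subst mpol_eq_sum_single[of G]) (simp only: sum_product)
    then have "lin_ext T (F * G) = (\<Sum>m\<in>keys F. \<Sum>m'\<in>keys G.
        T m (lookup F m) * T m' (lookup G m'))"
      by (simp only: lsum mult_single lin_ext_single mult)
    then show ?thesis by (simp only: lin_ext_def sum_product)
  qed
qed

end

lemma ring_map_pconst: "ring_map (pconst :: 'a::comm_ring_1 \<Rightarrow> ('i, 'a) mpol)"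
  by unfold_locales (auto simp: pconst_def single_add mult_single)

definition mon_eval :: "('i \<Rightarrow> 'b::comm_ring_1) \<Rightarrow> ('i \<Rightarrow>\<^sub>0 nat) \<Rightarrow> 'b"
  where "mon_eval g m = (\<Prod>v\<in>keys m. g v ^ lookup m v)"

lemma mon_eval_superset:
  "finite V \<Longrightarrow> keys m \<subseteq> V \<Longrightarrow> mon_eval g m = (\<Prod>v\<in>V. g v ^ lookup m v)"
  unfolding mon_eval_def by (intro prod.mono_neutral_left) (auto simp: in_keys_iff)

lemma mon_eval_add: "mon_eval g (m + m') = mon_eval g m * mon_eval g m'"
proof -
  let ?V = "keys m \<union> keys m'"
  have "keys (m + m') \<subseteq> ?V" by (rule keys_add)
  then show ?thesis
    by (simp add: mon_eval_superset[of ?V] lookup_add power_add prod.distrib)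
qed

lemma mon_eval_zero: "mon_eval g 0 = 1"
  by (simp add: mon_eval_def)

lemma pvar_power: "pvar v ^ n = single (single v n) 1"
  by (induction n) (auto simp: pvar_def mult_single single_add[symmetric] single_one)

lemma prod_single_one:
  "(\<Prod>v\<in>V. single (h v) 1) = (single (\<Sum>v\<in>V. h v) 1 :: ('i, 'a::comm_ring_1) mpol)"
  by (induction V rule: infinite_finite_induct) (auto simp: mult_single single_one)

lemma mon_eval_pvar:
  "mon_eval pvar m = (single m 1 :: ('i, 'a::comm_ring_1) mpol)"
proof -
  have "m = (\<Sum>v\<in>keys m. single v (lookup m v))"
    by (rule poly_mapping_eqI) (auto simp: lookup_sum lookup_single when_def in_keys_iff)
  then show ?thesis by (simp add: mon_eval_def pvar_power prod_single_one)
qed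

definition peval :: "('a \<Rightarrow> 'b) \<Rightarrow> ('i \<Rightarrow> 'b) \<Rightarrow> ('i, 'a::comm_ring_1) mpol \<Rightarrow> 'b::comm_ring_1"
  where "peval h g = lin_ext (\<lambda>m c. h c * mon_eval g m)"

context
  fixes h :: "'a::comm_ring_1 \<Rightarrow> 'b::comm_ring_1" and g :: "'i \<Rightarrow> 'b"
  assumes h: "ring_map h"
begin

interpretation ring_map h by (rule h)

lemma ring_map_peval: "ring_map (peval h g)"
  unfolding peval_def
  by (rule ring_map_lin_ext)
    (simp_all add: map_add map_mult map_one mon_eval_add mon_eval_zero algebra_simps)

lemma peval_single: "peval h g (single m c) = h c * mon_eval g m"
  unfolding peval_def by (rule lin_ext_single) (simp add: map_add algebra_simps)

lemma peval_pconst: "peval h g (pconst c) = h c"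
  by (simp add: pconst_def peval_single mon_eval_zero)

lemma peval_pvar: "peval h g (pvar v) = g v"
  by (simp add: pvar_def peval_single mon_eval_def map_one)

end

lemma lookup_pconst: "lookup (pconst c) m = (if m = 0 then c else 0)"
  by (simp add: pconst_def lookup_single when_def)

lemma pconst_in_polys: "pconst c \<in> polys_in V"
  by (auto simp: polys_in_def pconst_def)

lemma pvar_in_polys: "v \<in> V \<Longrightarrow> pvar v \<in> polys_in V"
  by (auto simp: polys_in_def pvar_def)

lemma subring_polys_in: "subring_set (polys_in V :: ('i, 'a::comm_ring_1) mpol set)"
  by unfold_locales (auto simp: polys_in_0 polys_in_1 polys_in_add polys_in_mult polys_in_uminus)

lemma polys_in_mono: "V \<subseteq> W \<Longrightarrow> polys_in V \<subseteq> polys_in W"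
  by (auto simp: polys_in_def)

lemma polys_in_UNIV: "polys_in UNIV = UNIV"
  by (auto simp: polys_in_def)

lemma polys_in_lookupD: "F \<in> polys_in V \<Longrightarrow> lookup F m \<noteq> 0 \<Longrightarrow> keys m \<subseteq> V"
  by (auto simp: polys_in_def in_keys_iff)

lemma ex_finite_polys_in:
  obtains V where "finite V" "F \<in> polys_in V"
  by (rule that[of "\<Union>m\<in>keys F. keys m"]) (auto simp: polys_in_def)

lemma polys_in_induct [consumes 1, case_names const var add mult]:
  fixes F :: "('i, 'a::comm_ring_1) mpol"
  assumes F: "F \<in> polys_in V"
    and const: "\<And>c. P (pconst c)" and var: "\<And>v. v \<in> V \<Longrightarrow> P (pvar v)"
    and add: "\<And>F G. F \<in> polys_in V \<Longrightarrow> G \<in> polys_in V \<Longrightarrow> P F \<Longrightarrow> P G \<Longrightarrow> P (F + G)"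
    and mult: "\<And>F G. F \<in> polys_in V \<Longrightarrow> G \<in> polys_in V \<Longrightarrow> P F \<Longrightarrow> P G \<Longrightarrow> P (F * G)"
  shows "P F"
proof -
  interpret subring_set "polys_in V :: ('i, 'a) mpol set" by (rule subring_polys_in)
  let ?P = "\<lambda>F. F \<in> polys_in V \<and> P F"
  have pow: "?P (pvar v ^ n)" if "v \<in> V" for v n
    using that const[of 1] by (induction n) (auto simp: pvar_in_polys var mult mult_mem one_mem pconst_def)
  have prod: "?P (prod f N)" if "\<And>x. x \<in> N \<Longrightarrow> ?P (f x)" for f :: "'i \<Rightarrow> ('i, 'a) mpol" and N
    using that const[of 1]
    by (induction N rule: infinite_finite_induct) (auto simp: mult mult_mem one_mem pconst_def)
  have sum: "?P (sum f N)" if "\<And>x. x \<in> N \<Longrightarrow> ?P (f x)" for f :: "('i \<Rightarrow>\<^sub>0 nat) \<Rightarrow> ('i, 'a) mpol" and N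
    using that const[of 0]
    by (induction N rule: infinite_finite_induct) (auto simp: add add_mem zero_mem pconst_def)
  have "?P (single m (lookup F m))" if m: "m \<in> keys F" for m
  proof -
    have "?P (mon_eval pvar m)"
      unfolding mon_eval_def using F m by (intro prod pow) (auto simp: polys_in_def)
    then have "?P (pconst (lookup F m) * mon_eval pvar m)"
      using mult const mult_mem pconst_in_polys by blast
    then show ?thesis by (simp add: pconst_def mon_eval_pvar mult_single)
  qed
  then have "?P (\<Sum>m\<in>keys F. single m (lookup F m))"
    by (rule sum)
  then show ?thesis using mpol_eq_sum_single[of F] by simp
qed

lemma ring_map_eq_on_polys:
  assumes f: "ring_map f" "ring_map g" and F: "F \<in> polys_in V"
    and "\<And>c. f (pconst c) = g (pconst c)" "\<And>v. v \<in> V \<Longrightarrow> f (pvar v) = g (pvar v)"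
  shows "f F = g F"
proof -
  interpret f: ring_map f by fact
  interpret g: ring_map g by fact
  show ?thesis
    using F by (induction rule: polys_in_induct) (auto simp: assms f.map_add g.map_add f.map_mult g.map_mult)
qed

text \<open>The polynomial \<open>F\<close> as a polynomial in the one indeterminate \<open>v\<close>.\<close>

definition to_poly :: "'i \<Rightarrow> ('i, 'a::comm_ring_1) mpol \<Rightarrow> ('i, 'a) mpol poly"
  where "to_poly v = lin_ext (\<lambda>m c.
    monom (single (m - single v (lookup m v)) c) (lookup m v))"

lemma ring_map_to_poly: "ring_map (to_poly v)"
  unfolding to_poly_def
proof (rule ring_map_lin_ext)
  fix m m' :: "'a \<Rightarrow>\<^sub>0 nat" and a b :: 'b
  have "m + m' - single v (lookup (m + m') v) =
      (m - single v (lookup m v)) + (m' - single v (lookup m' v))"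
    by (rule poly_mapping_eqI) (auto simp: lookup_add lookup_minus lookup_single when_def)
  then show "monom (single (m + m' - single v (lookup (m + m') v)) (a * b))
       (lookup (m + m') v) =
      monom (single (m - single v (lookup m v)) a) (lookup m v) *
      monom (single (m' - single v (lookup m' v)) b) (lookup m' v)"
    by (simp add: mult_monom mult_single lookup_add)
qed (simp_all add: single_add add_monom monom_eq_1)

lemma to_poly_single:
  "to_poly v (single m c) =
    monom (single (m - single v (lookup m v)) c) (lookup m v)"
  unfolding to_poly_def by (rule lin_ext_single) (simp add: single_add add_monom)

lemma to_poly_pconst: "to_poly v (pconst c) = [:pconst c:]"
  by (simp add: pconst_def to_poly_single monom_0)

lemma to_poly_pvar_self: "to_poly v (pvar v) = [:0, 1:]"
  by (simp add: pvar_def to_poly_single monom_altdef)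

lemma to_poly_pvar: "w \<noteq> v \<Longrightarrow> to_poly v (pvar w) = [:pvar w:]"
  by (simp add: pvar_def to_poly_single monom_0 lookup_single)

lemma lookup_coeff_to_poly:
  "lookup (coeff (to_poly v F) i) m =
    (if lookup m v = 0 then lookup F (m + single v i) else 0)"
proof -
  have iff: "lookup k v = i \<and> k - single v (lookup k v) = m \<longleftrightarrow>
      lookup m v = 0 \<and> k = m + single v i" (is "?L \<longleftrightarrow> ?R") for k
  proof
    assume L: ?L
    then have 0: "lookup m v = 0" by (auto simp: lookup_minus)
    moreover have "k = m + single v i"
    proof (rule poly_mapping_eqI)
      fix w
      have "lookup m w = lookup k w - lookup (single v i) w"
        using L by (auto simp: lookup_minus)
      then show "lookup k w = lookup (m + single v i) w"
        using L by (cases "w = v") (auto simp: lookup_add lookup_single)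
    qed
    ultimately show ?R by blast
  next
    assume ?R
    then show ?L
      by (auto simp: lookup_add lookup_minus lookup_single when_def intro!: poly_mapping_eqI)
  qed
  have "lookup (coeff (to_poly v F) i) m = (\<Sum>k\<in>keys F.
      if lookup k v = i \<and> k - single v (lookup k v) = m
      then lookup F k else 0)"
    unfolding to_poly_def lin_ext_def coeff_sum lookup_sum
    by (intro sum.cong) (auto simp: lookup_single when_def)
  also have "\<dots> = (\<Sum>k\<in>keys F.
      if k = m + single v i then (if lookup m v = 0 then lookup F k else 0) else 0)"
    unfolding iff by (intro sum.cong) auto
  also have "\<dots> = (if lookup m v = 0 then lookup F (m + single v i) else 0)"
    by (simp add: in_keys_iff)
  finally show ?thesis .
qed

lemma monomial_split:
  fixes m :: "'i \<Rightarrow>\<^sub>0 nat"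
  obtains i k where "lookup k v = 0" "m = k + single v i"
proof
  let ?i = "lookup m v"
  show "lookup (m - single v ?i) v = 0" by (simp add: lookup_minus)
  show "m = m - single v ?i + single v ?i"
    by (rule poly_mapping_eqI) (auto simp: lookup_add lookup_minus lookup_single when_def)
qed

lemma lookup_to_poly_iff:
  assumes "P 0"
  shows "(\<forall>i k. P (lookup (coeff (to_poly v F) i) k)) \<longleftrightarrow> (\<forall>m. P (lookup F m))"
proof (intro iffI allI)
  fix m :: "'b \<Rightarrow>\<^sub>0 nat" assume *: "\<forall>i k. P (lookup (coeff (to_poly v F) i) k)"
  obtain i k where "lookup k v = 0" "m = k + single v i" by (rule monomial_split)
  then have "lookup F m = lookup (coeff (to_poly v F) i) k"
    by (simp add: lookup_coeff_to_poly)
  then show "P (lookup F m)" using * by simp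
qed (use assms in \<open>auto simp: lookup_coeff_to_poly\<close>)

lemma coeff_to_poly_in:
  assumes "F \<in> polys_in V"
  shows "coeff (to_poly v F) i \<in> polys_in (V - {v})"
  unfolding polys_in_def mem_Collect_eq
proof
  fix m assume "m \<in> keys (coeff (to_poly v F) i)"
  then have *: "lookup m v = 0" "lookup F (m + single v i) \<noteq> 0"
    by (auto simp: in_keys_iff lookup_coeff_to_poly split: if_splits)
  from polys_in_lookupD[OF assms *(2)] have "keys (m + single v i) \<subseteq> V" .
  then show "keys m \<subseteq> V - {v}"
    using *(1) by (auto simp: in_keys_iff lookup_add)
qed

lemma coeff_to_poly_commute:
  "u \<noteq> v \<Longrightarrow> coeff (to_poly v (coeff (to_poly u F) i)) j = coeff (to_poly u (coeff (to_poly v F) j)) i"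
  by (rule poly_mapping_eqI) (auto simp: lookup_coeff_to_poly lookup_add lookup_single ac_simps)

lemma ring_map_poly: "ring_map (\<lambda>g. poly g x)"
  by unfold_locales auto

lemma poly_to_poly: "poly (to_poly v F) (pvar v) = F"
proof (rule ring_map_eq_on_polys[of "\<lambda>F. poly (to_poly v F) (pvar v)" "\<lambda>F. F" F UNIV])
  show "ring_map (\<lambda>F. poly (to_poly v F) (pvar v))"
    by (rule ring_map_comp[OF ring_map_to_poly ring_map_poly])
  show "poly (to_poly v (pvar w)) (pvar v) = pvar w" for w
    by (cases "w = v") (auto simp: to_poly_pvar_self to_poly_pvar)
qed (auto simp: ring_map_id polys_in_UNIV to_poly_pconst)

lemma ring_map_pCons: "ring_map (\<lambda>x. [:x:])"
  by unfold_locales auto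

lemma to_poly_notin: "F \<in> polys_in V \<Longrightarrow> v \<notin> V \<Longrightarrow> to_poly v F = [:F:]"
  by (rule ring_map_eq_on_polys[OF ring_map_to_poly ring_map_pCons])
    (auto simp: to_poly_pconst intro!: to_poly_pvar)

lemma to_poly_poly:
  assumes "g \<in> coeffs_in (polys_in V)" "v \<notin> V"
  shows "to_poly v (poly g (pvar v)) = g"
proof -
  interpret ring_map "to_poly v" by (rule ring_map_to_poly)
  have "to_poly v (coeff g i) = [:coeff g i:]" for i
    using assms by (intro to_poly_notin[of _ V]) (auto simp: coeffs_in_def)
  then have "to_poly v (poly g (pvar v)) = (\<Sum>i\<le>degree g. monom (coeff g i) i)"
    unfolding poly_altdef map_sum map_mult map_power to_poly_pvar_self
    by (simp add: monom_altdef)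
  then show ?thesis using poly_as_sum_of_monoms[of g] by simp
qed

lemma poly_in_polys: "g \<in> coeffs_in (polys_in V) \<Longrightarrow> v \<in> V \<Longrightarrow> poly g (pvar v) \<in> polys_in V"
proof -
  interpret subring_set "polys_in V" by (rule subring_polys_in)
  show ?thesis if "g \<in> coeffs_in (polys_in V)" "v \<in> V"
    unfolding poly_altdef using that
    by (intro sum_mem mult_mem power_mem pvar_in_polys) (auto simp: coeffs_in_def)
qed

lemma to_poly_in: "F \<in> polys_in (insert v V) \<Longrightarrow> to_poly v F \<in> coeffs_in (polys_in V)"
  using coeff_to_poly_in[of F "insert v V" v] polys_in_mono[of "insert v V - {v}" V]
  by (auto simp: coeffs_in_def)

lemma coeffs_in_mono: "A \<subseteq> B \<Longrightarrow> coeffs_in A \<subseteq> coeffs_in B"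
  by (auto simp: coeffs_in_def)

lemma polys_in_insert:
  "polys_in (insert v V) = {poly g (pvar v) | g. g \<in> coeffs_in (polys_in V)}"
proof
  show "polys_in (insert v V) \<subseteq> {poly g (pvar v) | g. g \<in> coeffs_in (polys_in V)}"
    using to_poly_in[of _ v V] poly_to_poly[of v, symmetric] by blast
  show "{poly g (pvar v) | g. g \<in> coeffs_in (polys_in V)} \<subseteq> polys_in (insert v V)"
    using poly_in_polys[of _ "insert v V" v] coeffs_in_mono[OF polys_in_mono[of V "insert v V"]] by blast
qed


section \<open>Rank\<close>

abbreviation alg_over :: "('i, 'a::comm_ring_1) mpol set \<Rightarrow> 'i set \<Rightarrow> ('i, 'a) mpol \<Rightarrow> bool"
  where "alg_over Q V x \<equiv> algebraic_mod Q (polys_in V) x"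

lemma alg_over_mono: "alg_over Q V x \<Longrightarrow> V \<subseteq> W \<Longrightarrow> alg_over Q W x"
  using algebraic_mod_mono polys_in_mono by blast

definition rank_step :: "('i, 'a::comm_ring_1) mpol set \<Rightarrow> 'i \<Rightarrow> 'i set \<times> nat \<Rightarrow> 'i set \<times> nat"
  where "rank_step Q v = (\<lambda>(W, r). (insert v W, if alg_over Q W (pvar v) then r else Suc r))"

text \<open>The transcendence degree of \<open>V\<close> modulo \<open>Q\<close> over the fractions
  of the contraction of \<open>Q\<close> to the constants. The fold adds indeterminates in an
  unspecified order and counts those transcendental over the earlier ones, which is why its state
  carries a set. The value is independent of the order by \<open>rank_step_commute\<close>.\<close>

definition rank :: "('i, 'a::comm_ring_1) mpol set \<Rightarrow> 'i set \<Rightarrow> nat"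
  where "rank Q V = snd (Finite_Set.fold (rank_step Q) ({}, 0) V)"

locale mpol_prime = prime_id Q for Q :: "('i, 'a::comm_ring_1) mpol set"
begin

lemma prime_over: "prime_over Q (polys_in V)"
  by (intro prime_over.intro prime_id_axioms subring_polys_in)

lemma alg_over_self: "x \<in> polys_in V \<Longrightarrow> alg_over Q V x"
  by (rule algebraic_mod_self[OF prime_id_axioms subring_polys_in])

lemma alg_over_trans: "alg_over Q V (pvar u) \<Longrightarrow> alg_over Q (insert u V) x \<Longrightarrow> alg_over Q V x"
  unfolding polys_in_insert by (rule prime_over.algebraic_mod_trans[OF prime_over])

lemma alg_over_trans_set:
  assumes "finite C" "\<And>v. v \<in> C \<Longrightarrow> alg_over Q V (pvar v)" "alg_over Q (V \<union> C) x"
  shows "alg_over Q V x"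
  using assms
proof (induction C)
  case (insert u C)
  have "alg_over Q (V \<union> C) (pvar u)" by (rule alg_over_mono[OF insert.prems(1)]) auto
  then have "alg_over Q (V \<union> C) x" by (rule alg_over_trans) (use insert.prems(2) in simp)
  then show ?case using insert by blast
qed simp

text \<open>A relation for \<open>v\<close> over \<open>u\<close> and \<open>W\<close> is read as
  one for \<open>u\<close>. If all its coefficients in this reading were in \<open>Q\<close>, each
  of them, as a polynomial in the transcendental \<open>v\<close> over \<open>W\<close>, would have
  its own coefficients in \<open>Q\<close>, and so would the relation for \<open>v\<close>.\<close>

lemma alg_over_exchange:
  assumes "alg_over Q (insert u W) (pvar v)" "\<not> alg_over Q W (pvar v)"
  shows "alg_over Q (insert v W) (pvar u)"
proof (cases "u \<in> insert v W")
  case True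
  then show ?thesis by (intro alg_over_self pvar_in_polys)
next
  case False
  have vW: "v \<notin> insert u W" using False assms(2) by (auto dest: alg_over_self[OF pvar_in_polys])
  from assms(1) obtain g where g: "g \<in> coeffs_in (polys_in (insert u W))" "g \<notin> coeffs_in Q" "poly g (pvar v) \<in> Q"
    unfolding algebraic_mod_def by blast
  define F where "F = poly g (pvar v)"
  have Fin: "F \<in> polys_in (insert u (insert v W))"
    unfolding F_def using g(1) coeffs_in_mono[OF polys_in_mono[of "insert u W" "insert u (insert v W)"]]
    by (intro poly_in_polys) auto
  have gF: "to_poly v F = g" unfolding F_def by (rule to_poly_poly[OF g(1) vW])
  have "to_poly u F \<notin> coeffs_in Q"
  proof
    assume uF: "to_poly u F \<in> coeffs_in Q"
    have "coeff (to_poly u (coeff g j)) i \<in> Q" for i j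
    proof -
      define c where "c = coeff (to_poly u F) i"
      have "c \<in> Q" using uF by (auto simp: c_def coeffs_in_def)
      moreover have "to_poly v c \<in> coeffs_in (polys_in W)"
        unfolding c_def using to_poly_in[OF Fin] by (intro to_poly_in) (auto simp: coeffs_in_def)
      moreover have "poly (to_poly v c) (pvar v) = c" by (rule poly_to_poly)
      ultimately have "to_poly v c \<in> coeffs_in Q"
        using assms(2) unfolding algebraic_mod_def by metis
      then have "coeff (to_poly v (coeff (to_poly u F) i)) j \<in> Q" by (auto simp: c_def coeffs_in_def)
      then show ?thesis using coeff_to_poly_commute[of u v F i j] vW gF by auto
    qed
    then have "coeff g j \<in> Q" for j
      by (subst poly_to_poly[of u, symmetric]) (auto simp: poly_altdef intro!: sum multr)
    then show False using g(2) by (auto simp: coeffs_in_def)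
  qed
  moreover have "poly (to_poly u F) (pvar u) \<in> Q" using g(3) by (simp add: poly_to_poly F_def)
  ultimately show ?thesis unfolding algebraic_mod_def using to_poly_in[OF Fin] by blast
qed

lemma rank_step_commute: "comp_fun_commute (rank_step Q)"
proof
  fix u v
  have "rank_step Q v (rank_step Q u (W, r)) = rank_step Q u (rank_step Q v (W, r))" for W r
  proof -
    have "insert u (insert v W) = insert v (insert u W)" by blast
    moreover have "alg_over Q W (pvar u) \<Longrightarrow> alg_over Q (insert u W) (pvar v) = alg_over Q W (pvar v)"
      and "alg_over Q W (pvar v) \<Longrightarrow> alg_over Q (insert v W) (pvar u) = alg_over Q W (pvar u)"
      by (metis alg_over_trans alg_over_mono subset_insertI)+
    moreover have "\<not> alg_over Q W (pvar u) \<Longrightarrow> \<not> alg_over Q W (pvar v) \<Longrightarrow>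
        alg_over Q (insert u W) (pvar v) = alg_over Q (insert v W) (pvar u)"
      using alg_over_exchange by blast
    moreover have "alg_over Q W (pvar u) \<Longrightarrow> alg_over Q (insert v W) (pvar u)"
      and "alg_over Q W (pvar v) \<Longrightarrow> alg_over Q (insert u W) (pvar v)"
      using alg_over_mono subset_insertI by metis+
    ultimately show ?thesis
      unfolding rank_step_def prod.case
      by (cases "alg_over Q W (pvar u)"; cases "alg_over Q W (pvar v)") simp_all
  qed
  then show "rank_step Q v \<circ> rank_step Q u = rank_step Q u \<circ> rank_step Q v"
    by (auto simp: fun_eq_iff)
qed

lemma rank_empty: "rank Q {} = 0"
  by (simp add: rank_def)

lemma rank_insert:
  assumes "finite V"
  shows "rank Q (insert v V) = (if alg_over Q V (pvar v) then rank Q V else Suc (rank Q V))"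
proof (cases "v \<in> V")
  case True
  then show ?thesis using alg_over_self[OF pvar_in_polys[OF True]] by (simp add: insert_absorb)
next
  case False
  interpret comp_fun_commute "rank_step Q" by (rule rank_step_commute)
  define f where "f = Finite_Set.fold (rank_step Q) ({}, 0)"
  have step: "f (insert u U) = rank_step Q u (f U)" if "finite U" "u \<notin> U" for u U
    unfolding f_def using that by (rule fold_insert)
  have fst: "fst (f U) = U" if "finite U" for U
    using that
  proof (induction U rule: finite_induct)
    case (insert u U)
    then show ?case unfolding step[OF insert.hyps] by (simp add: rank_step_def split_def)
  qed (simp add: f_def)
  show ?thesis
    unfolding rank_def f_def[symmetric] step[OF assms False] using fst[OF assms]
    by (simp add: rank_step_def split_def)
qed

lemma rank_mono:
  assumes "finite W" "V \<subseteq> W"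
  shows "rank Q V \<le> rank Q W"
proof -
  have V: "finite V" using assms finite_subset by blast
  have "rank Q V \<le> rank Q (V \<union> D)" if "finite D" for D
    using that
  proof (induction D rule: finite_induct)
    case (insert w D)
    then show ?case using V rank_insert[of "V \<union> D" w] by (auto split: if_splits)
  qed simp
  from this[of W] show ?thesis using assms by (simp add: Un_absorb1)
qed

lemma rank_le_card: "finite V \<Longrightarrow> rank Q V \<le> card V"
  by (induction V rule: finite_induct) (auto simp: rank_empty rank_insert)

lemma rank_Un_le:
  assumes "finite W" "finite V"
  shows "rank Q (V \<union> W) \<le> rank Q V + card W"
  using assms(1)
proof (induction W rule: finite_induct)
  case (insert w W)
  then show ?case using rank_insert[of "V \<union> W" w] assms(2) by (simp split: if_splits)
qed simp

lemma rank_Un_eq: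
  assumes "finite W" "finite V" and alg: "\<And>w. w \<in> W \<Longrightarrow> alg_over Q V (pvar w)"
  shows "rank Q (V \<union> W) = rank Q V"
  using assms(1) alg
proof (induction W rule: finite_induct)
  case (insert w W)
  have "alg_over Q (V \<union> W) (pvar w)" by (rule alg_over_mono[OF insert.prems]) auto
  moreover have "rank Q (V \<union> W) = rank Q V" by (rule insert.IH) (simp add: insert.prems)
  ultimately show ?case using rank_insert[of "V \<union> W" w] assms(2) insert.hyps(1) by simp
qed simp

lemma ex_relative_basis:
  assumes V: "finite V" and L: "finite L"
  obtains B where "B \<subseteq> L" "rank Q (V \<union> B) = rank Q V + card B" "rank Q (V \<union> L) = rank Q V + card B"
    "\<forall>v\<in>L. alg_over Q (V \<union> B) (pvar v)"
proof -
  have "\<exists>B\<subseteq>L. rank Q (V \<union> B) = rank Q V + card B \<and> (\<forall>v\<in>L. alg_over Q (V \<union> B) (pvar v))"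
    using L
  proof (induction L rule: finite_induct)
    case (insert v L)
    from insert.IH obtain B where B: "B \<subseteq> L" "rank Q (V \<union> B) = rank Q V + card B"
      "\<forall>v\<in>L. alg_over Q (V \<union> B) (pvar v)" by blast
    have fin: "finite B" "finite (V \<union> B)" using B(1) insert.hyps V by (auto intro: finite_subset)
    show ?case
    proof (cases "alg_over Q (V \<union> B) (pvar v)")
      case True
      then show ?thesis using B by blast
    next
      case False
      have "alg_over Q (V \<union> insert v B) (pvar w)" if "w \<in> insert v L" for w
      proof (cases "w = v")
        case True
        then show ?thesis by (intro alg_over_self pvar_in_polys) simp
      next
        case False
        then have "alg_over Q (V \<union> B) (pvar w)" using that B(3) by blast
        then show ?thesis by (rule alg_over_mono) blast
      qed
      moreover have "v \<notin> B" using B(1) insert.hyps by blast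
      ultimately show ?thesis
        using B False fin by (intro exI[of _ "insert v B"]) (auto simp: rank_insert)
    qed
  qed auto
  then obtain B where B: "B \<subseteq> L" "rank Q (V \<union> B) = rank Q V + card B"
    and alg: "\<forall>v\<in>L. alg_over Q (V \<union> B) (pvar v)" by blast
  have "finite B" using B(1) L by (rule finite_subset)
  then have "rank Q (V \<union> B \<union> L) = rank Q V + card B"
    using rank_Un_eq[of L "V \<union> B"] V L B(2) alg by simp
  moreover have "V \<union> B \<union> L = V \<union> L" using B(1) by blast
  ultimately have "rank Q (V \<union> L) = rank Q V + card B" by (simp only:)
  with B alg show thesis by (intro that[of B]) auto
qed

text \<open>Equivalently, \<open>Q\<close> meets \<open>polys_in V\<close> in the extension of its
  contraction to the constants.\<close>

definition independent :: "'i set \<Rightarrow> bool"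
  where "independent V \<longleftrightarrow> (\<forall>F\<in>Q \<inter> polys_in V. \<forall>m. pconst (lookup F m) \<in> Q)"

lemma independentD: "independent V \<Longrightarrow> F \<in> Q \<Longrightarrow> F \<in> polys_in V \<Longrightarrow> pconst (lookup F m) \<in> Q"
  unfolding independent_def by blast

lemma coeffs_imp_mem: "(\<And>m. pconst (lookup F m) \<in> Q) \<Longrightarrow> F \<in> Q"
proof -
  assume *: "\<And>m. pconst (lookup F m) \<in> Q"
  have "(\<Sum>m\<in>keys F. pconst (lookup F m) * single m 1) \<in> Q"
    by (intro sum multr *)
  also have "(\<Sum>m\<in>keys F. pconst (lookup F m) * single m 1) = F"
    by (subst (3) mpol_eq_sum_single[of F]) (simp add: pconst_def mult_single)
  finally show ?thesis .
qed

lemma independent_iff_rank: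
  assumes "finite V"
  shows "independent V \<longleftrightarrow> rank Q V = card V"
  using assms
proof (induction V rule: finite_induct)
  case empty
  have "pconst (lookup F m) \<in> Q" if "F \<in> Q" "F \<in> polys_in {}" for F m
  proof -
    have "F = pconst (lookup F 0)"
    proof (rule poly_mapping_eqI)
      fix k
      have "keys k \<subseteq> {}" if "lookup F k \<noteq> 0"
        using \<open>F \<in> polys_in {}\<close> that by (rule polys_in_lookupD)
      then show "lookup F k = lookup (pconst (lookup F 0)) k"
        by (auto simp: lookup_pconst)
    qed
    then show ?thesis using that(1) lookup_pconst[of "lookup F 0" m] zero
      by (cases "m = 0") (auto simp: pconst_def)
  qed
  then show ?case by (auto simp: independent_def rank_empty)
next
  case (insert v V)
  show ?case
  proof
    assume ind: "independent (insert v V)"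
    then have "independent V" unfolding independent_def using polys_in_mono[of V "insert v V"] by blast
    moreover have "\<not> alg_over Q V (pvar v)"
    proof
      assume "alg_over Q V (pvar v)"
      then obtain g where g: "g \<in> coeffs_in (polys_in V)" "g \<notin> coeffs_in Q" "poly g (pvar v) \<in> Q"
        unfolding algebraic_mod_def by blast
      have tg: "to_poly v (poly g (pvar v)) = g" by (rule to_poly_poly[OF g(1) insert.hyps(2)])
      have "poly g (pvar v) \<in> polys_in (insert v V)" unfolding polys_in_insert using g(1) by blast
      then have *: "pconst (lookup (poly g (pvar v)) m) \<in> Q" for m
        using independentD[OF ind g(3)] by blast
      have "coeff g i \<in> Q" for i
      proof (rule coeffs_imp_mem)
        show "pconst (lookup (coeff g i) m) \<in> Q" for m
          using lookup_to_poly_iff[of "\<lambda>c. pconst c \<in> Q" v "poly g (pvar v)"] * zero unfolding tg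
          by (simp add: pconst_def)
      qed
      then show False using g(2) by (auto simp: coeffs_in_def)
    qed
    ultimately show "rank Q (insert v V) = card (insert v V)"
      using insert by (simp add: rank_insert)
  next
    assume "rank Q (insert v V) = card (insert v V)"
    moreover have "rank Q V \<le> card V" by (rule rank_le_card[OF insert.hyps(1)])
    ultimately have nalg: "\<not> alg_over Q V (pvar v)" and "rank Q V = card V"
      using insert.hyps by (auto simp: rank_insert split: if_splits)
    then have ind: "independent V" using insert.IH by simp
    show "independent (insert v V)"
      unfolding independent_def
    proof (intro ballI allI)
      fix F and m :: "'i \<Rightarrow>\<^sub>0 nat" assume F: "F \<in> Q \<inter> polys_in (insert v V)"
      have tF: "to_poly v F \<in> coeffs_in (polys_in V)" using F by (intro to_poly_in) auto
      have "to_poly v F \<in> coeffs_in Q"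
        using nalg tF F poly_to_poly[of v F] unfolding algebraic_mod_def by auto
      with tF have *: "pconst (lookup (coeff (to_poly v F) i) k) \<in> Q" for i k
        by (intro independentD[OF ind]) (auto simp: coeffs_in_def)
      then show "pconst (lookup F m) \<in> Q"
        using lookup_to_poly_iff[of "\<lambda>c. pconst c \<in> Q" v F] zero by (simp add: pconst_def)
    qed
  qed
qed

lemma ex_basis:
  assumes "finite V"
  obtains B where "B \<subseteq> V" "card B = rank Q V" "independent B" "\<forall>v\<in>V. alg_over Q B (pvar v)"
proof -
  obtain B where B: "B \<subseteq> V" "rank Q ({} \<union> B) = rank Q {} + card B" "rank Q ({} \<union> V) = rank Q {} + card B"
    "\<forall>v\<in>V. alg_over Q ({} \<union> B) (pvar v)"
    using ex_relative_basis[OF finite.emptyI assms] by blast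
  have "finite B" using B(1) assms by (rule finite_subset)
  then show thesis using B by (intro that[of B]) (simp_all add: rank_empty independent_iff_rank)
qed

end

lemma mpol_primeI: "prime_id Q \<Longrightarrow> mpol_prime Q"
  by (rule mpol_prime.intro)

section \<open>Ranks modulo comparable primes over the same prime of the base ring\<close>

definition same_contraction :: "('i, 'a::comm_ring_1) mpol set \<Rightarrow> ('j, 'a) mpol set \<Rightarrow> bool"
  where "same_contraction Q Q' \<longleftrightarrow> (\<forall>c. pconst c \<in> Q \<longleftrightarrow> pconst c \<in> Q')"

text \<open>A relation modulo \<open>Q\<close> is one modulo \<open>Q'\<close>, where its
  coefficients vanish; constants in \<open>Q'\<close> are already in \<open>Q\<close>.\<close>

lemma independent_antimono:
  assumes "mpol_prime Q" "mpol_prime Q'" and same: "same_contraction Q Q'"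
    and sub: "Q \<inter> polys_in V \<subseteq> Q'" and "B \<subseteq> V" and ind: "mpol_prime.independent Q' B"
  shows "mpol_prime.independent Q B"
proof -
  interpret Q: mpol_prime Q by fact
  interpret Q': mpol_prime Q' by fact
  show ?thesis
    unfolding Q.independent_def
  proof (intro ballI allI)
    fix F m assume F: "F \<in> Q \<inter> polys_in B"
    then have "F \<in> Q'" using sub polys_in_mono[OF \<open>B \<subseteq> V\<close>] by blast
    then have "pconst (lookup F m) \<in> Q'" using Q'.independentD[OF ind] F by blast
    then show "pconst (lookup F m) \<in> Q" using same unfolding same_contraction_def by blast
  qed
qed

lemma rank_antimono:
  assumes Q: "mpol_prime Q" "mpol_prime Q'" and same: "same_contraction Q Q'"
    and sub: "Q \<inter> polys_in V \<subseteq> Q'" and V: "finite V"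
  shows "rank Q' V \<le> rank Q V"
proof -
  interpret Q: mpol_prime Q by fact
  interpret Q': mpol_prime Q' by fact
  obtain B where B: "B \<subseteq> V" "card B = rank Q' V" "Q'.independent B"
    "\<forall>v\<in>V. alg_over Q' B (pvar v)" by (rule Q'.ex_basis[OF V])
  have "finite B" using B(1) V by (rule finite_subset)
  moreover have "Q.independent B" by (rule independent_antimono[OF Q same sub B(1) B(3)])
  ultimately have "rank Q B = card B" using Q.independent_iff_rank by blast
  then show ?thesis using Q.rank_mono[OF V B(1)] B(2) by simp
qed

text \<open>With equal ranks, a basis \<open>B\<close> modulo \<open>Q'\<close> would be one modulo
  \<open>Q\<close> too, and \<open>F\<close> would have a multiple congruent modulo \<open>Q\<close>
  to some \<open>a\<close> in \<open>polys_in B\<close> outside \<open>Q\<close>. But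
  \<open>F\<close> in \<open>Q'\<close> gives \<open>a\<close> in \<open>Q'\<close>, so the
  coefficients of \<open>a\<close> lie in the common contraction and \<open>a\<close> in
  \<open>Q\<close>.\<close>

lemma rank_strict_antimono:
  assumes Q: "mpol_prime Q" "mpol_prime Q'" and same: "same_contraction Q Q'"
    and sub: "Q \<inter> polys_in V \<subseteq> Q'" and V: "finite V"
    and F: "F \<in> Q'" "F \<notin> Q" "F \<in> polys_in V"
  shows "rank Q' V < rank Q V"
proof (rule ccontr)
  interpret Q: mpol_prime Q by fact
  interpret Q': mpol_prime Q' by fact
  assume "\<not> ?thesis"
  then have eq: "rank Q' V = rank Q V" using rank_antimono[OF Q same sub V] by simp
  obtain B where B: "B \<subseteq> V" "card B = rank Q' V" "Q'.independent B"
    "\<forall>v\<in>V. alg_over Q' B (pvar v)" by (rule Q'.ex_basis[OF V])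
  have fB: "finite B" using B(1) V by (rule finite_subset)
  have indB: "Q.independent B" by (rule independent_antimono[OF Q same sub B(1) B(3)])
  then have rB: "rank Q B = card B" using Q.independent_iff_rank[OF fB] by blast
  have alg: "alg_over Q B (pvar v)" if "v \<in> V" for v
  proof (rule ccontr)
    assume "\<not> ?thesis"
    then have "rank Q (insert v B) = Suc (card B)" using Q.rank_insert[OF fB] rB by simp
    moreover have "rank Q (insert v B) \<le> rank Q V" using that B(1) by (intro Q.rank_mono V) auto
    ultimately show False using B(2) eq by simp
  qed
  have "alg_over Q (B \<union> V) F"
    by (rule alg_over_mono[OF Q.alg_over_self[OF F(3)]]) simp
  with V alg have "alg_over Q B F" by (rule Q.alg_over_trans_set)
  then obtain a z where a: "a \<in> polys_in B" "a \<notin> Q" "z \<in> polys_in V" "z * F - a \<in> Q"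
    by (rule prime_over.ex_inverse_mod[OF Q.prime_over _ subring_polys_in polys_in_mono[OF B(1)] F(3,2)])
  interpret V: subring_set "polys_in V" by (rule subring_polys_in)
  have "z * F - a \<in> polys_in V"
    using a F(3) polys_in_mono[OF B(1)] by (intro V.diff_mem V.mult_mem) auto
  then have "z * F - a \<in> Q'" using a(4) sub by blast
  then have "a \<in> Q'" using Q'.diff_cong Q'.multl[OF F(1)] by blast
  then have "pconst (lookup a m) \<in> Q" for m
    using Q'.independentD[OF B(3) _ a(1)] same unfolding same_contraction_def by blast
  then show False using Q.coeffs_imp_mem a(2) by blast
qed


section \<open>Chains of primes\<close>

text \<open>This contracts \<open>Q\<close> to the polynomials free of \<open>v\<close> and extends
  it again, which makes \<open>v\<close> generic and forgets every relation for it.\<close>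

definition gen_var :: "'i \<Rightarrow> ('i, 'a::comm_ring_1) mpol set \<Rightarrow> ('i, 'a) mpol set"
  where "gen_var v Q = to_poly v -` coeffs_in Q"

definition gen_vars :: "'i list \<Rightarrow> ('i, 'a::comm_ring_1) mpol set \<Rightarrow> ('i, 'a) mpol set"
  where "gen_vars vs Q = foldr gen_var vs Q"

lemma gen_vars_simps: "gen_vars [] Q = Q" "gen_vars (v # vs) Q = gen_var v (gen_vars vs Q)"
  by (simp_all add: gen_vars_def)

lemma prime_gen_var: "prime_id Q \<Longrightarrow> prime_id (gen_var v Q)"
  unfolding gen_var_def by (rule ring_map.prime_vimage[OF ring_map_to_poly prime_id.prime_coeffs_in])

lemma prime_gen_vars: "prime_id Q \<Longrightarrow> prime_id (gen_vars vs Q)"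
  by (induction vs) (auto simp: gen_vars_simps prime_gen_var)

lemma (in prime_id) poly_in_Q: "g \<in> coeffs_in Q \<Longrightarrow> poly g x \<in> Q"
  by (auto simp: poly_altdef coeffs_in_def intro!: sum multr)

lemma gen_var_subset: "prime_id Q \<Longrightarrow> gen_var v Q \<subseteq> Q"
  using prime_id.poly_in_Q[of Q "to_poly v _" "pvar v"] by (auto simp: gen_var_def poly_to_poly)

lemma gen_vars_subset: "prime_id Q \<Longrightarrow> gen_vars vs Q \<subseteq> Q"
proof (induction vs)
  case (Cons v vs)
  then show ?case using gen_var_subset[OF prime_gen_vars, of Q v vs] by (auto simp: gen_vars_simps)
qed (simp add: gen_vars_simps)

lemma gen_var_notin:
  assumes "prime_id Q" "F \<in> polys_in V" "v \<notin> V"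
  shows "F \<in> gen_var v Q \<longleftrightarrow> F \<in> Q"
  using prime_id.zero[OF assms(1)] to_poly_notin[OF assms(2,3)]
  by (auto simp: gen_var_def coeffs_in_def coeff_pCons split: nat.splits)

lemma gen_vars_notin:
  assumes "prime_id Q" "F \<in> polys_in V" "set vs \<inter> V = {}"
  shows "F \<in> gen_vars vs Q \<longleftrightarrow> F \<in> Q"
  using assms(3)
  by (induction vs) (use gen_var_notin[OF prime_gen_vars[OF assms(1)] assms(2)] in \<open>auto simp: gen_vars_simps\<close>)

lemma pconst_gen_vars: "prime_id Q \<Longrightarrow> pconst c \<in> gen_vars vs Q \<longleftrightarrow> pconst c \<in> Q"
  by (rule gen_vars_notin[OF _ pconst_in_polys[of c "{}"]]) auto

lemma gen_vars_iff:
  assumes Q: "prime_id Q" and F: "F \<in> polys_in (set vs)"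
  shows "F \<in> gen_vars vs Q \<longleftrightarrow> (\<forall>m. pconst (lookup F m) \<in> Q)"
  using F
proof (induction vs arbitrary: F)
  case Nil
  interpret mpol_prime Q using Q by (rule mpol_primeI)
  have "independent {}" using independent_iff_rank[of "{}"] rank_empty by simp
  then show ?case using Nil independentD[of "{}" F] coeffs_imp_mem[of F] by (auto simp: gen_vars_simps)
next
  case (Cons v vs)
  have "coeff (to_poly v F) i \<in> polys_in (set vs)" for i
    using to_poly_in[of F v "set vs"] Cons.prems by (auto simp: coeffs_in_def)
  then have "F \<in> gen_vars (v # vs) Q \<longleftrightarrow>
      (\<forall>i k. pconst (lookup (coeff (to_poly v F) i) k) \<in> Q)"
    using Cons.IH by (auto simp: gen_vars_simps gen_var_def coeffs_in_def)
  also have "\<dots> \<longleftrightarrow> (\<forall>m. pconst (lookup F m) \<in> Q)"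
    by (rule lookup_to_poly_iff) (use prime_id.zero[OF Q] in \<open>simp add: pconst_def\<close>)
  finally show ?case .
qed

text \<open>Only the traces on \<open>polys_in V\<close> count. The base case compares traces as
  well, so that the upper end can be exchanged for any prime with a larger trace.\<close>

inductive prime_chain :: "'i set \<Rightarrow> nat \<Rightarrow> ('i, 'a::comm_ring_1) mpol set \<Rightarrow> ('i, 'a) mpol set \<Rightarrow> bool"
  for V where
  base: "prime_id P \<Longrightarrow> prime_id Q \<Longrightarrow> P \<inter> polys_in V \<subseteq> Q \<Longrightarrow> prime_chain V 0 P Q"
| step: "prime_chain V k P Q \<Longrightarrow> prime_id Q' \<Longrightarrow> Q \<inter> polys_in V \<subset> Q' \<inter> polys_in V \<Longrightarrow> prime_chain V (Suc k) P Q'"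

lemma prime_chain_weaken:
  "prime_chain V k P Q \<Longrightarrow> prime_id Q' \<Longrightarrow> Q \<inter> polys_in V \<subseteq> Q' \<Longrightarrow> prime_chain V k P Q'"
proof (induction rule: prime_chain.induct)
  case (base P Q)
  then show ?case by (intro prime_chain.base) auto
next
  case (step k P Q Q'')
  then have "prime_chain V k P Q" "Q \<inter> polys_in V \<subset> Q' \<inter> polys_in V" by auto
  then show ?case using step.prems by (intro prime_chain.step)
qed

lemma prime_chain_trans:
  assumes "prime_chain V l Q R" "prime_chain V k P Q"
  shows "prime_chain V (k + l) P R"
  using assms
proof (induction rule: prime_chain.induct)
  case (base P' Q')
  then show ?case by (simp add: prime_chain_weaken)
next
  case (step l P' Q' Q'')
  then show ?case using prime_chain.step[of V "k + l" P Q' Q''] by simp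
qed

lemma prime_chain_single:
  "prime_id P \<Longrightarrow> prime_id Q \<Longrightarrow> P \<inter> polys_in V \<subset> Q \<inter> polys_in V \<Longrightarrow> prime_chain V 1 P Q"
  using prime_chain.step[OF prime_chain.base[of P P V]] by simp

text \<open>Each indeterminate costs one strict step: its relation over \<open>B\<close> involves
  none of the indeterminates made generic before, hence survives up to that point, and is lost when
  the indeterminate itself becomes generic.\<close>

lemma prime_chain_gen_vars:
  assumes Q: "prime_id Q" and vs: "distinct vs" "set vs \<subseteq> V" and B: "B \<subseteq> V" "B \<inter> set vs = {}"
    and alg: "\<And>v. v \<in> set vs \<Longrightarrow> alg_over Q B (pvar v)"
  shows "prime_chain V (length vs) (gen_vars vs Q) Q"
  using vs B(2) alg
proof (induction vs)
  case Nil
  then show ?case using Q by (auto simp: gen_vars_simps intro: prime_chain.base)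
next
  case (Cons v vs)
  have IH: "prime_chain V (length vs) (gen_vars vs Q) Q" using Cons by auto
  define P where "P = gen_vars vs Q"
  have P: "prime_id P" unfolding P_def by (rule prime_gen_vars[OF Q])
  from Cons.prems(4) have "alg_over Q B (pvar v)" by simp
  then obtain g where g: "g \<in> coeffs_in (polys_in B)" "g \<notin> coeffs_in Q" "poly g (pvar v) \<in> Q"
    unfolding algebraic_mod_def by blast
  have F: "poly g (pvar v) \<in> polys_in (insert v B)" unfolding polys_in_insert using g(1) by blast
  have "poly g (pvar v) \<in> P"
    unfolding P_def using gen_vars_notin[OF Q F, of vs] g(3) Cons.prems(1,3) by auto
  moreover have "poly g (pvar v) \<notin> gen_var v P"
  proof -
    have "to_poly v (poly g (pvar v)) = g" using Cons.prems(3) by (intro to_poly_poly[OF g(1)]) auto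
    moreover have "g \<notin> coeffs_in P" using g(2) gen_vars_subset[OF Q] unfolding P_def coeffs_in_def by blast
    ultimately show ?thesis by (simp add: gen_var_def)
  qed
  moreover have "insert v B \<subseteq> V" using Cons.prems(2) B(1) by simp
  then have "poly g (pvar v) \<in> polys_in V" using F polys_in_mono by blast
  ultimately have "gen_var v P \<inter> polys_in V \<subset> P \<inter> polys_in V"
    using gen_var_subset[OF P] by blast
  then have "prime_chain V 1 (gen_var v P) P" by (rule prime_chain_single[OF prime_gen_var[OF P] P])
  from prime_chain_trans[OF IH[folded P_def] this] show ?case by (simp add: gen_vars_simps P_def)
qed

definition chain_length_in :: "'i set \<Rightarrow> 'a::comm_ring_1 itself \<Rightarrow> nat \<Rightarrow> bool"
  where "chain_length_in V (_ :: 'a itself) k \<longleftrightarrow> (\<exists>c :: nat \<Rightarrow> ('i, 'a) mpol set.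
    (\<forall>i\<le>k. prime_id (c i)) \<and> (\<forall>i<k. c i \<inter> polys_in V \<subset> c (Suc i) \<inter> polys_in V))"

lemma chain_length_in_if_prime_chain:
  fixes P :: "('i, 'a::comm_ring_1) mpol set"
  assumes "prime_chain V k P Q"
  shows "chain_length_in V TYPE('a) k"
proof -
  have "\<exists>c. (\<forall>i\<le>k. prime_id (c i)) \<and> (\<forall>i<k. c i \<inter> polys_in V \<subset> c (Suc i) \<inter> polys_in V) \<and> c k = Q"
    using assms
  proof (induction rule: prime_chain.induct)
    case (base P Q)
    then show ?case by (auto intro!: exI[of _ "\<lambda>_. Q"])
  next
    case (step k P Q Q')
    then obtain c where "\<forall>i\<le>k. prime_id (c i)" "\<forall>i<k. c i \<inter> polys_in V \<subset> c (Suc i) \<inter> polys_in V" "c k = Q"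
      by blast
    then show ?case using step.hyps
      by (intro exI[of _ "c(Suc k := Q')"]) (auto simp: le_Suc_eq less_Suc_eq)
  qed
  then show ?thesis unfolding chain_length_in_def by blast
qed


section \<open>Primes of the rings of polynomials\<close>

definition retract :: "'i set \<Rightarrow> ('i, 'a::comm_ring_1) mpol \<Rightarrow> ('i, 'a) mpol"
  where "retract V = peval pconst (\<lambda>v. if v \<in> V then pvar v else 0)"

lemma ring_map_retract: "ring_map (retract V)"
  unfolding retract_def by (rule ring_map_peval[OF ring_map_pconst])

lemma retract_id: "F \<in> polys_in V \<Longrightarrow> retract V F = F"
  by (rule ring_map_eq_on_polys[OF ring_map_retract ring_map_id])
    (auto simp: retract_def peval_pconst peval_pvar ring_map_pconst)

lemma retract_in: "retract V F \<in> polys_in V"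
proof -
  have "F \<in> polys_in UNIV" by (simp add: polys_in_UNIV)
  interpret ring_map "retract V" by (rule ring_map_retract)
  from \<open>F \<in> polys_in UNIV\<close> show ?thesis
  proof (induction rule: polys_in_induct)
    case (const c)
    then show ?case by (simp add: retract_def peval_pconst ring_map_pconst pconst_in_polys)
  next
    case (var v)
    then show ?case by (simp add: retract_def peval_pvar ring_map_pconst pvar_in_polys polys_in_0)
  qed (auto simp: map_add map_mult polys_in_add polys_in_mult)
qed

text \<open>The indeterminates outside \<open>V\<close> are sent to 0. Inclusions of primes of
  \<open>poly_ring V\<close> thus become inclusions in the whole polynomial type, as
  \<open>gain_if_rank\<close> requires.\<close>

definition extend_prime :: "'i set \<Rightarrow> ('i, 'a::comm_ring_1) mpol set \<Rightarrow> ('i, 'a) mpol set"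
  where "extend_prime V P = retract V -` P"

lemma extend_prime_Int: "P \<subseteq> polys_in V \<Longrightarrow> extend_prime V P \<inter> polys_in V = P"
  by (auto simp: extend_prime_def retract_id)

lemma extend_prime_iff: "F \<in> polys_in V \<Longrightarrow> F \<in> extend_prime V P \<longleftrightarrow> F \<in> P"
  by (auto simp: extend_prime_def retract_id)

lemma primeideal_subset: "primeideal P (poly_ring V) \<Longrightarrow> P \<subseteq> polys_in V"
proof -
  assume "primeideal P (poly_ring V)"
  then interpret primeideal P "poly_ring V" .
  show ?thesis using a_subset by (simp add: poly_ring_simps)
qed

lemma prime_extend_prime:
  assumes "primeideal P (poly_ring V)"
  shows "prime_id (extend_prime V P)"
proof -
  interpret primeideal P "poly_ring V" by fact
  interpret r: ring_map "retract V" by (rule ring_map_retract)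
  have mult: "a * b \<in> P" if "a \<in> P" "b \<in> polys_in V" for a b
    using I_r_closed[OF that(1), of b] that(2) by (simp add: poly_ring_simps)
  have "1 \<notin> P"
  proof
    assume "1 \<in> P"
    then have "polys_in V \<subseteq> P" using mult[of 1] by auto
    then show False using I_notcarr primeideal_subset[OF assms] by (auto simp: poly_ring_simps)
  qed
  moreover have "0 \<in> P" using additive_subgroup.zero_closed[OF is_additive_subgroup] by (simp add: poly_ring_simps)
  moreover have "a + b \<in> P" if "a \<in> P" "b \<in> P" for a b
    using additive_subgroup.a_closed[OF is_additive_subgroup that] by (simp add: poly_ring_simps)
  moreover have "a \<in> P \<or> b \<in> P" if "a * b \<in> P" "a \<in> polys_in V" "b \<in> polys_in V" for a b
    using I_prime[of a b] that by (simp add: poly_ring_simps)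
  ultimately show ?thesis
    unfolding extend_prime_def
    by unfold_locales (auto simp: r.map_zero r.map_one r.map_add r.map_mult retract_in mult)
qed

lemma primeideal_Int:
  assumes "prime_id Q"
  shows "primeideal (Q \<inter> polys_in V) (poly_ring V)"
proof -
  interpret Q: prime_id Q by fact
  interpret V: subring_set "polys_in V" by (rule subring_polys_in)
  let ?R = "poly_ring V"
  interpret R: cring ?R by (rule cring_poly_ring)
  show ?thesis
  proof (rule primeidealI)
    show "ideal (Q \<inter> polys_in V) ?R"
    proof (rule idealI)
      show "subgroup (Q \<inter> polys_in V) (add_monoid ?R)"
      proof (rule group.subgroupI[OF R.add.is_group])
        fix a assume a: "a \<in> Q \<inter> polys_in V"
        have "inv\<^bsub>add_monoid ?R\<^esub> a = \<ominus>\<^bsub>?R\<^esub> a" by (simp add: a_inv_def)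
        also have "\<dots> = - a"
          by (rule R.minus_equality) (use a in \<open>simp_all add: poly_ring_simps V.uminus_mem\<close>)
        finally show "inv\<^bsub>add_monoid ?R\<^esub> a \<in> Q \<inter> polys_in V" using a Q.uminus V.uminus_mem by auto
      qed (use Q.zero V.zero_mem in \<open>auto simp: poly_ring_simps Q.add V.add_mem\<close>)
    qed (auto simp: poly_ring_simps Q.multl Q.multr V.mult_mem R.ring_axioms)
    show "carrier ?R \<noteq> Q \<inter> polys_in V" using Q.one V.one_mem by (auto simp: poly_ring_simps)
  qed (use Q.prime in \<open>auto simp: poly_ring_simps R.cring_axioms\<close>)
qed

lemma krull_dim_poly_ring:
  "krull_dim (poly_ring V :: ('i, 'a::comm_ring_1) mpol ring) = (SUP k\<in>{k. chain_length_in V TYPE('a) k}. enat k)"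
proof -
  have "(\<exists>c :: nat \<Rightarrow> ('i, 'a) mpol set. (\<forall>i\<le>k. primeideal (c i) (poly_ring V)) \<and> (\<forall>i<k. c i \<subset> c (Suc i))) \<longleftrightarrow>
      chain_length_in V TYPE('a) k" (is "?L \<longleftrightarrow> _") for k
  proof
    assume ?L
    then obtain c :: "nat \<Rightarrow> ('i, 'a) mpol set" where
      c: "\<And>i. i \<le> k \<Longrightarrow> primeideal (c i) (poly_ring V)" "\<And>i. i < k \<Longrightarrow> c i \<subset> c (Suc i)" by blast
    then have "extend_prime V (c i) \<inter> polys_in V = c i" if "i \<le> k" for i
      using that by (intro extend_prime_Int primeideal_subset) auto
    then show "chain_length_in V TYPE('a) k"
      unfolding chain_length_in_def using c
      by (intro exI[of _ "\<lambda>i. extend_prime V (c i)"]) (auto simp: prime_extend_prime)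
  next
    assume "chain_length_in V TYPE('a) k"
    then obtain c :: "nat \<Rightarrow> ('i, 'a) mpol set" where
      "\<forall>i\<le>k. prime_id (c i)" "\<forall>i<k. c i \<inter> polys_in V \<subset> c (Suc i) \<inter> polys_in V"
      unfolding chain_length_in_def by blast
    then show ?L by (intro exI[of _ "\<lambda>i. c i \<inter> polys_in V"]) (auto simp: primeideal_Int)
  qed
  then show ?thesis unfolding krull_dim_def by simp
qed

lemma prime_pconst_vimage: "prime_id Q \<Longrightarrow> prime_id (pconst -` Q)"
  by (rule ring_map.prime_vimage[OF ring_map_pconst])

section \<open>Dominating a finite set of fractions\<close>

text \<open>\<open>hom_eval y D f\<close> is \<open>y\<^sup>D f(1/y)\<close>.\<close>

definition hom_eval :: "'b::comm_ring_1 \<Rightarrow> nat \<Rightarrow> 'b poly \<Rightarrow> 'b"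
  where "hom_eval y D f = (\<Sum>k\<le>D. coeff f k * y ^ (D - k))"

lemma hom_eval_add: "hom_eval y D (f + g) = hom_eval y D f + hom_eval y D g"
  by (simp add: hom_eval_def distrib_right sum.distrib)

lemma hom_eval_sum: "hom_eval y D (sum f A) = (\<Sum>x\<in>A. hom_eval y D (f x))"
  by (induction A rule: infinite_finite_induct) (simp_all add: hom_eval_add, simp_all add: hom_eval_def)

lemma hom_eval_monom: "n \<le> D \<Longrightarrow> hom_eval y D (monom c n) = c * y ^ (D - n)"
  by (simp add: hom_eval_def if_distrib[of "\<lambda>x. x * _"] cong: if_cong)

lemma hom_eval_mult:
  assumes "degree f \<le> D" "degree g \<le> D'"
  shows "hom_eval y (D + D') (f * g) = hom_eval y D f * hom_eval y D' g"
proof -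
  have "f * g = (\<Sum>i\<le>D. monom (coeff f i) i) * (\<Sum>j\<le>D'. monom (coeff g j) j)"
    using assms by (simp add: poly_as_sum_of_monoms')
  then have "f * g = (\<Sum>i\<le>D. \<Sum>j\<le>D'. monom (coeff f i * coeff g j) (i + j))"
    by (simp only: sum_product mult_monom)
  then have "hom_eval y (D + D') (f * g) =
      (\<Sum>i\<le>D. \<Sum>j\<le>D'. coeff f i * coeff g j * y ^ (D + D' - (i + j)))"
    by (simp add: hom_eval_sum hom_eval_monom)
  also have "\<dots> = (\<Sum>i\<le>D. \<Sum>j\<le>D'. (coeff f i * y ^ (D - i)) * (coeff g j * y ^ (D' - j)))"
  proof (intro sum.cong refl)
    fix i j assume "i \<in> {..D}" "j \<in> {..D'}"
    then have "D + D' - (i + j) = (D - i) + (D' - j)" by auto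
    then show "coeff f i * coeff g j * y ^ (D + D' - (i + j)) = (coeff f i * y ^ (D - i)) * (coeff g j * y ^ (D' - j))"
      by (simp add: power_add mult_ac)
  qed
  finally show ?thesis by (simp add: hom_eval_def sum_product)
qed

lemma hom_eval_const: "hom_eval y D [:c:] = c * y ^ D"
  using hom_eval_monom[of 0 D y c] by (simp add: monom_0)

lemma hom_eval_shift:
  assumes "degree f \<le> D"
  shows "hom_eval y (D + e) f = hom_eval y D f * y ^ e"
  using hom_eval_mult[OF assms, of 1 e y] hom_eval_const[of y e 1] by (simp add: one_pCons)

lemma hom_eval_linear: "hom_eval y 1 [:a, b:] = a * y + b"
  by (simp add: hom_eval_def)

text \<open>The kernel of the evaluation at \<open>1/y\<close> modulo \<open>Q\<close>.\<close>

definition eval_inverse_kernel :: "'b::comm_ring_1 \<Rightarrow> 'b set \<Rightarrow> 'b poly set"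
  where "eval_inverse_kernel y Q = {f. hom_eval y (degree f) f \<in> Q}"

context prime_id begin

lemma eval_inverse_kernel_iff:
  assumes "y \<notin> Q" "degree f \<le> D"
  shows "f \<in> eval_inverse_kernel y Q \<longleftrightarrow> hom_eval y D f \<in> Q"
proof -
  obtain e where D: "D = degree f + e" using assms(2) le_Suc_ex by blast
  have "hom_eval y D f = hom_eval y (degree f) f * y ^ e" unfolding D by (rule hom_eval_shift) simp
  then show ?thesis
    using power_notin[OF assms(1), of e] prime multr by (auto simp: eval_inverse_kernel_def)
qed

lemma prime_eval_inverse_kernel:
  assumes y: "y \<notin> Q"
  shows "prime_id (eval_inverse_kernel y Q)"
proof
  show "0 \<in> eval_inverse_kernel y Q" by (simp add: eval_inverse_kernel_def hom_eval_def zero)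
  show "1 \<notin> eval_inverse_kernel y Q" by (simp add: eval_inverse_kernel_def hom_eval_def one)
  fix f g :: "'b poly"
  let ?d = "degree f" and ?e = "degree g"
  have mult: "f * g \<in> eval_inverse_kernel y Q \<longleftrightarrow> hom_eval y ?d f * hom_eval y ?e g \<in> Q"
    using eval_inverse_kernel_iff[OF y degree_mult_le[of f g]] hom_eval_mult[of f ?d g ?e y] by simp
  show "f \<in> eval_inverse_kernel y Q \<Longrightarrow> f * g \<in> eval_inverse_kernel y Q"
    unfolding mult by (simp add: eval_inverse_kernel_def multr)
  show "f * g \<in> eval_inverse_kernel y Q \<Longrightarrow> f \<in> eval_inverse_kernel y Q \<or> g \<in> eval_inverse_kernel y Q"
    unfolding mult by (simp add: eval_inverse_kernel_def prime)
  assume "f \<in> eval_inverse_kernel y Q" "g \<in> eval_inverse_kernel y Q"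
  then have "hom_eval y (max ?d ?e) f \<in> Q" "hom_eval y (max ?d ?e) g \<in> Q"
    using eval_inverse_kernel_iff[OF y, of f "max ?d ?e"] eval_inverse_kernel_iff[OF y, of g "max ?d ?e"] by auto
  then show "f + g \<in> eval_inverse_kernel y Q"
    using eval_inverse_kernel_iff[OF y degree_add_le_max[of f g]] by (simp add: hom_eval_add add)
qed

end

section \<open>Nakayama's lemma and the charts of a blow-up\<close>

inductive_set lin_span :: "'b::comm_ring_1 set \<Rightarrow> 'b set \<Rightarrow> 'b set" for I M where
  zero: "0 \<in> lin_span I M"
| step: "c \<in> I \<Longrightarrow> \<beta> \<in> M \<Longrightarrow> x \<in> lin_span I M \<Longrightarrow> c * \<beta> + x \<in> lin_span I M"

lemma lin_span_base: "c \<in> I \<Longrightarrow> \<beta> \<in> M \<Longrightarrow> c * \<beta> \<in> lin_span I M"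
  using lin_span.step[OF _ _ lin_span.zero] by force

lemma lin_span_add: "x \<in> lin_span I M \<Longrightarrow> y \<in> lin_span I M \<Longrightarrow> x + y \<in> lin_span I M"
  by (induction rule: lin_span.induct) (auto simp: add.assoc intro: lin_span.step)

lemma lin_span_sum: "(\<And>x. x \<in> A \<Longrightarrow> f x \<in> lin_span I M) \<Longrightarrow> sum f A \<in> lin_span I M"
  by (induction A rule: infinite_finite_induct) (auto simp: lin_span.zero lin_span_add)

lemma lin_span_mult:
  assumes I: "\<And>a b. a \<in> I \<Longrightarrow> b * a \<in> I"
    and M: "\<And>\<beta> \<gamma>. \<beta> \<in> M \<Longrightarrow> \<gamma> \<in> M' \<Longrightarrow> \<beta> * \<gamma> \<in> M''"
    and x: "x \<in> lin_span I M" and y: "y \<in> lin_span UNIV M'"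
  shows "x * y \<in> lin_span I M''"
  using x
proof (induction rule: lin_span.induct)
  case (step c \<beta> x)
  have "c * \<beta> * y \<in> lin_span I M''"
    using y
  proof (induction rule: lin_span.induct)
    case (step d \<gamma> z)
    have "c * \<beta> * (d * \<gamma> + z) = (d * c) * (\<beta> * \<gamma>) + c * \<beta> * z" by (simp add: algebra_simps)
    also have "\<dots> \<in> lin_span I M''"
      using step \<open>c \<in> I\<close> \<open>\<beta> \<in> M\<close> by (intro lin_span.step I M)
    finally show ?case .
  qed (simp add: lin_span.zero)
  then show ?case using step.IH by (simp add: distrib_right lin_span_add)
qed (simp add: lin_span.zero)

lemma lin_span_eq_sum:
  assumes "finite M" "0 \<in> I" "\<And>a b. a \<in> I \<Longrightarrow> b \<in> I \<Longrightarrow> a + b \<in> I" "x \<in> lin_span I M"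
  shows "\<exists>c. (\<forall>\<beta>\<in>M. c \<beta> \<in> I) \<and> x = (\<Sum>\<beta>\<in>M. c \<beta> * \<beta>)"
  using assms(4)
proof (induction rule: lin_span.induct)
  case zero
  then show ?case using assms(2) by (auto intro!: exI[of _ "\<lambda>_. 0"])
next
  case (step a \<beta> x)
  then obtain c where c: "\<forall>\<beta>\<in>M. c \<beta> \<in> I" "x = (\<Sum>\<beta>\<in>M. c \<beta> * \<beta>)" by blast
  have "(\<Sum>\<gamma>\<in>M. (c(\<beta> := a + c \<beta>)) \<gamma> * \<gamma>) = (\<Sum>\<gamma>\<in>M. (if \<gamma> = \<beta> then a * \<beta> else 0) + c \<gamma> * \<gamma>)"
    by (intro sum.cong) (auto simp: distrib_right)
  also have "\<dots> = a * \<beta> + x" using assms(1) step.hyps(2) c(2) by (simp add: sum.distrib)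
  finally show ?case using c(1) assms(3) step.hyps(1,2) by (intro exI[of _ "c(\<beta> := a + c \<beta>)"]) auto
qed

text \<open>Nakayama's lemma in the localisation at \<open>Q'\<close>, with denominators cleared.
  One generator is eliminated at a time; \<open>s0 - c0 \<beta>0\<close> lies outside
  \<open>Q'\<close> and so acts as a unit.\<close>

lemma nakayama_mod_prime:
  assumes Q: "prime_id Q" and Q': "prime_id Q'" and QQ': "Q \<subseteq> Q'" and "finite M"
    and "\<And>\<beta>. \<beta> \<in> M \<Longrightarrow> \<exists>s c. s \<notin> Q' \<and> (\<forall>\<gamma>\<in>M. c \<gamma> \<in> Q') \<and> s * \<beta> - (\<Sum>\<gamma>\<in>M. c \<gamma> * \<gamma>) \<in> Q"
  shows "M \<subseteq> Q"
  using assms(4,5)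
proof (induction M rule: finite_induct)
  case (insert \<beta>0 M)
  interpret Q: prime_id Q by fact
  interpret Q': prime_id Q' by fact
  obtain s0 c0 where s0: "s0 \<notin> Q'" "\<forall>\<gamma>\<in>insert \<beta>0 M. c0 \<gamma> \<in> Q'"
    "s0 * \<beta>0 - (\<Sum>\<gamma>\<in>insert \<beta>0 M. c0 \<gamma> * \<gamma>) \<in> Q" using insert.prems[of \<beta>0] by auto
  define t where "t = s0 - c0 \<beta>0"
  have t: "t \<notin> Q'" unfolding t_def using s0(1,2) Q'.add[of "s0 - c0 \<beta>0" "c0 \<beta>0"] by auto
  have rel0: "t * \<beta>0 - (\<Sum>\<gamma>\<in>M. c0 \<gamma> * \<gamma>) \<in> Q"
    using s0(3) insert.hyps by (simp add: t_def algebra_simps)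
  have "M \<subseteq> Q"
  proof (rule insert.IH)
    fix \<beta> assume "\<beta> \<in> M"
    then obtain s c where s: "s \<notin> Q'" "\<forall>\<gamma>\<in>insert \<beta>0 M. c \<gamma> \<in> Q'"
      "s * \<beta> - (\<Sum>\<gamma>\<in>insert \<beta>0 M. c \<gamma> * \<gamma>) \<in> Q" using insert.prems[of \<beta>] by auto
    have "t * (s * \<beta> - (\<Sum>\<gamma>\<in>insert \<beta>0 M. c \<gamma> * \<gamma>)) + c \<beta>0 * (t * \<beta>0 - (\<Sum>\<gamma>\<in>M. c0 \<gamma> * \<gamma>)) \<in> Q"
      by (intro Q.add Q.multl s(3) rel0)
    also have "t * (s * \<beta> - (\<Sum>\<gamma>\<in>insert \<beta>0 M. c \<gamma> * \<gamma>)) + c \<beta>0 * (t * \<beta>0 - (\<Sum>\<gamma>\<in>M. c0 \<gamma> * \<gamma>)) =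
        (t * s) * \<beta> - (\<Sum>\<gamma>\<in>M. (t * c \<gamma> + c \<beta>0 * c0 \<gamma>) * \<gamma>)"
      using insert.hyps by (simp add: algebra_simps sum.distrib sum_distrib_left)
    finally have "(t * s) * \<beta> - (\<Sum>\<gamma>\<in>M. (t * c \<gamma> + c \<beta>0 * c0 \<gamma>) * \<gamma>) \<in> Q" .
    moreover have "t * s \<notin> Q'" using t s(1) by (rule Q'.mult_notin)
    moreover have "\<forall>\<gamma>\<in>M. t * c \<gamma> + c \<beta>0 * c0 \<gamma> \<in> Q'" using s(2) s0(2) by (auto intro!: Q'.add Q'.multl)
    ultimately show "\<exists>s c. s \<notin> Q' \<and> (\<forall>\<gamma>\<in>M. c \<gamma> \<in> Q') \<and> s * \<beta> - (\<Sum>\<gamma>\<in>M. c \<gamma> * \<gamma>) \<in> Q"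
      by (intro exI[of _ "t * s"] exI[of _ "\<lambda>\<gamma>. t * c \<gamma> + c \<beta>0 * c0 \<gamma>"]) blast
  qed
  moreover from this have "(\<Sum>\<gamma>\<in>M. c0 \<gamma> * \<gamma>) \<in> Q" by (auto intro!: Q.sum Q.multl)
  then have "t * \<beta>0 \<in> Q" using rel0 Q.diff_cong by blast
  then have "\<beta>0 \<in> Q" using t QQ' Q.prime by blast
  ultimately show ?case by simp
qed simp

text \<open>These elements generate the \<open>D\<close>-th power of the ideal generated by
  \<open>E\<close>.\<close>

definition products :: "'b::comm_ring_1 set \<Rightarrow> nat \<Rightarrow> 'b set"
  where "products E D = {prod_list xs | xs. set xs \<subseteq> E \<and> length xs = D}"

lemma finite_products: "finite E \<Longrightarrow> finite (products E D)"
  using finite_imageI[OF finite_lists_length_eq[of E D], of prod_list]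
  by (auto simp: products_def setcompr_eq_image)

lemma products_mult: "\<beta> \<in> products E D \<Longrightarrow> \<gamma> \<in> products E D' \<Longrightarrow> \<beta> * \<gamma> \<in> products E (D + D')"
  unfolding products_def by (force intro: exI[of _ "_ @ _"])

lemma power_in_products: "e \<in> E \<Longrightarrow> e ^ D \<in> products E D"
  unfolding products_def by (auto intro!: exI[of _ "replicate D e"] simp: prod_list_replicate split: if_splits)

lemma (in prime_id) products_notin: "E \<inter> Q = {} \<Longrightarrow> \<beta> \<in> products E D \<Longrightarrow> \<beta> \<notin> Q"
proof -
  have "prod_list xs \<notin> Q" if "set xs \<inter> Q = {}" for xs
    using that by (induction xs) (auto simp: one dest: prime)
  then show "E \<inter> Q = {} \<Longrightarrow> \<beta> \<in> products E D \<Longrightarrow> \<beta> \<notin> Q" unfolding products_def by blast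
qed

text \<open>Isolates a factor \<open>e ^ D\<close>: in \<open>ex_dominating\<close>, the assumption
  to be refuted speaks about such pure powers only.\<close>

lemma products_pigeonhole:
  assumes "finite E" "E \<noteq> {}" "\<beta> \<in> products E (card E * D)"
  obtains e \<gamma> where "e \<in> E" "\<gamma> \<in> products E (card E * D - D)" "\<beta> = e ^ D * \<gamma>"
proof -
  from assms(3) obtain xs where xs: "\<beta> = prod_list xs" "set xs \<subseteq> E" "length xs = card E * D"
    unfolding products_def by blast
  have "\<exists>e\<in>E. D \<le> count_list xs e"
  proof (rule ccontr)
    assume "\<not> ?thesis"
    then have "(\<Sum>e\<in>E. count_list xs e) < (\<Sum>e\<in>E. D)"
      using assms(1,2) by (intro sum_strict_mono) auto
    then show False using sum_count_set[OF xs(2) assms(1)] xs(3) by simp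
  qed
  then obtain e where e: "e \<in> E" "D \<le> count_list xs e" by blast
  define n where "n = count_list xs e"
  define ys where "ys = replicate (n - D) e @ filter (\<lambda>x. x \<noteq> e) xs"
  have "prod_list xs = e ^ count_list xs e * prod_list (filter (\<lambda>x. x \<noteq> e) xs)" for xs :: "'a list"
    by (induction xs) (auto simp: mult_ac)
  moreover have "count_list xs e + length (filter (\<lambda>x. x \<noteq> e) xs) = length xs" for xs :: "'a list"
    by (induction xs) auto
  ultimately have *: "prod_list xs = e ^ n * prod_list (filter (\<lambda>x. x \<noteq> e) xs)"
    "n + length (filter (\<lambda>x. x \<noteq> e) xs) = length xs"
    unfolding n_def by blast+
  have "prod_list xs = e ^ D * prod_list ys"
    using e(2) *(1) by (simp add: ys_def prod_list_replicate n_def mult.assoc[symmetric] power_add[symmetric])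
  moreover have "length ys = card E * D - D" using * xs(3) e(2) by (simp add: ys_def n_def)
  moreover have "set ys \<subseteq> E" using xs(2) e(1) by (auto simp: ys_def)
  ultimately show thesis using that[of e "prod_list ys"] e(1) xs(1) unfolding products_def by blast
qed

text \<open>The Rees algebra of the ideal generated by \<open>E\<close>. Evaluation of the variable
  at \<open>1/e\<close> maps it onto the ring generated by the fractions \<open>E/e\<close>, a chart
  of the blow-up.\<close>

definition rees :: "'b::comm_ring_1 set \<Rightarrow> 'b poly set"
  where "rees E = {f. \<forall>k. coeff f k \<in> lin_span UNIV (products E k)}"

text \<open>For \<open>f\<close> in \<open>rees E\<close> and \<open>e\<close> in \<open>E\<close>
  outside \<open>Q\<close> this says that \<open>f(1/e)\<close> lies in the ideal generated by
  \<open>Q'\<close> in the chart of \<open>e\<close> modulo \<open>Q\<close>: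
  \<open>e ^ D * f(1/e)\<close> has to be in \<open>Q'\<close> times the \<open>D\<close>-th power
  of the ideal of \<open>E\<close>. As \<open>e\<close> is in \<open>E\<close>, one sufficiently
  large \<open>D\<close> yields all larger ones.\<close>

definition fiber_ideal :: "'b::comm_ring_1 set \<Rightarrow> 'b \<Rightarrow> 'b set \<Rightarrow> 'b set \<Rightarrow> 'b poly set"
  where "fiber_ideal E e Q Q' =
    {f. \<exists>D0. \<forall>D\<ge>D0. \<exists>n\<in>lin_span Q' (products E D). hom_eval e D f - n \<in> Q}"

lemma rees_const: "[:c:] \<in> rees E"
proof -
  have "(c::'a) * 1 \<in> lin_span UNIV (products E 0)" for c
    by (rule lin_span_base) (auto simp: products_def)
  then show ?thesis by (auto simp: rees_def coeff_pCons lin_span.zero split: nat.splits)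
qed

lemma rees_add: "f \<in> rees E \<Longrightarrow> g \<in> rees E \<Longrightarrow> f + g \<in> rees E"
  by (simp add: rees_def lin_span_add)

lemma rees_mult:
  assumes "f \<in> rees E" "g \<in> rees E"
  shows "f * g \<in> rees E"
  unfolding rees_def mem_Collect_eq coeff_mult
proof (intro allI lin_span_sum)
  fix n i :: nat assume "i \<in> {..n}"
  then have n: "i + (n - i) = n" by simp
  show "coeff f i * coeff g (n - i) \<in> lin_span UNIV (products E n)"
    by (rule lin_span_mult[of UNIV "products E i" "products E (n - i)"])
      (use assms products_mult[of _ E i _ "n - i", unfolded n] in \<open>auto simp: rees_def\<close>)
qed

lemma rees_linear: "e \<in> E \<Longrightarrow> [:0, e:] \<in> rees E"
proof -
  assume "e \<in> E"
  then have "1 * e \<in> lin_span UNIV (products E (Suc 0))"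
    using power_in_products[of e E "Suc 0"] by (intro lin_span_base) auto
  then show ?thesis by (auto simp: rees_def coeff_pCons lin_span.zero split: nat.splits)
qed

context
  fixes E :: "'b::comm_ring_1 set" and Q Q' :: "'b set"
  assumes Q: "prime_id Q" and Q': "prime_id Q'" and QQ': "Q \<subseteq> Q'"
begin

interpretation Q: prime_id Q by (rule Q)
interpretation Q': prime_id Q' by (rule Q')

lemma fiber_ideal_add:
  assumes "f \<in> fiber_ideal E e Q Q'" "g \<in> fiber_ideal E e Q Q'"
  shows "f + g \<in> fiber_ideal E e Q Q'"
proof -
  from assms obtain D0 D1 where
    f: "\<And>D. D \<ge> D0 \<Longrightarrow> \<exists>n\<in>lin_span Q' (products E D). hom_eval e D f - n \<in> Q" and
    g: "\<And>D. D \<ge> D1 \<Longrightarrow> \<exists>n\<in>lin_span Q' (products E D). hom_eval e D g - n \<in> Q"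
    unfolding fiber_ideal_def by blast
  have "\<exists>n\<in>lin_span Q' (products E D). hom_eval e D (f + g) - n \<in> Q" if D: "D \<ge> max D0 D1" for D
  proof -
    from D f[of D] g[of D] obtain n m where "n \<in> lin_span Q' (products E D)" "hom_eval e D f - n \<in> Q"
      "m \<in> lin_span Q' (products E D)" "hom_eval e D g - m \<in> Q" by auto
    moreover have "hom_eval e D (f + g) - (n + m) = (hom_eval e D f - n) + (hom_eval e D g - m)"
      by (simp add: hom_eval_add)
    ultimately show ?thesis using lin_span_add Q.add by metis
  qed
  then show ?thesis unfolding fiber_ideal_def by blast
qed

lemma fiber_ideal_mult:
  assumes f: "f \<in> fiber_ideal E e Q Q'" and g: "g \<in> rees E" and e: "e \<in> E"
  shows "f * g \<in> fiber_ideal E e Q Q'"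
proof -
  from f obtain D0 where
    f: "\<And>D. D \<ge> D0 \<Longrightarrow> \<exists>n\<in>lin_span Q' (products E D). hom_eval e D f - n \<in> Q"
    unfolding fiber_ideal_def by blast
  define d where "d = degree g"
  have gd: "hom_eval e d g \<in> lin_span UNIV (products E d)"
    unfolding hom_eval_def
  proof (rule lin_span_sum)
    fix k assume "k \<in> {..d}"
    then have d: "k + (d - k) = d" by simp
    have "1 * e ^ (d - k) \<in> lin_span UNIV (products E (d - k))"
      by (intro lin_span_base power_in_products e UNIV_I)
    then show "coeff g k * e ^ (d - k) \<in> lin_span UNIV (products E d)"
      by (intro lin_span_mult[of UNIV "products E k" "products E (d - k)"])
        (use g products_mult[of _ E k _ "d - k", unfolded d] in \<open>auto simp: rees_def\<close>)
  qed
  have "\<exists>n\<in>lin_span Q' (products E D). hom_eval e D (f * g) - n \<in> Q"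
    if D: "D \<ge> max D0 (degree f) + d" for D
  proof -
    define D1 where "D1 = D - d"
    have D1: "D1 \<ge> D0" "D1 \<ge> degree f" "D = D1 + d" using D by (auto simp: D1_def)
    from f[OF D1(1)] obtain n where n: "n \<in> lin_span Q' (products E D1)" "hom_eval e D1 f - n \<in> Q" by blast
    have "n * hom_eval e d g \<in> lin_span Q' (products E D)"
      unfolding D1(3) by (rule lin_span_mult[OF _ _ n(1) gd]) (auto simp: Q'.multl products_mult)
    moreover have "hom_eval e D (f * g) - n * hom_eval e d g = (hom_eval e D1 f - n) * hom_eval e d g"
      unfolding D1(3) using hom_eval_mult[OF D1(2), of g d] by (simp add: d_def algebra_simps)
    then have "hom_eval e D (f * g) - n * hom_eval e d g \<in> Q" using Q.multr[OF n(2)] by simp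
    ultimately show ?thesis by blast
  qed
  then show ?thesis unfolding fiber_ideal_def by blast
qed

lemma fiber_ideal_const: "s \<in> Q' \<Longrightarrow> e \<in> E \<Longrightarrow> [:s:] \<in> fiber_ideal E e Q Q'"
  unfolding fiber_ideal_def
  by (auto simp: hom_eval_const Q.zero
    intro!: exI[of _ 0] bexI[of _ "s * e ^ _"] lin_span_base power_in_products)

lemma eval_inverse_kernel_subset:
  assumes "e \<notin> Q"
  shows "eval_inverse_kernel e Q \<subseteq> fiber_ideal E e Q Q'"
proof
  fix f assume f: "f \<in> eval_inverse_kernel e Q"
  have "\<exists>n\<in>lin_span Q' (products E D). hom_eval e D f - n \<in> Q" if "D \<ge> degree f" for D
    using f Q.eval_inverse_kernel_iff[OF assms that] lin_span.zero by (intro bexI[of _ 0]) auto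
  then show "f \<in> fiber_ideal E e Q Q'" unfolding fiber_ideal_def by blast
qed

text \<open>
  Some \<open>e \<in> E\<close> has the smallest value under some valuation that dominates \<open>Q'\<close>; for this \<open>e\<close>,
  the ideal \<open>Q'\<close> survives when the fractions \<open>E/e\<close> are adjoined.
\<close>

lemma ex_dominating:
  assumes E: "finite E" "E \<noteq> {}" "E \<inter> Q = {}"
  obtains e where "e \<in> E" "\<forall>s. [:s:] \<in> fiber_ideal E e Q Q' \<longrightarrow> s \<in> Q'"
proof (rule ccontr)
  assume "\<not> thesis"
  then have "\<forall>e\<in>E. \<exists>s. [:s:] \<in> fiber_ideal E e Q Q' \<and> s \<notin> Q'" using that by blast
  then obtain s where s: "\<And>e. e \<in> E \<Longrightarrow> [:s e:] \<in> fiber_ideal E e Q Q'" "\<And>e. e \<in> E \<Longrightarrow> s e \<notin> Q'" by metis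
  then have "\<forall>e\<in>E. \<exists>D0. \<forall>D\<ge>D0. \<exists>n\<in>lin_span Q' (products E D). s e * e ^ D - n \<in> Q"
    unfolding fiber_ideal_def by (simp add: hom_eval_const)
  from bchoice[OF this] obtain D0 where
    D0: "\<forall>e\<in>E. \<forall>D\<ge>D0 e. \<exists>n\<in>lin_span Q' (products E D). s e * e ^ D - n \<in> Q" by blast
  define D where "D = Max (D0 ` E)"
  have D: "\<exists>n\<in>lin_span Q' (products E D). s e * e ^ D - n \<in> Q" if "e \<in> E" for e
    using that D0 E by (auto simp: D_def)
  define M where "M = products E (card E * D)"
  \<comment> \<open>Every product of length \<open>card E * D\<close> contains some
    \<open>e ^ D\<close>. Up to the factor \<open>s e\<close> outside \<open>Q'\<close> it is
    therefore a combination of such products with coefficients in \<open>Q'\<close>, modulo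
    \<open>Q\<close>.\<close>
  have "M \<subseteq> Q"
  proof (rule nakayama_mod_prime[OF Q Q' QQ'])
    show finM: "finite M" unfolding M_def by (rule finite_products[OF E(1)])
    fix \<beta> assume "\<beta> \<in> M"
    then obtain e \<gamma> where e: "e \<in> E" "\<gamma> \<in> products E (card E * D - D)" "\<beta> = e ^ D * \<gamma>"
      unfolding M_def by (rule products_pigeonhole[OF E(1,2)])
    obtain n where n: "n \<in> lin_span Q' (products E D)" "s e * e ^ D - n \<in> Q" using D[OF e(1)] by blast
    have "card E \<ge> 1" using E by (simp add: card_gt_0_iff Suc_le_eq)
    then have "D \<le> card E * D" by simp
    then have ED: "D + (card E * D - D) = card E * D" by simp
    have "1 * \<gamma> \<in> lin_span UNIV (products E (card E * D - D))" by (intro lin_span_base e UNIV_I)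
    then have "n * \<gamma> \<in> lin_span Q' M"
      unfolding M_def using products_mult[of _ E D _ "card E * D - D", unfolded ED]
      by (intro lin_span_mult[OF _ _ n(1)]) (auto simp: Q'.multl)
    then have "\<exists>c. (\<forall>\<beta>\<in>M. c \<beta> \<in> Q') \<and> n * \<gamma> = (\<Sum>\<beta>\<in>M. c \<beta> * \<beta>)"
      by (intro lin_span_eq_sum finM) (auto simp: Q'.zero Q'.add)
    moreover have "s e * \<beta> - n * \<gamma> \<in> Q"
      using Q.multr[OF n(2), of \<gamma>] unfolding e(3) by (simp add: algebra_simps)
    ultimately show "\<exists>s c. s \<notin> Q' \<and> (\<forall>\<gamma>\<in>M. c \<gamma> \<in> Q') \<and> s * \<beta> - (\<Sum>\<gamma>\<in>M. c \<gamma> * \<gamma>) \<in> Q"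
      using s(2)[OF e(1)] by metis
  qed
  moreover obtain e where "e \<in> E" using E(2) by blast
  then have "e ^ (card E * D) \<in> M" unfolding M_def by (rule power_in_products)
  ultimately show False using Q.products_notin[OF E(3)] unfolding M_def by blast
qed

end

section \<open>Gain of rank and analytic independence\<close>

definition rename :: "('i \<Rightarrow> 'j) \<Rightarrow> ('i, 'a::comm_ring_1) mpol \<Rightarrow> ('j, 'a) mpol"
  where "rename f = peval pconst (\<lambda>v. pvar (f v))"

definition rename_mon :: "('i \<Rightarrow> 'j) \<Rightarrow> ('i \<Rightarrow>\<^sub>0 nat) \<Rightarrow> ('j \<Rightarrow>\<^sub>0 nat)"
  where "rename_mon f m = (\<Sum>v\<in>keys m. single (f v) (lookup m v))"

lemma ring_map_rename: "ring_map (rename f)"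
  unfolding rename_def by (rule ring_map_peval[OF ring_map_pconst])

lemma rename_pconst: "rename f (pconst c) = pconst c"
  by (simp add: rename_def peval_pconst ring_map_pconst)

lemma rename_pvar: "rename f (pvar v) = pvar (f v)"
  by (simp add: rename_def peval_pvar ring_map_pconst)

lemma mon_eval_rename:
  "mon_eval (\<lambda>v. pvar (f v)) m = (single (rename_mon f m) 1 :: ('j, 'a::comm_ring_1) mpol)"
  by (simp add: mon_eval_def rename_mon_def pvar_power prod_single_one)

lemma lookup_rename_mon:
  assumes "inj_on f V" "keys m \<subseteq> V" "v \<in> V"
  shows "lookup (rename_mon f m) (f v) = lookup m v"
proof -
  have "lookup (rename_mon f m) (f v) =
      (\<Sum>w\<in>keys m. if w = v then lookup m w else 0)"
    unfolding rename_mon_def lookup_sum lookup_single when_def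
    using assms by (intro sum.cong) (auto dest: inj_onD)
  then show ?thesis by (simp add: in_keys_iff)
qed

lemma rename_mon_inj:
  assumes "inj_on f V" "keys m \<subseteq> V" "keys k \<subseteq> V" "rename_mon f m = rename_mon f k"
  shows "m = k"
proof (rule poly_mapping_eqI)
  fix v
  show "lookup m v = lookup k v"
  proof (cases "v \<in> V")
    case True
    then show ?thesis using lookup_rename_mon[OF assms(1,2) True] lookup_rename_mon[OF assms(1,3) True] assms(4) by simp
  next
    case False
    then have "v \<notin> keys m" "v \<notin> keys k" using assms by auto
    then show ?thesis by (simp add: in_keys_iff)
  qed
qed

lemma lookup_rename:
  "lookup (rename f F) m =
    (\<Sum>k\<in>keys F. if rename_mon f k = m then lookup F k else 0)"
  unfolding rename_def peval_def lin_ext_def mon_eval_rename pconst_def mult_single lookup_sum lookup_single when_def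
  by (intro sum.cong) auto

lemma lookup_rename_rename_mon:
  assumes f: "inj_on f V" and F: "F \<in> polys_in V" and k: "keys k \<subseteq> V"
  shows "lookup (rename f F) (rename_mon f k) = lookup F k"
proof -
  have "lookup (rename f F) (rename_mon f k) =
      (\<Sum>l\<in>keys F. if l = k then lookup F l else 0)"
    unfolding lookup_rename using rename_mon_inj[OF f _ k] F by (intro sum.cong) (auto simp: polys_in_def)
  then show ?thesis by (simp add: in_keys_iff)
qed

lemma lookup_rename_cases:
  assumes f: "inj_on f V" and F: "F \<in> polys_in V"
  obtains "lookup (rename f F) m = 0"
    | k where "lookup (rename f F) m = lookup F k"
proof (cases "\<exists>k\<in>keys F. rename_mon f k = m")
  case True
  then obtain k where "k \<in> keys F" "m = rename_mon f k" by blast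
  then show ?thesis using that(2) lookup_rename_rename_mon[OF f F, of k] F by (auto simp: polys_in_def)
next
  case False
  then have "lookup (rename f F) m = 0" unfolding lookup_rename by (auto intro!: sum.neutral)
  then show ?thesis by (rule that(1))
qed

lemma rename_in: "F \<in> polys_in V \<Longrightarrow> rename f F \<in> polys_in (f ` V)"
proof (induction rule: polys_in_induct)
  case (add F G)
  then show ?case by (simp add: ring_map.map_add[OF ring_map_rename] polys_in_add)
next
  case (mult F G)
  then show ?case by (simp add: ring_map.map_mult[OF ring_map_rename] polys_in_mult)
qed (auto simp: rename_pconst rename_pvar pconst_in_polys pvar_in_polys)

lemma rename_surj: "F \<in> polys_in (f ` V) \<Longrightarrow> \<exists>G\<in>polys_in V. F = rename f G"
proof (induction rule: polys_in_induct)
  case (const c)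
  then show ?case using pconst_in_polys rename_pconst by metis
next
  case (var v)
  then show ?case using pvar_in_polys rename_pvar by (metis imageE)
next
  case (add F G)
  then show ?case using polys_in_add ring_map.map_add[OF ring_map_rename, symmetric] by metis
next
  case (mult F G)
  then show ?case using polys_in_mult ring_map.map_mult[OF ring_map_rename, symmetric] by metis
qed

text \<open>The \<open>A m\<close> are the coefficients of a polynomial in generic indeterminates.
  The induction extracts the terms in which the first of these has the exponent that it has in
  \<open>m\<close>.\<close>

lemma gen_vars_sum_imp_coeff:
  assumes Q: "prime_id Q"
  shows "finite M \<Longrightarrow> distinct vs \<Longrightarrow> set vs \<inter> W = {} \<Longrightarrow>
    (\<And>m. m \<in> M \<Longrightarrow> keys m \<subseteq> set vs \<and> A m \<in> polys_in W) \<Longrightarrow>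
    (\<Sum>m\<in>M. A m * mon_eval pvar m) \<in> gen_vars vs Q \<Longrightarrow> m \<in> M \<Longrightarrow> A m \<in> Q"
proof (induction vs arbitrary: M A m)
  case Nil
  then have "M = {0}" "m = 0" by auto
  then show ?case using Nil.prems(5) by (simp add: gen_vars_simps mon_eval_zero)
next
  case (Cons v vs)
  interpret t: ring_map "to_poly v" by (rule ring_map_to_poly)
  define i where "i = lookup m v"
  define N where "N = {k \<in> M. lookup k v = i}"
  define e where "e k = k - single v i" for k :: "'a \<Rightarrow>\<^sub>0 nat"
  have e: "e k + single v i = k" if "k \<in> N" for k
    using that by (intro poly_mapping_eqI) (auto simp: N_def e_def lookup_add lookup_minus lookup_single when_def)
  then have inj: "inj_on e N" by (metis inj_onI)
  have tA: "to_poly v (A k * mon_eval pvar k) =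
      monom (A k * mon_eval pvar (k - single v (lookup k v))) (lookup k v)"
    if "k \<in> M" for k
  proof -
    have "to_poly v (A k) = [:A k:]" using Cons.prems(3,4) that by (intro to_poly_notin[of _ W]) auto
    then show ?thesis by (simp add: t.map_mult mon_eval_pvar to_poly_single smult_monom)
  qed
  have "coeff (to_poly v (\<Sum>k\<in>M. A k * mon_eval pvar k)) i = (\<Sum>k\<in>M. if lookup k v = i then A k * mon_eval pvar (e k) else 0)"
    unfolding t.map_sum coeff_sum by (intro sum.cong) (auto simp: tA e_def)
  also have "\<dots> = (\<Sum>k\<in>N. A k * mon_eval pvar (e k))"
    using Cons.prems(1) by (simp add: N_def sum.inter_filter)
  also have "\<dots> = (\<Sum>k\<in>e ` N. A (k + single v i) * mon_eval pvar k)"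
    by (subst sum.reindex[OF inj]) (auto simp: e intro!: sum.cong)
  finally have eq: "coeff (to_poly v (\<Sum>k\<in>M. A k * mon_eval pvar k)) i =
      (\<Sum>k\<in>e ` N. A (k + single v i) * mon_eval pvar k)" .
  have "(\<Sum>k\<in>e ` N. A (k + single v i) * mon_eval pvar k) \<in> gen_vars vs Q"
    using Cons.prems(5) unfolding eq[symmetric] by (simp add: gen_vars_simps gen_var_def coeffs_in_def)
  then have "A (e m + single v i) \<in> Q"
  proof (rule Cons.IH[rotated 4])
    show "finite (e ` N)" using Cons.prems(1) by (simp add: N_def)
    show "e m \<in> e ` N" using Cons.prems(6) by (simp add: N_def i_def)
    fix k assume "k \<in> e ` N"
    then obtain l where l: "l \<in> N" "k = e l" by blast
    then have "keys k \<subseteq> keys l - {v}"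
      by (auto simp: e_def in_keys_iff lookup_minus lookup_single when_def N_def split: if_splits)
    then show "keys k \<subseteq> set vs \<and> A (k + single v i) \<in> polys_in W"
      using Cons.prems(4)[of l] l e by (auto simp: N_def)
  qed (use Cons.prems(2,3) in auto)
  then show ?case using e[of m] Cons.prems(6) by (simp add: N_def i_def)
qed

context mpol_prime begin

text \<open>An indeterminate that is transcendental over the rest of \<open>U\<close> is generic
  already, as far as \<open>polys_in U\<close> can tell.\<close>

lemma mem_gen_vars_if_not_alg:
  assumes "set vs \<subseteq> U" "\<And>v. v \<in> set vs \<Longrightarrow> \<not> alg_over Q (U - {v}) (pvar v)" "H \<in> Q" "H \<in> polys_in U"
  shows "H \<in> gen_vars vs Q"
  using assms
proof (induction vs arbitrary: H)
  case (Cons v vs)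
  have "H \<in> polys_in (insert v (U - {v}))" using Cons.prems(1,4) by (simp add: insert_absorb)
  then have t: "to_poly v H \<in> coeffs_in (polys_in (U - {v}))" by (rule to_poly_in)
  have "\<not> alg_over Q (U - {v}) (pvar v)" using Cons.prems(2) by simp
  then have "to_poly v H \<in> coeffs_in Q"
    using t Cons.prems(3) poly_to_poly[of v H] unfolding algebraic_mod_def by auto
  then have "coeff (to_poly v H) i \<in> gen_vars vs Q" for i
    using t polys_in_mono[of "U - {v}" U] Cons.prems(1,2) by (intro Cons.IH) (auto simp: coeffs_in_def)
  then show ?case by (simp add: gen_vars_simps gen_var_def coeffs_in_def)
qed (simp add: gen_vars_simps)

text \<open>Dropping the terms with coefficients in \<open>Q\<close> leaves a relation in which any
  coefficient may serve as a denominator.\<close>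

lemma not_independent_relation:
  assumes "\<not> independent Y"
  obtains G where "G \<in> Q" "G \<in> polys_in Y" "G \<noteq> 0"
    "\<forall>m\<in>keys G. pconst (lookup G m) \<notin> Q"
proof -
  from assms obtain F m0 where F: "F \<in> Q" "F \<in> polys_in Y" "pconst (lookup F m0) \<notin> Q"
    unfolding independent_def by blast
  define M where "M = {m \<in> keys F. pconst (lookup F m) \<notin> Q}"
  define G where "G = (\<Sum>m\<in>M. single m (lookup F m))"
  have fin: "finite M" by (simp add: M_def)
  have lookG: "lookup G m = (if m \<in> M then lookup F m else 0)" for m
    using fin by (simp add: G_def lookup_sum lookup_single when_def)
  have "F - G \<in> Q"
  proof (rule coeffs_imp_mem)
    fix m
    show "pconst (lookup (F - G) m) \<in> Q"
      using zero by (auto simp: lookup_minus lookG M_def in_keys_iff pconst_def)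
  qed
  then have "G \<in> Q" using diff_cong F(1) by blast
  moreover have "G \<in> polys_in Y" using F(2) by (auto simp: polys_in_def in_keys_iff lookG M_def split: if_splits)
  moreover have "lookup G m0 \<noteq> 0"
    using F(3) zero by (auto simp: lookG M_def in_keys_iff pconst_def)
  then have "G \<noteq> 0" by auto
  moreover have "\<forall>m\<in>keys G. pconst (lookup G m) \<notin> Q"
    by (auto simp: in_keys_iff lookG M_def split: if_splits)
  ultimately show thesis by (rule that)
qed

end

text \<open>
  \<open>gain q p h\<close>: there are \<open>h\<close> fractions over \<open>R/q\<close> that are algebraically independent modulo
  some prime over \<open>p\<close>; the prime \<open>Q\<close> is the kernel of the evaluation at these fractions.
\<close>

definition gain :: "'a::comm_ring_1 set \<Rightarrow> 'a set \<Rightarrow> nat \<Rightarrow> bool"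
  where "gain q p h \<longleftrightarrow> (\<exists>Q :: (nat, 'a) mpol set. prime_id Q \<and> (\<forall>c. pconst c \<in> Q \<longleftrightarrow> c \<in> q) \<and>
    (\<forall>F\<in>Q \<inter> polys_in {..<h}. \<forall>m. lookup F m \<in> p) \<and> (\<forall>j<h. alg_over Q {} (pvar j)))"

text \<open>The fractions \<open>E/e0\<close> are adjoined, and \<open>P\<close> is a prime over
  \<open>Q'\<close> in the larger ring. Modulo \<open>P\<close>, the rank of \<open>V\<close> is
  still at least that modulo \<open>Q'\<close>, but over the fractions it is at most
  \<open>b\<close>, because the normalised relations persist. The excess \<open>h\<close> must come
  from the fractions themselves.\<close>

theorem gain_if_rank:
  fixes Q Q' :: "('i, 'a::comm_ring_1) mpol set"
  assumes Q: "prime_id Q" and Q': "prime_id Q'" and QQ': "Q \<subseteq> Q'" and V: "finite V"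
    and h: "h + rank Q V \<le> rank Q' V"
  shows "gain (pconst -` Q) (pconst -` Q') h"
proof -
  interpret Q: mpol_prime Q using Q by (rule mpol_primeI)
  interpret Q': mpol_prime Q' using Q' by (rule mpol_primeI)
  interpret c: ring_map "pconst :: 'a \<Rightarrow> ('i, 'a) mpol" by (rule ring_map_pconst)
  define b where "b = rank Q V"
  define \<Y> where "\<Y> = {Y. Y \<subseteq> V \<and> card Y = Suc b}"
  have fin\<Y>: "finite \<Y>" using V by (simp add: \<Y>_def)
  have "\<exists>G. G \<in> Q \<and> G \<in> polys_in Y \<and> G \<noteq> 0 \<and> (\<forall>m\<in>keys G. pconst (lookup G m) \<notin> Q)"
    if "Y \<in> \<Y>" for Y
  proof -
    have Y: "finite Y" "Y \<subseteq> V" "card Y = Suc b" using that V by (auto simp: \<Y>_def intro: finite_subset)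
    have "rank Q Y \<noteq> card Y" using Q.rank_mono[OF V Y(2)] Y(3) by (simp add: b_def)
    then have "\<not> Q.independent Y" using Q.independent_iff_rank[OF Y(1)] by blast
    then show ?thesis by (rule Q.not_independent_relation) blast
  qed
  then obtain G where G: "\<And>Y. Y \<in> \<Y> \<Longrightarrow> G Y \<in> Q" "\<And>Y. Y \<in> \<Y> \<Longrightarrow> G Y \<in> polys_in Y"
    "\<And>Y. Y \<in> \<Y> \<Longrightarrow> G Y \<noteq> 0"
    "\<And>Y m. Y \<in> \<Y> \<Longrightarrow> m \<in> keys (G Y) \<Longrightarrow> pconst (lookup (G Y) m) \<notin> Q"
    by metis
  \<comment> \<open>An element of \<open>C\<close> selects one coefficient of every relation.
    Replacing a single selected coefficient gives another element of \<open>C\<close>, so one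
    denominator from \<open>E\<close> serves all relations simultaneously.\<close>
  define C where "C = (\<Pi>\<^sub>E Y\<in>\<Y>. lookup (G Y) ` keys (G Y))"
  define E where "E = (\<lambda>c. \<Prod>Y\<in>\<Y>. c Y) ` C"
  define E' where "E' = (pconst ` E :: ('i, 'a) mpol set)"
  have finE: "finite E" unfolding E_def C_def using fin\<Y> by (intro finite_imageI finite_PiE) auto
  have "C \<noteq> {}" unfolding C_def PiE_eq_empty_iff using G(3) by auto
  then have E'ne: "E' \<noteq> {}" unfolding E'_def E_def by blast
  have pconst_prod: "pconst (prod f N) = (\<Prod>x\<in>N. pconst (f x) :: ('i, 'a) mpol)" for f :: "'i set \<Rightarrow> 'a" and N
    by (induction N rule: infinite_finite_induct) (auto simp: c.map_mult c.map_one)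
  have EQ: "pconst e \<notin> Q" if e: "e \<in> E" for e
  proof -
    from e obtain c where c: "c \<in> C" "e = (\<Prod>Y\<in>\<Y>. c Y)" unfolding E_def by blast
    have "pconst (c Y) \<notin> Q" if "Y \<in> \<Y>" for Y
    proof -
      have "c Y \<in> lookup (G Y) ` keys (G Y)"
        using c(1) that unfolding C_def by (rule PiE_mem)
      then show ?thesis using G(4)[OF that] by auto
    qed
    then show ?thesis unfolding c(2) pconst_prod by (rule Q.prod_notin)
  qed
  have "finite E'" "E' \<inter> Q = {}" using finE EQ by (auto simp: E'_def)
  from ex_dominating[OF Q Q' QQ' this(1) E'ne this(2)] obtain e' where
    e': "e' \<in> E'" "\<forall>s. [:s:] \<in> fiber_ideal E' e' Q Q' \<longrightarrow> s \<in> Q'" by blast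
  from e'(1) obtain c0 where c0: "c0 \<in> C" "e' = pconst (\<Prod>Y\<in>\<Y>. c0 Y)" unfolding E'_def E_def by blast
  define e0 where "e0 = (\<Prod>Y\<in>\<Y>. c0 Y)"
  have e0: "e0 \<in> E" "e' = pconst e0" "e' \<notin> Q" using c0 EQ unfolding E_def e0_def by auto

  \<comment> \<open>\<open>Inl i\<close> is the old indeterminate \<open>i\<close>, and
    \<open>Inr e\<close> stands for \<open>e/e0\<close>, realised as \<open>e\<close> times a
    variable that is later evaluated at \<open>1/e0\<close>. Labels outside \<open>E\<close> are
    sent to 0, which keeps the image inside \<open>rees E'\<close>.\<close>
  define \<psi> where "\<psi> = (peval (\<lambda>c. [:pconst c:])
    (case_sum (\<lambda>i. [:pvar i:]) (\<lambda>e. if e \<in> E then [:0, pconst e:] else 0)) :: ('i + 'a, 'a) mpol \<Rightarrow> ('i, 'a) mpol poly)"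
  have rm: "ring_map (\<lambda>c. [:pconst c :: ('i, 'a) mpol:])"
    by (rule ring_map_comp[OF ring_map_pconst ring_map_pCons])
  interpret \<psi>: ring_map \<psi> unfolding \<psi>_def by (rule ring_map_peval[OF rm])
  have \<psi>s: "\<psi> (pconst c) = [:pconst c:]" "\<psi> (pvar (Inl i)) = [:pvar i:]"
    "e \<in> E \<Longrightarrow> \<psi> (pvar (Inr e)) = [:0, pconst e:]" for c i e
    by (simp_all add: \<psi>_def peval_pconst[OF rm] peval_pvar[OF rm])
  have rees: "\<psi> F \<in> rees E'" for F
  proof -
    have "F \<in> polys_in UNIV" by (simp add: polys_in_UNIV)
    then show ?thesis
    proof (induction rule: polys_in_induct)
      case (var v)
      then show ?case
        using rees_const[of 0 E'] by (cases v) (auto simp: \<psi>_def peval_pvar[OF rm] E'_def rees_const intro!: rees_linear)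
    qed (auto simp: \<psi>s \<psi>.map_add \<psi>.map_mult rees_const rees_add rees_mult)
  qed
  \<comment> \<open>\<open>K\<close> consists of the relations that hold modulo \<open>Q\<close>,
    and \<open>J\<close> of those modulo the ideal that \<open>Q'\<close> generates in the chart.
    The choice of \<open>e'\<close> ensures that \<open>J\<close> contains no old polynomial outside
    \<open>Q'\<close>, so some prime over \<open>J\<close> contracts exactly to
    \<open>Q'\<close>.\<close>
  define K where "K = \<psi> -` eval_inverse_kernel e' Q"
  define J where "J = \<psi> -` fiber_ideal E' e' Q Q'"
  have primeK: "prime_id K" unfolding K_def
    by (rule \<psi>.prime_vimage[OF Q.prime_eval_inverse_kernel[OF e0(3)]])
  have KJ: "K \<subseteq> J" unfolding K_def J_def using eval_inverse_kernel_subset[OF Q Q' QQ' e0(3)] by blast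
  define \<iota> where "\<iota> = (rename Inl :: ('i, 'a) mpol \<Rightarrow> ('i + 'a, 'a) mpol)"
  interpret \<iota>: ring_map \<iota> unfolding \<iota>_def by (rule ring_map_rename)
  have \<psi>\<iota>: "\<psi> (\<iota> s) = [:s:]" for s
    by (rule ring_map_eq_on_polys[OF ring_map_comp[OF \<iota>.ring_map_axioms \<psi>.ring_map_axioms] ring_map_pCons, of s UNIV])
      (auto simp: polys_in_UNIV \<iota>_def rename_pconst rename_pvar \<psi>s)
  obtain P where P: "prime_id P" "J \<subseteq> P" "P \<inter> \<iota> ` (- Q') = {}"
  proof (rule ex_prime_avoiding)
    show "0 \<in> J" using KJ prime_id.zero[OF primeK] by blast
    show "F + G \<in> J" if "F \<in> J" "G \<in> J" for F G
      using that fiber_ideal_add[OF Q Q' QQ'] by (simp add: J_def \<psi>.map_add)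
    show "F * G \<in> J" if "F \<in> J" for F G
      using that fiber_ideal_mult[OF Q Q' QQ' _ rees e'(1)] by (simp add: J_def \<psi>.map_mult)
    show "1 \<in> \<iota> ` (- Q')" using \<iota>.map_one Q'.one by (metis ComplI imageI)
    show "F * G \<in> \<iota> ` (- Q')" if "F \<in> \<iota> ` (- Q')" "G \<in> \<iota> ` (- Q')" for F G
    proof -
      from that obtain s t where "F = \<iota> s" "s \<notin> Q'" "G = \<iota> t" "t \<notin> Q'" by blast
      then have "F * G = \<iota> (s * t)" "s * t \<in> - Q'" using Q'.prime by (auto simp: \<iota>.map_mult)
      then show ?thesis by blast
    qed
    show "J \<inter> \<iota> ` (- Q') = {}" using e'(2) by (auto simp: J_def \<psi>\<iota>)
  qed
  interpret P: mpol_prime P using P(1) by (rule mpol_primeI)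
  have P\<iota>: "\<iota> s \<in> P \<longleftrightarrow> s \<in> Q'" for s
  proof
    assume "s \<in> Q'"
    then have "\<iota> s \<in> J" unfolding J_def using fiber_ideal_const[OF Q Q' QQ' _ e'(1)] by (simp add: \<psi>\<iota>)
    then show "\<iota> s \<in> P" using P(2) by blast
  qed (use P(3) in blast)
  have Pc: "pconst c \<in> P \<longleftrightarrow> pconst c \<in> Q'" for c
    using P\<iota>[of "pconst c"] by (simp add: \<iota>_def rename_pconst)

  define T where "T = (Inr ` E :: ('i + 'a) set)"
  define W where "W = (Inl ` V :: ('i + 'a) set)"
  have finTW: "finite T" "finite W" using finE V by (auto simp: T_def W_def)
  have "rank Q' V \<le> rank P W"
  proof -
    obtain B where B: "B \<subseteq> V" "card B = rank Q' V" "Q'.independent B" "\<forall>v\<in>V. alg_over Q' B (pvar v)"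
      by (rule Q'.ex_basis[OF V])
    have "P.independent (Inl ` B)"
      unfolding P.independent_def
    proof (intro ballI allI)
      fix F m assume "F \<in> P \<inter> polys_in (Inl ` B)"
      then obtain F0 where F0: "F0 \<in> polys_in B" "F = \<iota> F0" "F0 \<in> Q'"
        using rename_surj P\<iota> unfolding \<iota>_def by blast
      then have coeff: "pconst (lookup F0 k) \<in> P" for k using Q'.independentD[OF B(3)] Pc by blast
      have "inj_on Inl B" by simp
      from this F0(1) show "pconst (lookup F m) \<in> P"
        unfolding F0(2) \<iota>_def
        by (rule lookup_rename_cases[of Inl B F0 m]) (use coeff P.zero in \<open>auto simp: pconst_def\<close>)
    qed
    moreover have "finite B" using B(1) V by (rule finite_subset)
    ultimately have "rank P (Inl ` B) = card B"
      using P.independent_iff_rank[of "Inl ` B"] by (simp add: card_image)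
    then show ?thesis using P.rank_mono[OF finTW(2), of "Inl ` B"] B(1,2) by (auto simp: W_def)
  qed
  also have "rank P W \<le> rank P (T \<union> W)" using finTW by (intro P.rank_mono) auto
  also have "rank P (T \<union> W) \<le> rank P T + b"
  proof -
    obtain B where B: "B \<subseteq> W" "rank P (T \<union> B) = rank P T + card B" "rank P (T \<union> W) = rank P T + card B"
      "\<forall>v\<in>W. alg_over P (T \<union> B) (pvar v)"
      by (rule P.ex_relative_basis[OF finTW])
    have finB: "finite B" using B(1) finTW(2) by (rule finite_subset)
    have notalg: "\<not> alg_over P (T \<union> (B - {y})) (pvar y)" if "y \<in> B" for y
    proof
      assume "alg_over P (T \<union> (B - {y})) (pvar y)"
      then have "rank P (insert y (T \<union> (B - {y}))) = rank P (T \<union> (B - {y}))"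
        using P.rank_insert finTW finB by simp
      moreover have "insert y (T \<union> (B - {y})) = T \<union> B" using that by blast
      moreover have "rank P (T \<union> (B - {y})) \<le> rank P T + card (B - {y})"
        using finTW finB by (intro P.rank_Un_le) auto
      moreover have "card (B - {y}) < card B" using that finB by (rule card_Diff1_less[rotated])
      ultimately show False using B(2) by simp
    qed
    have "card B \<le> b"
    proof (rule ccontr)
      assume "\<not> card B \<le> b"
      then obtain Y' where Y': "Y' \<subseteq> B" "card Y' = Suc b" by (metis Suc_leI not_le obtain_subset_with_card_n)
      then obtain Y where Y: "Y \<subseteq> V" "Y' = Inl ` Y" using B(1) unfolding W_def by (metis subset_imageE subset_trans)
      then have Y\<Y>: "Y \<in> \<Y>" using Y'(2) by (simp add: \<Y>_def card_image)
      \<comment> \<open>With \<open>r\<close>, the product of the coefficients selected from the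
        other relations, all coefficients of \<open>r * g\<close> belong to \<open>E\<close>, and
        the one at \<open>m0\<close> below is \<open>e0\<close>. Divided by \<open>e0\<close>, the
        relation has a coefficient 1.\<close>
      define r where "r = (\<Prod>Z\<in>\<Y> - {Y}. c0 Z)"
      define g where "g = G Y"
      define t where "t m = lookup g m * r" for m
      have tE: "t m \<in> E" if "m \<in> keys g" for m
      proof -
        have "c0(Y := lookup g m) \<in> C"
          using PiE_fun_upd[OF _ c0(1)[unfolded C_def], of "lookup g m" Y] that Y\<Y>
          unfolding C_def by (simp add: g_def insert_absorb)
        moreover have "(\<Prod>Z\<in>\<Y>. (c0(Y := lookup g m)) Z) = t m"
          unfolding prod.remove[OF fin\<Y> Y\<Y>] t_def r_def by (auto intro!: arg_cong2[where f="(*)"] prod.cong)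
        ultimately show ?thesis unfolding E_def by force
      qed
      have "c0 Y \<in> lookup g ` keys g"
        using c0(1) Y\<Y> unfolding C_def g_def by (rule PiE_mem)
      then obtain m0 where m0: "m0 \<in> keys g" "c0 Y = lookup g m0" by blast
      then have t0: "t m0 = e0" unfolding t_def e0_def r_def prod.remove[OF fin\<Y> Y\<Y>] by simp
      define N where "N = (rename_mon Inl ` keys g :: ('i + 'a \<Rightarrow>\<^sub>0 nat) set)"
      have keysY: "keys m \<subseteq> Y" if "m \<in> keys g" for m
        using G(2)[OF Y\<Y>] that by (auto simp: polys_in_def g_def)
      have inj: "inj_on (rename_mon Inl :: _ \<Rightarrow> ('i + 'a) \<Rightarrow>\<^sub>0 nat) (keys g)"
        using keysY by (intro inj_onI rename_mon_inj[of Inl Y]) auto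
      define A where "A (k :: 'i + 'a \<Rightarrow>\<^sub>0 nat) = (pvar (Inr (t (the_inv_into (keys g) (rename_mon Inl) k))) :: ('i + 'a, 'a) mpol)" for k
      define H where "H = (\<Sum>k\<in>N. A k * mon_eval pvar k)"
      have H: "H = (\<Sum>m\<in>keys g. pvar (Inr (t m)) * \<iota> (mon_eval pvar m))"
      proof -
        have "\<iota> (mon_eval pvar m) = mon_eval pvar (rename_mon Inl m)" for m
        proof -
          have "\<iota> (single m 1) = single (rename_mon Inl m) 1"
            unfolding \<iota>_def rename_def peval_single[OF ring_map_pconst] mon_eval_rename by (simp add: pconst_def)
          then show ?thesis unfolding mon_eval_pvar .
        qed
        then show ?thesis
          unfolding H_def N_def by (subst sum.reindex[OF inj]) (auto simp: A_def the_inv_into_f_f[OF inj] intro!: sum.cong)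
      qed
      have "\<psi> H = (\<Sum>m\<in>keys g. [:0, pconst (t m):] * [:mon_eval pvar m:])"
        unfolding H \<psi>.map_sum \<psi>.map_mult \<psi>\<iota> using tE by (intro sum.cong) (auto simp: \<psi>s)
      also have "\<dots> = (\<Sum>m\<in>keys g. monom (pconst (t m) * mon_eval pvar m) 1)"
        by (intro sum.cong) (auto simp: monom_altdef)
      also have "\<dots> = monom (\<Sum>m\<in>keys g. pconst (t m) * mon_eval pvar m) 1"
        by (rule poly_eqI) (simp add: coeff_sum)
      also have "(\<Sum>m\<in>keys g. pconst (t m) * mon_eval pvar m) = pconst r * g"
      proof -
        have "(\<Sum>m\<in>keys g. pconst (t m) * mon_eval pvar m) =
            pconst r * (\<Sum>m\<in>keys g. single m (lookup g m))"
          unfolding sum_distrib_left t_def mon_eval_pvar pconst_def mult_single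
          by (intro sum.cong) (auto simp: mult.commute)
        then show ?thesis using mpol_eq_sum_single[of g] by simp
      qed
      finally have \<psi>H: "\<psi> H = [:0, pconst r * g:]" by (simp add: monom_altdef)
      have "pconst r * g \<in> Q" using G(1)[OF Y\<Y>] Q.multl unfolding g_def by blast
      then have "hom_eval e' 1 (\<psi> H) \<in> Q" unfolding \<psi>H hom_eval_linear by simp
      moreover have "degree (\<psi> H) \<le> 1" unfolding \<psi>H by simp
      ultimately have "H \<in> K" unfolding K_def using Q.eval_inverse_kernel_iff[OF e0(3)] by blast
      then have HP: "H \<in> P" using KJ P(2) by blast
      obtain ys where ys: "set ys = Y'" "distinct ys"
        using finite_distinct_list[of Y'] Y'(1) finB finite_subset by blast
      have AT: "A k \<in> polys_in T" if "k \<in> N" for k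
        using that tE unfolding A_def N_def T_def by (auto simp: the_inv_into_f_f[OF inj] intro!: pvar_in_polys)
      have keysN: "keys k \<subseteq> Y'" if k: "k \<in> N" for k
      proof -
        from k obtain m where m: "m \<in> keys g" "k = rename_mon Inl m" unfolding N_def by blast
        have "keys k \<subseteq> (\<Union>v\<in>keys m. keys (single (Inl v) (lookup m v)))"
          unfolding m(2) rename_mon_def by (rule keys_sum)
        then show ?thesis using keysY[OF m(1)] Y(2) by (auto split: if_splits)
      qed
      have "H \<in> polys_in (T \<union> B)"
      proof -
        interpret TB: subring_set "polys_in (T \<union> B) :: ('i + 'a, 'a) mpol set" by (rule subring_polys_in)
        have "mon_eval pvar k \<in> polys_in (T \<union> B)" if "k \<in> N" for k
          using keysN[OF that] Y'(1) unfolding mon_eval_pvar by (auto simp: polys_in_def)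
        then show ?thesis
          unfolding H_def using AT polys_in_mono[of T "T \<union> B"] by (intro TB.sum_mem TB.mult_mem) auto
      qed
      \<comment> \<open>The elements of \<open>Y'\<close> are transcendental over \<open>T\<close>
        and the rest of \<open>B\<close>, so the coefficients of \<open>H\<close>, which lie in
        \<open>polys_in T\<close>, would all be in \<open>P\<close>. One of them stands for
        \<open>e0/e0\<close> and is congruent to 1.\<close>
      then have "H \<in> gen_vars ys P"
      proof (rule P.mem_gen_vars_if_not_alg[OF _ _ HP, rotated 2])
        show "set ys \<subseteq> T \<union> B" using ys(1) Y'(1) by blast
        fix y assume "y \<in> set ys"
        then have "y \<in> B" "y \<notin> T" using ys(1) Y'(1) Y(2) by (auto simp: T_def)
        then have "T \<union> B - {y} = T \<union> (B - {y})" by blast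
        then show "\<not> alg_over P (T \<union> B - {y}) (pvar y)" using notalg[OF \<open>y \<in> B\<close>] by simp
      qed
      moreover have "rename_mon Inl m0 \<in> N" using m0 by (simp add: N_def)
      ultimately have "A (rename_mon Inl m0) \<in> P"
        unfolding H_def
        by (intro gen_vars_sum_imp_coeff[OF P(1), of N ys T A])
          (use keysN AT ys Y(2) in \<open>auto simp: N_def T_def\<close>)
      then have "pvar (Inr e0) \<in> P" unfolding A_def by (simp add: the_inv_into_f_f[OF inj m0(1)] t0)
      moreover have "pvar (Inr e0) - 1 \<in> P"
      proof -
        have eq: "\<psi> (pvar (Inr e0) - 1) = [:-1, e':]"
          by (simp add: \<psi>.map_diff \<psi>.map_one \<psi>s(3)[OF e0(1)] e0(2) one_pCons)
        have "hom_eval e' 1 (\<psi> (pvar (Inr e0) - 1)) \<in> Q" unfolding eq hom_eval_linear using Q.zero by simp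
        moreover have "degree (\<psi> (pvar (Inr e0) - 1)) \<le> 1" unfolding eq by simp
        ultimately have "pvar (Inr e0) - 1 \<in> K" unfolding K_def using Q.eval_inverse_kernel_iff[OF e0(3)] by blast
        then show ?thesis using KJ P(2) by blast
      qed
      ultimately show False using P.diff_cong P.one by blast
    qed
    then show ?thesis using B(3) by simp
  qed
  finally have hT: "h \<le> rank P T" using h by (simp add: b_def)

  obtain B where B: "B \<subseteq> T" "card B = rank P T" "P.independent B" "\<forall>v\<in>T. alg_over P B (pvar v)"
    by (rule P.ex_basis[OF finTW(1)])
  obtain B' where B': "B' \<subseteq> B" "card B' = h" "finite B'"
    using obtain_subset_with_card_n[of h B] hT B(2) by metis
  have indB': "P.independent B'"
    using B(3) polys_in_mono[OF B'(1)] unfolding P.independent_def by blast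
  obtain \<beta> where \<beta>: "bij_betw \<beta> {..<h} B'"
    using ex_bij_betw_nat_finite[OF B'(3)] B'(2) by (auto simp: atLeast0LessThan)
  \<comment> \<open>The relations modulo \<open>Q\<close> between \<open>h\<close> fractions that
    are independent modulo \<open>P\<close>.\<close>
  define Q1 where "Q1 = (rename \<beta> -` K :: (nat, 'a) mpol set)"
  have primeQ1: "prime_id Q1" unfolding Q1_def by (rule ring_map.prime_vimage[OF ring_map_rename primeK])
  have constK: "pconst c \<in> K \<longleftrightarrow> pconst c \<in> Q" for c
    unfolding K_def vimage_eq \<psi>s using Q.eval_inverse_kernel_iff[OF e0(3), of "[:pconst c:]" 0]
    by (simp add: hom_eval_const)
  show ?thesis
    unfolding gain_def
  proof (intro exI conjI allI ballI impI)
    show "prime_id Q1" by (rule primeQ1)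
    show Q1c: "pconst c \<in> Q1 \<longleftrightarrow> c \<in> pconst -` Q" for c
      by (simp add: Q1_def rename_pconst constK)
    show "lookup F m \<in> pconst -` Q'" if F: "F \<in> Q1 \<inter> polys_in {..<h}" for F m
    proof (cases "lookup F m = 0")
      case True
      then show ?thesis using Q'.zero by (simp add: pconst_def)
    next
      case False
      have "rename \<beta> F \<in> P" using F KJ P(2) by (auto simp: Q1_def)
      moreover have "rename \<beta> F \<in> polys_in B'" using rename_in[of F "{..<h}" \<beta>] F \<beta> by (simp add: bij_betw_def)
      ultimately have "pconst (lookup (rename \<beta> F) (rename_mon \<beta> m)) \<in> P"
        by (rule P.independentD[OF indB'])
      moreover have "keys m \<subseteq> {..<h}" using polys_in_lookupD[OF _ False] F by blast
      then have "lookup (rename \<beta> F) (rename_mon \<beta> m) = lookup F m"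
        using F \<beta> by (intro lookup_rename_rename_mon[of \<beta> "{..<h}"]) (auto simp: bij_betw_def)
      ultimately show ?thesis using Pc by simp
    qed
    fix j assume j: "j < h"
    then have "\<beta> j \<in> T" using \<beta> B'(1) B(1) by (auto simp: bij_betw_def)
    then obtain e where e: "e \<in> E" "\<beta> j = Inr e" by (auto simp: T_def)
    interpret \<rho>: ring_map "rename \<beta> :: (nat, 'a) mpol \<Rightarrow> ('i + 'a, 'a) mpol" by (rule ring_map_rename)
    \<comment> \<open>The equation of the fraction \<open>e/e0\<close>; its leading coefficient
      \<open>e0\<close> is outside \<open>Q\<close>.\<close>
    let ?g = "[:- pconst e, pconst e0:] :: (nat, 'a) mpol poly"
    have eq: "\<psi> (rename \<beta> (poly ?g (pvar j))) = [:- pconst e, pconst e0 * pconst e:]"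
      by (simp add: \<rho>.map_add \<rho>.map_mult \<rho>.map_diff rename_pconst rename_pvar e \<psi>.map_add \<psi>.map_mult
          \<psi>.map_diff \<psi>s mult.commute)
    have "hom_eval e' 1 (\<psi> (rename \<beta> (poly ?g (pvar j)))) \<in> Q"
      unfolding eq hom_eval_linear using Q.zero by (simp add: e0(2) mult.commute)
    moreover have "degree (\<psi> (rename \<beta> (poly ?g (pvar j)))) \<le> 1" unfolding eq by simp
    ultimately have "poly ?g (pvar j) \<in> Q1"
      unfolding Q1_def K_def using Q.eval_inverse_kernel_iff[OF e0(3)] by blast
    moreover have "?g \<in> coeffs_in (polys_in {})"
      by (auto simp: coeffs_in_def coeff_pCons pconst_in_polys polys_in_0 polys_in_uminus split: nat.splits)
    moreover have "?g \<notin> coeffs_in Q1"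
      using EQ[OF e0(1)] Q1c[of e0] by (auto simp: coeffs_in_def intro!: exI[of _ 1])
    ultimately show "alg_over Q1 {} (pvar j)" unfolding algebraic_mod_def by blast
  qed
qed

section \<open>Dimension of polynomial rings\<close>

text \<open>The ideal generated by \<open>p\<close> and all indeterminates. Making the first
  \<open>n\<close> of them generic turns its trace on \<open>polys_in {..<n}\<close> into the
  extension of \<open>p\<close>.\<close>

definition augment :: "'a::comm_ring_1 set \<Rightarrow> ('i, 'a) mpol set"
  where "augment p = peval (\<lambda>c. c) (\<lambda>_. 0) -` p"

lemma prime_augment: "prime_id p \<Longrightarrow> prime_id (augment p)"
  unfolding augment_def by (rule ring_map.prime_vimage[OF ring_map_peval[OF ring_map_id]])

lemma pconst_augment: "pconst c \<in> augment p \<longleftrightarrow> c \<in> p"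
  by (simp add: augment_def peval_pconst ring_map_id)

lemma pvar_augment: "prime_id p \<Longrightarrow> pvar v \<in> augment p"
  by (simp add: augment_def peval_pvar ring_map_id prime_id.zero)

lemma gen_vars_append: "gen_vars (vs @ ws) Q = gen_vars vs (gen_vars ws Q)"
  by (simp add: gen_vars_def)

lemma gen_vars_lookup:
  assumes "P 0" and W: "\<And>F m. F \<in> Q \<Longrightarrow> F \<in> polys_in W \<Longrightarrow> P (lookup F m)"
    and "F \<in> gen_vars vs Q" "F \<in> polys_in (set vs \<union> W)"
  shows "P (lookup F m)"
  using assms(3,4)
proof (induction vs arbitrary: F m)
  case Nil
  then show ?case using W by (simp add: gen_vars_simps)
next
  case (Cons v vs)
  have "to_poly v F \<in> coeffs_in (polys_in (set vs \<union> W))"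
    using Cons.prems(2) by (intro to_poly_in) simp
  then have "P (lookup (coeff (to_poly v F) i) k)" for i k
    using Cons.prems(1) by (intro Cons.IH) (auto simp: coeffs_in_def gen_vars_simps gen_var_def)
  then show ?case using lookup_to_poly_iff[of P v F] assms(1) by blast
qed

lemma gain_antimono:
  assumes "gain q p h" "h' \<le> h"
  shows "gain q p h'"
proof -
  from assms(1) obtain Q :: "(nat, 'a) mpol set" where "prime_id Q" "\<forall>c. pconst c \<in> Q \<longleftrightarrow> c \<in> q"
    "\<forall>F\<in>Q \<inter> polys_in {..<h}. \<forall>m. lookup F m \<in> p" "\<forall>j<h. alg_over Q {} (pvar j)"
    unfolding gain_def by blast
  moreover have "polys_in {..<h'} \<subseteq> (polys_in {..<h} :: (nat, 'a) mpol set)"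
    using assms(2) by (intro polys_in_mono) auto
  ultimately show ?thesis
    unfolding gain_def using assms(2) by (intro exI[of _ Q]) auto
qed

lemma gain_0:
  assumes "prime_id q" "q \<subseteq> p"
  shows "gain q p 0"
  unfolding gain_def
proof (intro exI conjI ballI allI impI)
  show "prime_id (augment q)" by (rule prime_augment[OF assms(1)])
  show "pconst c \<in> augment q \<longleftrightarrow> c \<in> q" for c by (rule pconst_augment)
  fix F :: "(nat, 'a) mpol" and m assume F: "F \<in> augment q \<inter> polys_in {..<0}"
  interpret mpol_prime "augment q :: (nat, 'a) mpol set" using prime_augment[OF assms(1)] by (rule mpol_primeI)
  have "independent {}" using independent_iff_rank[of "{}"] rank_empty by simp
  then have "pconst (lookup F m) \<in> (augment q :: (nat, 'a) mpol set)" using F by (intro independentD) auto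
  then show "lookup F m \<in> p" using assms(2) by (auto simp: pconst_augment)
qed simp

text \<open>There is a chain of length \<open>k\<close> of primes in \<open>R[x\<^sub>1,\<dots>,x\<^sub>n]\<close> below the extension of \<open>p\<close>.\<close>

definition height_ge :: "nat \<Rightarrow> 'a::comm_ring_1 set \<Rightarrow> nat \<Rightarrow> bool"
  where "height_ge n p k \<longleftrightarrow> (\<exists>P. prime_chain {..<n} k P (gen_vars [0..<n] (augment p)))"

lemma height_ge_0: "prime_id p \<Longrightarrow> height_ge n p 0"
  unfolding height_ge_def using prime_gen_vars[OF prime_augment] by (blast intro: prime_chain.base)

lemma gen_vars_augment_iff:
  "prime_id p \<Longrightarrow> F \<in> polys_in {..<n} \<Longrightarrow>
    F \<in> gen_vars [0..<n] (augment p) \<longleftrightarrow> (\<forall>m. lookup F m \<in> p)"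
  using gen_vars_iff[OF prime_augment, of p F "[0..<n]"] by (simp add: pconst_augment atLeast0LessThan)

text \<open>Above the extension of \<open>q\<close>, the first \<open>h\<close> indeterminates are
  specialised one by one to the algebraic elements of the gain, in \<open>h\<close> steps, while the
  others stay generic. By the definition of \<open>gain\<close> the resulting \<open>Q1\<close> is
  still contained in the extension of \<open>p\<close> on \<open>polys_in {..<n}\<close>; an element
  of \<open>p\<close> outside \<open>q\<close> makes the last step strict.\<close>

lemma height_ge_step:
  assumes H: "height_ge n q k" and g: "gain q p h" and h: "h \<le> n"
    and p: "prime_id p" and q: "prime_id q" and qp: "q \<subset> p"
  shows "height_ge n p (k + Suc h)"
proof -
  from g obtain Q :: "(nat, 'a) mpol set" where Q: "prime_id Q" "\<And>c. pconst c \<in> Q \<longleftrightarrow> c \<in> q"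
    "\<And>F m. F \<in> Q \<Longrightarrow> F \<in> polys_in {..<h} \<Longrightarrow> lookup F m \<in> p"
    "\<And>j. j < h \<Longrightarrow> alg_over Q {} (pvar j)"
    unfolding gain_def by blast
  define Q1 where "Q1 = gen_vars [h..<n] Q"
  define Q2 where "Q2 = gen_vars [0..<h] Q1"
  have Q1: "prime_id Q1" unfolding Q1_def by (rule prime_gen_vars[OF Q(1)])
  have Q2: "prime_id Q2" unfolding Q2_def by (rule prime_gen_vars[OF Q1])
  have "Q2 = gen_vars [0..<n] Q"
    unfolding Q2_def Q1_def gen_vars_append[symmetric] using upt_add_eq_append[of 0 h "n - h"] h by simp
  then have Q2_iff: "F \<in> Q2 \<longleftrightarrow> (\<forall>m. lookup F m \<in> q)" if "F \<in> polys_in {..<n}" for F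
    using gen_vars_iff[OF Q(1), of F "[0..<n]"] that Q(2) by (simp add: atLeast0LessThan)
  from H obtain P where P: "prime_chain {..<n} k P (gen_vars [0..<n] (augment q))"
    unfolding height_ge_def by blast
  have "prime_chain {..<n} k P Q2"
    by (rule prime_chain_weaken[OF P Q2]) (auto simp: Q2_iff gen_vars_augment_iff[OF q])
  moreover have "prime_chain {..<n} (length [0..<h]) (gen_vars [0..<h] Q1) Q1"
  proof (rule prime_chain_gen_vars[OF Q1, where B = "{}"])
    fix v assume "v \<in> set [0..<h]"
    then have v: "v < h" by simp
    then obtain g where g: "g \<in> coeffs_in (polys_in {})" "g \<notin> coeffs_in Q" "poly g (pvar v) \<in> Q"
      using Q(4) unfolding algebraic_mod_def by blast
    have "poly g (pvar v) \<in> polys_in {v}"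
      using g(1) polys_in_mono[of "{}" "{v}"] by (intro poly_in_polys) (auto simp: coeffs_in_def)
    then have "poly g (pvar v) \<in> Q1"
      unfolding Q1_def using gen_vars_notin[OF Q(1), of "poly g (pvar v)" "{v}" "[h..<n]"] g(3) v by simp
    moreover have "g \<notin> coeffs_in Q1" using g(2) gen_vars_subset[OF Q(1)] unfolding Q1_def coeffs_in_def by blast
    ultimately show "alg_over Q1 {} (pvar v)" unfolding algebraic_mod_def using g(1) by blast
  qed (use h in auto)
  then have "prime_chain {..<n} h Q2 Q1" unfolding Q2_def by simp
  ultimately have chain: "prime_chain {..<n} (k + h) P Q1" by (rule prime_chain_trans[rotated])
  have "{..<n} = set [h..<n] \<union> {..<h}" using h by auto
  then have sub: "lookup F m \<in> p" if "F \<in> Q1" "F \<in> polys_in {..<n}" for F m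
    using gen_vars_lookup[of "\<lambda>c. c \<in> p" Q "{..<h}" F "[h..<n]" m] that Q(3) prime_id.zero[OF p]
    unfolding Q1_def by simp
  obtain c where c: "c \<in> p" "c \<notin> q" using qp by blast
  have "pconst c \<notin> Q1" using c(2) pconst_gen_vars[OF Q(1)] Q(2) unfolding Q1_def by blast
  moreover have "pconst c \<in> gen_vars [0..<n] (augment p)"
    using c(1) pconst_gen_vars[OF prime_augment[OF p]] pconst_augment by blast
  moreover have "pconst c \<in> polys_in {..<n}" by (rule pconst_in_polys)
  ultimately have "Q1 \<inter> polys_in {..<n} \<subset> gen_vars [0..<n] (augment p) \<inter> polys_in {..<n}"
    using sub gen_vars_augment_iff[OF p] by blast
  with chain have "prime_chain {..<n} (Suc (k + h)) P (gen_vars [0..<n] (augment p))"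
    by (rule prime_chain.step[OF _ prime_gen_vars[OF prime_augment[OF p]]])
  then show ?thesis unfolding height_ge_def by auto
qed

text \<open>The \<open>n\<close> additional steps lead from the extension of \<open>p\<close> to
  \<open>augment p\<close>, where each indeterminate satisfies the relation of being 0.\<close>

lemma chain_length_if_height_ge:
  fixes p :: "'a::comm_ring_1 set"
  assumes "height_ge n p k" and p: "prime_id p"
  shows "chain_length_in {..<n} TYPE('a) (k + n)"
proof -
  from assms(1) obtain P where P: "prime_chain {..<n} k P (gen_vars [0..<n] (augment p))"
    unfolding height_ge_def by blast
  have "prime_chain {..<n} (length [0..<n]) (gen_vars [0..<n] (augment p)) (augment p)"
  proof (rule prime_chain_gen_vars[OF prime_augment[OF p], where B = "{}"])
    fix v :: nat
    have "poly [:0, 1:] (pvar v) \<in> augment p" using pvar_augment[OF p] by simp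
    moreover have "[:0, 1:] \<in> coeffs_in (polys_in {} :: (nat, 'a) mpol set)"
      by (auto simp: coeffs_in_def coeff_pCons polys_in_0 polys_in_1 split: nat.splits)
    moreover have "[:0, 1:] \<notin> coeffs_in (augment p :: (nat, 'a) mpol set)"
      using prime_id.one[OF prime_augment[OF p]] by (auto simp: coeffs_in_def intro!: exI[of _ 1])
    ultimately show "alg_over (augment p) {} (pvar v)" unfolding algebraic_mod_def by blast
  qed auto
  then have "prime_chain {..<n} n (gen_vars [0..<n] (augment p)) (augment p)" by simp
  from chain_length_in_if_prime_chain[OF prime_chain_trans[OF this P]] show ?thesis .
qed

section \<open>Chains of primes with gains, and the dimension of polynomial rings\<close>

inductive gain_chain :: "'a::comm_ring_1 set \<Rightarrow> nat list \<Rightarrow> bool" where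
  base: "prime_id p \<Longrightarrow> gain_chain p []"
| step: "gain_chain q hs \<Longrightarrow> prime_id p \<Longrightarrow> q \<subset> p \<Longrightarrow> gain q p h \<Longrightarrow> gain_chain p (h # hs)"

text \<open>A gain \<open>h\<close> counts \<open>h + 1\<close>: its \<open>h\<close> steps over the
  smaller prime and the step to the larger one, as in \<open>height_ge_step\<close>.\<close>

definition weight :: "nat list \<Rightarrow> nat"
  where "weight hs = sum_list (map Suc hs)"

lemma weight_simps: "weight [] = 0" "weight (h # hs) = Suc h + weight hs"
  by (simp_all add: weight_def)

lemma gain_chain_prime: "gain_chain p hs \<Longrightarrow> prime_id p"
  by (induction rule: gain_chain.induct)

lemma gain_chain_cap: "gain_chain p hs \<Longrightarrow> gain_chain p (map (min n) hs)"
proof (induction rule: gain_chain.induct)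
  case (step q hs p h)
  then show ?case using gain_antimono[OF step.hyps(4), of "min n h"] by (auto intro: gain_chain.step)
qed (simp add: gain_chain.base)

lemma height_ge_weight: "gain_chain p hs \<Longrightarrow> \<forall>h\<in>set hs. h \<le> n \<Longrightarrow> height_ge n p (weight hs)"
proof (induction rule: gain_chain.induct)
  case (step q hs p h)
  have "height_ge n p (weight hs + Suc h)"
    by (rule height_ge_step[OF _ step.hyps(4) _ step.hyps(2) gain_chain_prime[OF step.hyps(1)] step.hyps(3)])
      (use step in auto)
  then show ?case by (simp add: weight_simps add.commute)
qed (simp add: height_ge_0 weight_simps)

lemma chain_length_weight:
  fixes p :: "'a::comm_ring_1 set"
  assumes "gain_chain p hs" "\<forall>h\<in>set hs. h \<le> n"
  shows "chain_length_in {..<n} TYPE('a) (weight hs + n)"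
  using chain_length_if_height_ge[OF height_ge_weight[OF assms] gain_chain_prime[OF assms(1)]] .

text \<open>Along the chain, \<open>j + rank (c j)\<close> never exceeds \<open>n\<close> plus the
  weight collected so far. A step with unchanged contraction lowers the rank; any other step raises
  it by at most its gain \<open>h\<close>, and the weight \<open>h + 1\<close> pays for
  both.\<close>

lemma ex_gain_chain_ge:
  assumes "chain_length_in {..<n} TYPE('a::comm_ring_1) k"
  obtains p :: "'a::comm_ring_1 set" and hs where "gain_chain p hs" "\<forall>h\<in>set hs. h \<le> n" "k \<le> weight hs + n"
proof -
  let ?V = "{..<n}"
  from assms obtain c0 :: "nat \<Rightarrow> (nat, 'a) mpol set" where
    c0: "\<And>i. i \<le> k \<Longrightarrow> prime_id (c0 i)" "\<And>i. i < k \<Longrightarrow> c0 i \<inter> polys_in ?V \<subset> c0 (Suc i) \<inter> polys_in ?V"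
    unfolding chain_length_in_def by blast
  define c where "c i = extend_prime ?V (c0 i)" for i
  have c_prime: "prime_id (c i)" if "i \<le> k" for i
    unfolding c_def extend_prime_def by (rule ring_map.prime_vimage[OF ring_map_retract c0(1)[OF that]])
  have c_sub: "c i \<subseteq> c (Suc i)" if "i < k" for i
    using c0(2)[OF that] retract_in[of ?V] unfolding c_def extend_prime_def by blast
  have c_strict: "\<exists>F. F \<in> c (Suc i) \<and> F \<notin> c i \<and> F \<in> polys_in ?V" if "i < k" for i
    using c0(2)[OF that] extend_prime_iff[of _ ?V] unfolding c_def by blast
  have "\<exists>hs. gain_chain (pconst -` c j) hs \<and> (\<forall>h\<in>set hs. h \<le> n) \<and> j + rank (c j) ?V \<le> n + weight hs" if "j \<le> k" for j
    using that
  proof (induction j)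
    case 0
    interpret mpol_prime "c 0" using c_prime[OF 0] by (rule mpol_primeI)
    have "gain_chain (pconst -` c 0) []" by (intro gain_chain.base prime_pconst_vimage prime_id_axioms)
    then show ?case using rank_le_card[of ?V] by (intro exI[of _ "[]"]) (simp add: weight_simps)
  next
    case (Suc j)
    then obtain hs where hs: "gain_chain (pconst -` c j) hs" "\<forall>h\<in>set hs. h \<le> n"
      "j + rank (c j) ?V \<le> n + weight hs" by auto
    have j: "j < k" "j \<le> k" using Suc.prems by auto
    interpret Q: mpol_prime "c j" using c_prime[OF j(2)] by (rule mpol_primeI)
    interpret Q': mpol_prime "c (Suc j)" using c_prime[OF Suc.prems] by (rule mpol_primeI)
    show ?case
    proof (cases "same_contraction (c j) (c (Suc j))")
      case True
      obtain F where F: "F \<in> c (Suc j)" "F \<notin> c j" "F \<in> polys_in ?V" using c_strict[OF j(1)] by blast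
      have "rank (c (Suc j)) ?V < rank (c j) ?V"
        by (rule rank_strict_antimono[OF Q.mpol_prime_axioms Q'.mpol_prime_axioms True _ _ F])
          (use c_sub[OF j(1)] in auto)
      moreover have "pconst -` c (Suc j) = pconst -` c j"
        using True by (auto simp: same_contraction_def)
      ultimately show ?thesis using hs by auto
    next
      case False
      \<comment> \<open>Truncated subtraction: when the rank drops, the gain is 0.\<close>
      define h where "h = rank (c (Suc j)) ?V - rank (c j) ?V"
      have sub: "pconst -` c j \<subset> pconst -` c (Suc j)"
        using False c_sub[OF j(1)] unfolding same_contraction_def by blast
      have "gain (pconst -` c j) (pconst -` c (Suc j)) h"
      proof (cases "rank (c j) ?V \<le> rank (c (Suc j)) ?V")
        case True
        then show ?thesis
          by (intro gain_if_rank[OF Q.prime_id_axioms Q'.prime_id_axioms c_sub[OF j(1)], of ?V]) (auto simp: h_def)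
      next
        case False
        then show ?thesis
          using gain_0[OF prime_pconst_vimage[OF Q.prime_id_axioms], of "pconst -` c (Suc j)"] sub by (simp add: h_def)
      qed
      then have "gain_chain (pconst -` c (Suc j)) (h # hs)"
        using hs(1) sub by (intro gain_chain.step prime_pconst_vimage Q'.prime_id_axioms)
      moreover have "h \<le> n" using Q'.rank_le_card[of ?V] by (simp add: h_def)
      moreover have "Suc j + rank (c (Suc j)) ?V \<le> n + weight (h # hs)"
        using hs(3) by (simp add: weight_simps h_def)
      ultimately show ?thesis using hs(2) by (intro exI[of _ "h # hs"]) simp
    qed
  qed
  from this[of k] obtain hs where "gain_chain (pconst -` c k) hs" "\<forall>h\<in>set hs. h \<le> n" "k + rank (c k) ?V \<le> n + weight hs"
    by blast
  then show thesis using that by simp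
qed

lemma length_gain_chain:
  fixes p :: "'a::comm_ring_1 set"
  assumes "gain_chain p hs"
  shows "enat (length hs) \<le> krull_dim (ring_of_type_algebra :: 'a ring)"
proof -
  have "\<exists>c :: nat \<Rightarrow> 'a set. (\<forall>i\<le>length hs. prime_id (c i)) \<and> (\<forall>i<length hs. c i \<subset> c (Suc i)) \<and> c (length hs) = p"
    using assms
  proof (induction rule: gain_chain.induct)
    case (base p)
    then show ?case by (auto intro!: exI[of _ "\<lambda>_. p"])
  next
    case (step q hs p h)
    then obtain c where "\<forall>i\<le>length hs. prime_id (c i)" "\<forall>i<length hs. c i \<subset> c (Suc i)" "c (length hs) = q" by blast
    then show ?case using step.hyps
      by (intro exI[of _ "c(Suc (length hs) := p)"]) (auto simp: le_Suc_eq less_Suc_eq)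
  qed
  then show ?thesis
    unfolding krull_dim_def primeideal_type_iff by (intro SUP_upper) blast
qed

lemma weight_filter: "weight hs = weight (filter (\<lambda>h. h < t) hs) + weight (filter (\<lambda>h. t \<le> h) hs)"
  by (induction hs) (auto simp: weight_simps)

lemma weight_le: "\<forall>h\<in>set hs. h \<le> n \<Longrightarrow> weight hs \<le> length hs * Suc n"
  by (induction hs) (auto simp: weight_simps)

text \<open>
  For \<open>n \<rightarrow> \<infinity>\<close> the maximum of \<open>weight\<close> over the lists bounded by \<open>n\<close> is reached by lists with the
  largest possible number \<open>e\<close> of arbitrarily large entries, whose other entries stay bounded.
\<close>

lemma eventually_linear_max_weight:
  fixes \<S> :: "nat list set"
  assumes ne: "\<S> \<noteq> {}" and len: "\<And>hs. hs \<in> \<S> \<Longrightarrow> length hs \<le> l"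
    and cap: "\<And>hs n. hs \<in> \<S> \<Longrightarrow> map (min n) hs \<in> \<S>"
    and unbounded: "\<And>t. \<exists>hs\<in>\<S>. \<exists>h\<in>set hs. t \<le> h"
  obtains e w where "e \<ge> 1"
    "eventually (\<lambda>n. (\<exists>hs\<in>\<S>. (\<forall>h\<in>set hs. h \<le> n) \<and> weight hs = e * Suc n + w) \<and>
      (\<forall>hs\<in>\<S>. (\<forall>h\<in>set hs. h \<le> n) \<longrightarrow> weight hs \<le> e * Suc n + w)) sequentially"
proof -
  define N where "N t hs = length (filter (\<lambda>h. t \<le> h) hs)" for t :: nat and hs
  define s where "s t hs = weight (filter (\<lambda>h. h < t) hs)" for t hs
  have N_antimono: "N t' hs \<le> N t hs" if "t \<le> t'" for t t' hs
    unfolding N_def using that by (induction hs) auto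
  have N_len: "N t hs \<le> length hs" for t hs by (simp add: N_def)
  define good where "good e \<longleftrightarrow> (\<forall>t. \<exists>hs\<in>\<S>. e \<le> N t hs)" for e
  have "\<exists>hs\<in>\<S>. 1 \<le> N t hs" for t
  proof -
    from unbounded[of t] obtain hs h where "hs \<in> \<S>" "h \<in> set hs" "t \<le> h" by blast
    then have "filter (\<lambda>h. t \<le> h) hs \<noteq> []" by (auto simp: filter_empty_conv)
    then show ?thesis using \<open>hs \<in> \<S>\<close> unfolding N_def by (metis One_nat_def Suc_leI length_greater_0_conv)
  qed
  then have good1: "good 1" by (simp add: good_def)
  have good_le: "e \<le> l" if "good e" for e
    using that len N_len unfolding good_def by (meson order_trans)
  define e where "e = (GREATEST e. good e)"
  have e: "good e" "1 \<le> e" and e_max: "\<And>e'. good e' \<Longrightarrow> e' \<le> e"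
    unfolding e_def using GreatestI_nat[of good 1 l] Greatest_le_nat[of good _ l] good1 good_le by auto
  have "\<not> good (Suc e)" using e_max[of "Suc e"] by auto
  then obtain t0 where t0: "\<And>hs. hs \<in> \<S> \<Longrightarrow> N t0 hs \<le> e" unfolding good_def by (metis not_less_eq_eq)
  define bound where "bound = l * Suc t0"
  have s_le: "s t0 hs \<le> bound" if "hs \<in> \<S>" for hs
  proof -
    have "s t0 hs \<le> length (filter (\<lambda>h. h < t0) hs) * Suc t0" unfolding s_def by (rule weight_le) auto
    also have "\<dots> \<le> bound"
      unfolding bound_def by (intro mult_right_mono order_trans[OF length_filter_le len[OF that]]) simp
    finally show ?thesis .
  qed
  \<comment> \<open>The weights of the small entries that occur next to \<open>e\<close> arbitrarily
    large ones; their maximum is the constant term \<open>w\<close>. Every other value up to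
    \<open>bound\<close> is excluded beyond some threshold, and \<open>t1\<close> exceeds all these
    thresholds.\<close>
  define W where "W = {w. \<forall>t. \<exists>hs\<in>\<S>. e \<le> N t hs \<and> s t0 hs = w}"
  have WB: "W \<subseteq> {..bound}" unfolding W_def using s_le by force
  have "\<exists>t. \<forall>hs\<in>\<S>. e \<le> N t hs \<longrightarrow> s t0 hs \<noteq> w" if "w \<notin> W" for w
    using that unfolding W_def by blast
  then obtain tw where tw: "\<And>w hs. w \<notin> W \<Longrightarrow> hs \<in> \<S> \<Longrightarrow> e \<le> N (tw w) hs \<Longrightarrow> s t0 hs \<noteq> w" by metis
  define t1 where "t1 = Max (insert t0 (tw ` {..bound}))"
  have t1: "t0 \<le> t1" "\<And>w. w \<le> bound \<Longrightarrow> tw w \<le> t1" unfolding t1_def by (intro Max_ge; simp)+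
  have inW: "s t0 hs \<in> W" if "hs \<in> \<S>" "e \<le> N t1 hs" for hs
  proof (rule ccontr)
    assume "s t0 hs \<notin> W"
    moreover have "e \<le> N (tw (s t0 hs)) hs"
      using that(2) N_antimono[OF t1(2)[OF s_le[OF that(1)]], of hs] by simp
    ultimately show False using tw that(1) by blast
  qed
  obtain hs1 where "hs1 \<in> \<S>" "e \<le> N t1 hs1" using e(1) unfolding good_def by blast
  then have Wne: "W \<noteq> {}" using inW by blast
  define w where "w = Max W"
  have finW: "finite W" using WB finite_subset by blast
  have wW: "w \<in> W" and w_max: "\<And>x. x \<in> W \<Longrightarrow> x \<le> w"
    unfolding w_def using finW Wne by auto
  \<comment> \<open>The bound on \<open>n\<close> disposes of lists with fewer than \<open>e\<close>
    entries from \<open>t1\<close> on: their small entries weigh at most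
    \<open>l * Suc t1 \<le> n\<close>, less than the \<open>Suc n\<close> of the missing large
    entry.\<close>
  have "(\<exists>hs\<in>\<S>. (\<forall>h\<in>set hs. h \<le> n) \<and> weight hs = e * Suc n + w) \<and>
      (\<forall>hs\<in>\<S>. (\<forall>h\<in>set hs. h \<le> n) \<longrightarrow> weight hs \<le> e * Suc n + w)" if n: "n \<ge> l * Suc t1 + t1" for n
  proof (intro conjI ballI impI)
    have nt: "t0 \<le> n" using n t1(1) by simp
    from wW obtain hs where hs: "hs \<in> \<S>" "e \<le> N n hs" "s t0 hs = w" unfolding W_def by blast
    have Ne: "N n hs = e" "N t0 hs = e" using hs(2) t0[OF hs(1)] N_antimono[OF nt, of hs] by auto
    \<comment> \<open>There are exactly \<open>e\<close> entries from \<open>t0\<close> on and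
      exactly \<open>e\<close> from \<open>n\<close> on, so none lies between; capping at
      \<open>n\<close> makes all of them equal to \<open>n\<close>.\<close>
    have eqf: "filter (\<lambda>h. t0 \<le> h) hs = filter (\<lambda>h. n \<le> h) hs"
    proof -
      have "filter (\<lambda>h. n \<le> h) (filter (\<lambda>h. t0 \<le> h) hs) = filter (\<lambda>h. n \<le> h) hs"
        using nt by (auto intro!: filter_cong)
      moreover have "filter (\<lambda>h. n \<le> h) (filter (\<lambda>h. t0 \<le> h) hs) = filter (\<lambda>h. t0 \<le> h) hs"
      proof (rule ccontr)
        assume "filter (\<lambda>h. n \<le> h) (filter (\<lambda>h. t0 \<le> h) hs) \<noteq> filter (\<lambda>h. t0 \<le> h) hs"
        then obtain h where "h \<in> set (filter (\<lambda>h. t0 \<le> h) hs)" "\<not> n \<le> h" unfolding filter_id_conv by blast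
        then have "length (filter (\<lambda>h. n \<le> h) (filter (\<lambda>h. t0 \<le> h) hs)) < length (filter (\<lambda>h. t0 \<le> h) hs)"
          by (rule length_filter_less)
        then show False using Ne calculation by (simp add: N_def del: filter_filter)
      qed
      ultimately show ?thesis by simp
    qed
    have "weight (map (min n) hs) = weight (map (min n) (filter (\<lambda>h. h < t0) hs)) + weight (map (min n) (filter (\<lambda>h. t0 \<le> h) hs))"
      by (induction hs) (auto simp: weight_simps)
    also have "map (min n) (filter (\<lambda>h. h < t0) hs) = filter (\<lambda>h. h < t0) hs"
      using nt by (auto intro!: map_idI)
    also have "map (min n) (filter (\<lambda>h. t0 \<le> h) hs) = replicate e n"
      unfolding eqf using Ne(1) by (auto simp: N_def intro!: replicate_eqI)
    also have "weight (replicate e n) = e * Suc n" by (simp add: weight_def sum_list_replicate)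
    finally have "weight (map (min n) hs) = e * Suc n + w" using hs(3) by (simp add: s_def)
    then show "\<exists>hs\<in>\<S>. (\<forall>h\<in>set hs. h \<le> n) \<and> weight hs = e * Suc n + w"
      using cap[OF hs(1), of n] by (intro bexI[of _ "map (min n) hs"]) auto
  next
    fix hs assume hs: "hs \<in> \<S>" "\<forall>h\<in>set hs. h \<le> n"
    show "weight hs \<le> e * Suc n + w"
    proof (cases "e \<le> N t1 hs")
      case True
      have "weight (filter (\<lambda>h. t0 \<le> h) hs) \<le> N t0 hs * Suc n"
        unfolding N_def by (rule weight_le) (use hs(2) in auto)
      also have "\<dots> \<le> e * Suc n" using t0[OF hs(1)] by (rule mult_right_mono) simp
      finally show ?thesis using weight_filter[of hs t0] w_max[OF inW[OF hs(1) True]] by (simp add: s_def)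
    next
      case False
      have "weight (filter (\<lambda>h. h < t1) hs) \<le> length (filter (\<lambda>h. h < t1) hs) * Suc t1" by (rule weight_le) auto
      also have "\<dots> \<le> l * Suc t1"
        by (intro mult_right_mono order_trans[OF length_filter_le len[OF hs(1)]]) simp
      also have "\<dots> \<le> n" using n by simp
      finally have 1: "weight (filter (\<lambda>h. h < t1) hs) \<le> n" .
      have "weight (filter (\<lambda>h. t1 \<le> h) hs) \<le> N t1 hs * Suc n"
        unfolding N_def by (rule weight_le) (use hs(2) in auto)
      also have "\<dots> \<le> (e - 1) * Suc n" using False by (intro mult_right_mono) auto
      finally have "weight hs \<le> Suc n + (e - 1) * Suc n" using weight_filter[of hs t1] 1 by simp
      also have "\<dots> = e * Suc n" using e(2) by (cases e) auto
      finally show ?thesis by simp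
    qed
  qed
  from eventually_sequentiallyI[OF this] show thesis by (rule that[OF e(2)])
qed

text \<open>The dimension in \<open>n\<close> indeterminates is the maximal weight plus
  \<open>n\<close>, eventually \<open>e * Suc n + w + n\<close>, with increment
  \<open>e + 1\<close>. Unbounded gains provide one-entry lists of any size, hence
  \<open>e \<ge> 1\<close>.\<close>

theorem eventual_dim_growth_gt_one:
  assumes fin: "krull_dim (ring_of_type_algebra :: 'a::comm_ring_1 ring) < \<infinity>"
    and unbounded: "\<And>h. \<exists>q p :: 'a set. prime_id q \<and> prime_id p \<and> q \<subset> p \<and> gain q p h"
  shows "eventual_dim_growth TYPE('a) > 1"
proof -
  define \<S> where "\<S> = {hs. \<exists>p :: 'a set. gain_chain p hs}"
  from fin obtain l where l: "krull_dim (ring_of_type_algebra :: 'a ring) = enat l" by auto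
  have mem: "\<exists>hs\<in>\<S>. \<exists>h\<in>set hs. t \<le> h" for t
  proof -
    from unbounded[of t] obtain q p :: "'a set" where "prime_id q" "prime_id p" "q \<subset> p" "gain q p t" by blast
    then have "gain_chain p [t]" by (intro gain_chain.intros)
    then show ?thesis unfolding \<S>_def by force
  qed
  obtain e w where e: "e \<ge> 1" and ev:
    "eventually (\<lambda>n. (\<exists>hs\<in>\<S>. (\<forall>h\<in>set hs. h \<le> n) \<and> weight hs = e * Suc n + w) \<and>
      (\<forall>hs\<in>\<S>. (\<forall>h\<in>set hs. h \<le> n) \<longrightarrow> weight hs \<le> e * Suc n + w)) sequentially"
  proof (rule eventually_linear_max_weight)
    show "\<S> \<noteq> {}" using mem by blast
    show "length hs \<le> l" if "hs \<in> \<S>" for hs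
    proof -
      from that obtain p :: "'a set" where "gain_chain p hs" unfolding \<S>_def by blast
      from length_gain_chain[OF this] show ?thesis unfolding l by simp
    qed
    show "map (min n) hs \<in> \<S>" if "hs \<in> \<S>" for hs n
      using that gain_chain_cap unfolding \<S>_def by blast
    show "\<exists>hs\<in>\<S>. \<exists>h\<in>set hs. t \<le> h" for t by (rule mem)
  qed
  have dim: "eventually (\<lambda>n. krull_dim (poly_ring {..<n} :: (nat, 'a) mpol ring) = enat (e * Suc n + w + n)) sequentially"
    using ev
  proof eventually_elim
    case (elim n)
    then obtain hs where hs: "hs \<in> \<S>" "\<forall>h\<in>set hs. h \<le> n" "weight hs = e * Suc n + w" by blast
    show ?case
      unfolding krull_dim_poly_ring
    proof (rule antisym)
      show "(SUP k\<in>{k. chain_length_in {..<n} TYPE('a) k}. enat k) \<le> enat (e * Suc n + w + n)"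
      proof (rule SUP_least)
        fix k assume "k \<in> {k. chain_length_in {..<n} TYPE('a) k}"
        then have "chain_length_in {..<n} TYPE('a) k" by simp
        then obtain p :: "'a set" and ks where "gain_chain p ks" "\<forall>h\<in>set ks. h \<le> n" "k \<le> weight ks + n"
          by (rule ex_gain_chain_ge)
        then show "enat k \<le> enat (e * Suc n + w + n)" using elim unfolding \<S>_def by fastforce
      qed
      show "enat (e * Suc n + w + n) \<le> (SUP k\<in>{k. chain_length_in {..<n} TYPE('a) k}. enat k)"
        using hs chain_length_weight[of _ hs n] unfolding \<S>_def by (intro SUP_upper) (auto simp: hs(3))
    qed
  qed
  then obtain n0 where n0: "\<And>n. n \<ge> n0 \<Longrightarrow>
      krull_dim (poly_ring {..<n} :: (nat, 'a) mpol ring) = enat (e * Suc n + w + n)"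
    unfolding eventually_sequentially by blast
  have growth: "eventually (\<lambda>n. dim_growth TYPE('a) n = enat (Suc e)) sequentially"
  proof (rule eventually_sequentiallyI[of "Suc n0"])
    fix n assume "Suc n0 \<le> n"
    then obtain m where m: "n = Suc m" "n0 \<le> m" by (cases n) auto
    show "dim_growth TYPE('a) n = enat (Suc e)"
      unfolding dim_growth_def m(1) using n0[of m] n0[of "Suc m"] m(2) by simp
  qed
  have "eventual_dim_growth TYPE('a) = enat (Suc e)"
    unfolding eventual_dim_growth_def
  proof (rule the_equality)
    show "eventually (\<lambda>n. dim_growth TYPE('a) n = enat (Suc e)) sequentially" by (rule growth)
    fix d assume "eventually (\<lambda>n. dim_growth TYPE('a) n = d) sequentially"
    with growth have "eventually (\<lambda>_. d = enat (Suc e)) sequentially" by eventually_elim simp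
    then show "d = enat (Suc e)" by simp
  qed
  then show ?thesis using e by (simp add: one_enat_def)
qed

section \<open>Differential primes\<close>

definition shift :: "nat \<times> nat \<Rightarrow> nat \<times> nat"
  where "shift v = (fst v, Suc (snd v))"

definition jets :: "nat \<Rightarrow> nat \<Rightarrow> (nat \<times> nat) set"
  where "jets n k = {..<n} \<times> {..<k}"

lemma finite_jets: "finite (jets n k)"
  by (simp add: jets_def)

lemma jets_mono: "k \<le> l \<Longrightarrow> jets n k \<subseteq> jets n l"
  by (auto simp: jets_def)

lemma jets_Suc: "jets n (Suc k) = jets n k \<union> {..<n} \<times> {k}"
  by (auto simp: jets_def)

lemma jets_exhaust:
  assumes "F \<in> polys_in ({..<n} \<times> UNIV)"
  obtains k where "F \<in> polys_in (jets n k)"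
proof -
  obtain V where V: "finite V" "F \<in> polys_in V" by (rule ex_finite_polys_in)
  define k where "k = Suc (Max (insert 0 (snd ` V)))"
  have "snd v < k" if "v \<in> V" for v
    using V(1) that unfolding k_def by (intro le_imp_less_Suc Max_ge) auto
  then have "F \<in> polys_in (jets n k)" using assms V(2) by (fastforce simp: polys_in_def jets_def)
  then show thesis by (rule that)
qed

text \<open>The library function \<open>pderiv\<close> is restricted to rings without zero divisors.\<close>

definition formal_deriv :: "'b::comm_ring_1 poly \<Rightarrow> 'b poly"
  where "formal_deriv g = (\<Sum>i<degree g. monom (of_nat (Suc i) * coeff g (Suc i)) i)"

lemma coeff_formal_deriv: "coeff (formal_deriv g) i = of_nat (Suc i) * coeff g (Suc i)"
  using coeff_eq_0[of g "Suc i"] by (simp add: formal_deriv_def coeff_sum not_less)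

lemma formal_deriv_pCons: "formal_deriv (pCons a g) = g + pCons 0 (formal_deriv g)"
  by (rule poly_eqI) (simp add: coeff_formal_deriv coeff_pCons algebra_simps split: nat.split)

lemma degree_formal_deriv_le: "degree (formal_deriv g) \<le> degree g - 1"
  by (rule degree_le) (auto simp: coeff_formal_deriv coeff_eq_0)

lemma (in subring_set) formal_deriv_in:
  assumes "g \<in> coeffs_in A"
  shows "formal_deriv g \<in> coeffs_in A"
  unfolding coeffs_in_def mem_Collect_eq coeff_formal_deriv
proof
  fix i
  have "of_nat k \<in> A" for k by (induction k) (auto simp: zero_mem one_mem add_mem)
  then show "of_nat (Suc i) * coeff g (Suc i) \<in> A"
    by (rule mult_mem) (use assms in \<open>simp add: coeffs_in_def\<close>)
qed

locale diff_ring =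
  fixes D :: "'a::comm_ring_1 \<Rightarrow> 'a"
  assumes D: "derivation D"
begin

abbreviation \<delta> :: "(nat \<times> nat, 'a) mpol \<Rightarrow> (nat \<times> nat, 'a) mpol"
  where "\<delta> \<equiv> diff_poly_deriv D"

lemma \<delta>_add: "\<delta> (F + G) = \<delta> F + \<delta> G" and \<delta>_mult: "\<delta> (F * G) = \<delta> F * G + F * \<delta> G"
  using derivation_diff_poly_deriv[OF D] unfolding derivation_def by auto

lemma \<delta>_zero: "\<delta> 0 = 0"
  using \<delta>_add[of 0 0] by simp

lemma \<delta>_pconst: "\<delta> (pconst c) = pconst (D c)"
  unfolding pconst_def by (rule diff_poly_deriv_const[OF D])

lemma \<delta>_pvar: "\<delta> (pvar v) = pvar (shift v)"
  using diff_poly_deriv_indet[OF D, of "fst v" "snd v"] by (simp add: pvar_def shift_def)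

lemma \<delta>_in: "F \<in> polys_in W \<Longrightarrow> \<delta> F \<in> polys_in (W \<union> shift ` W)"
proof (induction rule: polys_in_induct)
  case (mult F G)
  then show ?case
    using polys_in_mono[of W "W \<union> shift ` W"] by (auto simp: \<delta>_mult intro!: polys_in_add polys_in_mult)
qed (auto simp: \<delta>_pconst \<delta>_pvar \<delta>_add pconst_in_polys polys_in_add intro!: pvar_in_polys)

lemma \<delta>_poly: "\<delta> (poly g y) = poly (map_poly \<delta> g) y + poly (formal_deriv g) y * \<delta> y"
proof (induction g)
  case (pCons a g)
  have "map_poly \<delta> (pCons a g) = pCons (\<delta> a) (map_poly \<delta> g)"
    by (rule poly_eqI) (simp add: coeff_map_poly \<delta>_zero coeff_pCons split: nat.split)
  then show ?case using pCons.IH by (simp add: \<delta>_add \<delta>_mult formal_deriv_pCons algebra_simps)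
qed (simp add: \<delta>_zero formal_deriv_def)

text \<open>The prime lives in the ring of all indeterminates, but differential stability concerns
  only the first \<open>n\<close> differential ones. The last clause is characteristic zero of the
  residue field.\<close>

definition diff_prime :: "nat \<Rightarrow> (nat \<times> nat, 'a) mpol set \<Rightarrow> bool"
  where "diff_prime n Q \<longleftrightarrow> prime_id Q \<and> (\<forall>F\<in>Q \<inter> polys_in ({..<n} \<times> UNIV). \<delta> F \<in> Q) \<and> (\<forall>k>0. of_nat k \<notin> Q)"

text \<open>
  Differentiating a relation of minimal degree for \<open>v\<close> gives one that is linear in the derivative
  of \<open>v\<close>; its leading coefficient is the derivative of the minimal relation and does not
  vanish in characteristic zero.
\<close>

lemma alg_over_shift:
  assumes Q: "diff_prime n Q" and W: "W \<subseteq> {..<n} \<times> UNIV" "v \<in> {..<n} \<times> UNIV"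
    and alg: "alg_over Q W (pvar v)"
  shows "alg_over Q (insert v (W \<union> shift ` W)) (pvar (shift v))"
proof -
  interpret mpol_prime Q using Q unfolding diff_prime_def by (intro mpol_primeI) blast
  let ?A = "polys_in W :: (nat \<times> nat, 'a) mpol set"
  interpret A: subring_set ?A by (rule subring_polys_in)
  let ?rel = "\<lambda>g. g \<in> coeffs_in ?A \<and> g \<notin> coeffs_in Q \<and> poly g (pvar v) \<in> Q"
  from alg have "\<exists>g. ?rel g" unfolding algebraic_mod_def by blast
  from ex_has_least_nat[of ?rel _ degree] this obtain g where
    g: "g \<in> coeffs_in ?A" "g \<notin> coeffs_in Q" "poly g (pvar v) \<in> Q"
    and min: "\<And>f. ?rel f \<Longrightarrow> degree g \<le> degree f" by blast
  define e where "e = degree g"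
  \<comment> \<open>A leading coefficient in \<open>Q\<close> could be removed from the relation,
    against the minimality of its degree.\<close>
  have lead: "coeff g e \<notin> Q"
  proof
    assume l: "coeff g e \<in> Q"
    define f where "f = g - monom (coeff g e) e"
    have cf: "coeff f i = (if i = e then 0 else coeff g i)" for i by (simp add: f_def)
    have "f \<in> coeffs_in ?A" using g(1) A.zero_mem by (auto simp: coeffs_in_def cf)
    moreover have f: "f \<notin> coeffs_in Q" using g(2) l by (auto simp: coeffs_in_def cf)
    moreover have "poly f (pvar v) \<in> Q" using g(3) l by (simp add: f_def poly_monom diff multr)
    ultimately have "e \<le> degree f" using min unfolding e_def by blast
    moreover have "coeff f i = 0" if "i \<ge> e" for i
      using that coeff_eq_0[of g i] by (auto simp: cf e_def)
    ultimately have "coeff f (degree f) = 0" by blast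
    then have "f = 0" by (simp add: leading_coeff_0_iff)
    then show False using f zero by (simp add: coeffs_in_def)
  qed
  have e0: "e > 0"
  proof (rule ccontr)
    assume "\<not> e > 0"
    then obtain a where "g = [:a:]" using degree_eq_zeroE[of g] unfolding e_def by blast
    then show False using g(3) lead e_def by simp
  qed
  have pd: "poly (formal_deriv g) (pvar v) \<notin> Q"
  proof
    assume p: "poly (formal_deriv g) (pvar v) \<in> Q"
    have "formal_deriv g \<in> coeffs_in ?A" by (rule A.formal_deriv_in[OF g(1)])
    moreover have "coeff (formal_deriv g) (e - 1) \<notin> Q"
      using lead e0 Q prime[of "of_nat e" "coeff g e"] unfolding coeff_formal_deriv diff_prime_def by auto
    then have "formal_deriv g \<notin> coeffs_in Q" unfolding coeffs_in_def by blast
    ultimately have "e \<le> degree (formal_deriv g)" using min p unfolding e_def by blast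
    moreover have "degree (formal_deriv g) \<le> e - 1" unfolding e_def by (rule degree_formal_deriv_le)
    ultimately show False using e0 by simp
  qed
  define U where "U = insert v (W \<union> shift ` W)"
  have WU: "W \<subseteq> U" "W \<union> shift ` W \<subseteq> U" "v \<in> U" by (auto simp: U_def)
  have gA: "coeff g i \<in> ?A" for i using g(1) by (auto simp: coeffs_in_def)
  have "poly g (pvar v) \<in> polys_in ({..<n} \<times> UNIV)"
    using g(1) W polys_in_mono[OF W(1)] by (intro poly_in_polys) (auto simp: coeffs_in_def)
  then have "\<delta> (poly g (pvar v)) \<in> Q" using g(3) Q unfolding diff_prime_def by blast
  then have rel: "poly [:poly (map_poly \<delta> g) (pvar v), poly (formal_deriv g) (pvar v):] (pvar (shift v)) \<in> Q"
    by (simp add: \<delta>_poly \<delta>_pvar mult.commute)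
  have "map_poly \<delta> g \<in> coeffs_in (polys_in U)"
    using \<delta>_in[OF gA] polys_in_mono[OF WU(2)] by (auto simp: coeffs_in_def coeff_map_poly \<delta>_zero)
  then have c0: "poly (map_poly \<delta> g) (pvar v) \<in> polys_in U" by (rule poly_in_polys[OF _ WU(3)])
  have "formal_deriv g \<in> coeffs_in (polys_in U)"
    using A.formal_deriv_in[OF g(1)] coeffs_in_mono[OF polys_in_mono[OF WU(1)]] by blast
  then have c1: "poly (formal_deriv g) (pvar v) \<in> polys_in U" by (rule poly_in_polys[OF _ WU(3)])
  show ?thesis
    unfolding algebraic_mod_def U_def[symmetric]
  proof (intro bexI conjI)
    show "[:poly (map_poly \<delta> g) (pvar v), poly (formal_deriv g) (pvar v):] \<in> coeffs_in (polys_in U)"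
      using c0 c1 polys_in_0 by (auto simp: coeffs_in_def coeff_pCons split: nat.split)
    show "[:poly (map_poly \<delta> g) (pvar v), poly (formal_deriv g) (pvar v):] \<notin> coeffs_in Q"
      using pd by (auto simp: coeffs_in_def intro!: exI[of _ 1])
  qed (rule rel)
qed

text \<open>Let \<open>B\<close> complete the orders below \<open>k\<close> to a basis at order
  \<open>k\<close>. Each indeterminate of order \<open>k\<close> is algebraic over these, so by
  \<open>alg_over_shift\<close> its derivative is algebraic over the orders up to \<open>k\<close>
  and the derivatives of \<open>B\<close>. The next increment of the rank is thus at most
  \<open>card B\<close>.\<close>

lemma rank_jets_concave:
  assumes Q: "diff_prime n Q"
  shows "rank Q (jets n (Suc (Suc k))) + rank Q (jets n k) \<le> 2 * rank Q (jets n (Suc k))"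
proof -
  interpret mpol_prime Q using Q unfolding diff_prime_def by (intro mpol_primeI) blast
  let ?L = "{..<n} \<times> {k}"
  obtain B where B: "B \<subseteq> ?L" "rank Q (jets n k \<union> B) = rank Q (jets n k) + card B"
    "rank Q (jets n k \<union> ?L) = rank Q (jets n k) + card B" "\<forall>v\<in>?L. alg_over Q (jets n k \<union> B) (pvar v)"
    by (rule ex_relative_basis[OF finite_jets[of n k], of ?L]) auto
  have finB: "finite B" using B(1) by (rule finite_subset) simp
  have "alg_over Q (jets n (Suc k) \<union> shift ` B) (pvar w)" if w: "w \<in> {..<n} \<times> {Suc k}" for w
  proof -
    obtain v where v: "v \<in> ?L" "w = shift v" using w by (force simp: shift_def)
    have "alg_over Q (insert v (jets n k \<union> B \<union> shift ` (jets n k \<union> B))) (pvar (shift v))"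
      using v B(1,4) by (intro alg_over_shift[OF Q]) (auto simp: jets_def)
    moreover have "insert v (jets n k \<union> B \<union> shift ` (jets n k \<union> B)) \<subseteq> jets n (Suc k) \<union> shift ` B"
      using v(1) B(1) by (auto simp: jets_def shift_def)
    ultimately show ?thesis unfolding v(2) by (rule alg_over_mono)
  qed
  then have "rank Q (jets n (Suc k) \<union> shift ` B \<union> {..<n} \<times> {Suc k}) = rank Q (jets n (Suc k) \<union> shift ` B)"
    using finB by (intro rank_Un_eq) (auto simp: finite_jets)
  also have "\<dots> \<le> rank Q (jets n (Suc k)) + card (shift ` B)"
    using finB by (intro rank_Un_le) (auto simp: finite_jets)
  also have "card (shift ` B) \<le> card B" using finB by (rule card_image_le)
  finally have "rank Q (jets n (Suc k) \<union> shift ` B \<union> {..<n} \<times> {Suc k}) \<le> rank Q (jets n (Suc k)) + card B" by simp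
  moreover have "rank Q (jets n (Suc (Suc k))) \<le> rank Q (jets n (Suc k) \<union> shift ` B \<union> {..<n} \<times> {Suc k})"
    using finB by (intro rank_mono) (auto simp: finite_jets jets_Suc[of n "Suc k"])
  moreover have "rank Q (jets n (Suc k)) = rank Q (jets n k) + card B" using B(3) unfolding jets_Suc .
  ultimately show ?thesis by simp
qed

text \<open>For a differential prime, \<open>d\<close> is the leading coefficient of its Kolchin
  polynomial, the number of differentially independent indeterminates modulo
  \<open>Q\<close>.\<close>

definition slope :: "nat \<Rightarrow> (nat \<times> nat, 'a) mpol set \<Rightarrow> nat \<Rightarrow> bool"
  where "slope n Q d \<longleftrightarrow> (\<exists>k0 a. \<forall>j. rank Q (jets n (k0 + j)) = a + d * j)"

lemma ex_slope:
  assumes Q: "diff_prime n Q"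
  obtains d where "slope n Q d"
proof -
  interpret mpol_prime Q using Q unfolding diff_prime_def by (intro mpol_primeI) blast
  define r where "r k = rank Q (jets n k)" for k
  have mono: "r k \<le> r (Suc k)" for k
    unfolding r_def by (intro rank_mono finite_jets jets_mono) simp
  define inc where "inc k = r (Suc k) - r k" for k
  have inc: "inc (Suc k) \<le> inc k" for k
    using rank_jets_concave[OF Q, of k] mono[of k] mono[of "Suc k"] by (simp add: inc_def r_def)
  define d where "d = (LEAST d. \<exists>k. inc k = d)"
  have "\<exists>k. inc k = d" unfolding d_def by (rule LeastI_ex) blast
  then obtain k0 where k0: "inc k0 = d" by blast
  have incd: "inc (k0 + j) = d" for j
  proof -
    have "inc (k0 + j) \<le> inc k0" by (induction j) (auto intro: order_trans[OF inc])
    moreover have "d \<le> inc (k0 + j)" unfolding d_def by (rule Least_le) blast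
    ultimately show ?thesis using k0 by simp
  qed
  have "r (k0 + j) = r k0 + d * j" for j
  proof (induction j)
    case (Suc j)
    then show ?case using incd[of j] mono[of "k0 + j"] by (simp add: inc_def)
  qed simp
  then have "slope n Q d" unfolding slope_def r_def by blast
  then show thesis by (rule that)
qed

lemma slopeD:
  assumes "slope n Q d" "slope n Q' d'"
  obtains k0 a a' where "\<And>j. rank Q (jets n (k0 + j)) = a + d * j" "\<And>j. rank Q' (jets n (k0 + j)) = a' + d' * j"
proof -
  from assms obtain k1 a1 k2 a2 where
    1: "\<And>j. rank Q (jets n (k1 + j)) = a1 + d * j" and 2: "\<And>j. rank Q' (jets n (k2 + j)) = a2 + d' * j"
    unfolding slope_def by blast
  show thesis
  proof (rule that[of "k1 + k2" "a1 + d * k2" "a2 + d' * k1"])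
    fix j
    show "rank Q (jets n (k1 + k2 + j)) = a1 + d * k2 + d * j"
      using 1[of "k2 + j"] by (simp add: algebra_simps)
    show "rank Q' (jets n (k1 + k2 + j)) = a2 + d' * k1 + d' * j"
      using 2[of "k1 + j"] by (simp add: algebra_simps)
  qed
qed

lemma linear_le_imp_slope_le:
  fixes a b d e :: nat
  assumes "\<And>j. a + d * j \<le> b + e * j"
  shows "d \<le> e"
proof (rule ccontr)
  assume "\<not> d \<le> e"
  then have "(e + 1) * (b + 1) \<le> d * (b + 1)" by (intro mult_right_mono) auto
  with assms[of "b + 1"] show False by (simp add: algebra_simps)
qed

lemma slope_le_if_rank_le:
  assumes "slope n Q d" "slope n Q' d'" "\<And>k. rank Q (jets n k) \<le> rank Q' (jets n k) + t"
  shows "d \<le> d'"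
proof -
  obtain k0 a a' where 1: "\<And>j. rank Q (jets n (k0 + j)) = a + d * j" and 2: "\<And>j. rank Q' (jets n (k0 + j)) = a' + d' * j"
    using slopeD[OF assms(1,2)] by metis
  have "a + d * j \<le> (a' + t) + d' * j" for j
    using assms(3)[of "k0 + j"] by (simp add: 1 2)
  then show ?thesis by (rule linear_le_imp_slope_le)
qed

lemma slope_le:
  assumes "diff_prime n Q" "slope n Q d"
  shows "d \<le> n"
proof -
  interpret mpol_prime Q using assms(1) unfolding diff_prime_def by (intro mpol_primeI) blast
  obtain k0 a where 1: "\<And>j. rank Q (jets n (k0 + j)) = a + d * j"
    using assms(2) unfolding slope_def by blast
  have "a + d * j \<le> n * k0 + n * j" for j
    using rank_le_card[OF finite_jets[of n "k0 + j"]] 1[of j] by (simp add: jets_def algebra_simps)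
  then show ?thesis by (rule linear_le_imp_slope_le)
qed

end

lemma descending_primes_stabilize:
  fixes q :: "nat \<Rightarrow> 'a::comm_ring_1 set"
  assumes fin: "krull_dim (ring_of_type_algebra :: 'a ring) < \<infinity>"
    and q: "\<And>i. prime_id (q i)" and dec: "\<And>i. q (Suc i) \<subseteq> q i"
  obtains i0 where "\<And>i. i \<ge> i0 \<Longrightarrow> q i = q i0"
proof (rule ccontr)
  assume no: "\<not> thesis"
  have anti: "q j \<subseteq> q i" if "i \<le> j" for i j using lift_Suc_antimono_le[of q, OF dec that] .
  have "\<forall>i. \<exists>j>i. q j \<subset> q i"
  proof
    fix i
    from no that obtain j where "j \<ge> i" "q j \<noteq> q i" by blast
    then show "\<exists>j>i. q j \<subset> q i" using anti[of i j] by (intro exI[of _ j]) (auto simp: le_less)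
  qed
  from choice[OF this] obtain f where f: "\<And>i. q (f i) \<subset> q i" by blast
  define g where "g k = (f ^^ k) 0" for k
  have g: "q (g (Suc k)) \<subset> q (g k)" for k using f by (simp add: g_def)
  from fin obtain l where l: "krull_dim (ring_of_type_algebra :: 'a ring) = enat l" by auto
  have "enat (Suc l) \<le> krull_dim (ring_of_type_algebra :: 'a ring)"
    unfolding krull_dim_def primeideal_type_iff
  \<comment> \<open>The indices are reversed because \<open>krull_dim\<close> counts ascending
    chains.\<close>
  proof (rule SUP_upper, rule CollectI, intro exI[of _ "\<lambda>i. q (g (Suc l - i))"] conjI allI impI)
    fix i assume "i < Suc l"
    then have "Suc l - i = Suc (Suc l - Suc i)" by simp
    then show "q (g (Suc l - i)) \<subset> q (g (Suc l - Suc i))" using g[of "Suc l - Suc i"] by simp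
  qed (rule q)
  then show False unfolding l by simp
qed

context diff_ring begin

section \<open>Slopes of differential primes when the gains are bounded\<close>

context
  fixes n t :: nat
  assumes bounded: "\<And>q p :: 'a set. prime_id q \<Longrightarrow> prime_id p \<Longrightarrow> q \<subset> p \<Longrightarrow> \<not> gain q p t"
begin

text \<open>Passing to the larger prime raises the rank only if the contraction changes, and then by
  less than \<open>t\<close> for every order. A bounded error does not affect the slope.\<close>

lemma slope_antimono:
  assumes Q: "diff_prime n Q" "slope n Q d" and Q': "diff_prime n Q'" "slope n Q' d'" and sub: "Q \<subseteq> Q'"
  shows "d' \<le> d"
proof (rule slope_le_if_rank_le[OF Q'(2) Q(2)])
  interpret Q: mpol_prime Q using Q(1) unfolding diff_prime_def by (intro mpol_primeI) blast
  interpret Q': mpol_prime Q' using Q'(1) unfolding diff_prime_def by (intro mpol_primeI) blast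
  fix k
  show "rank Q' (jets n k) \<le> rank Q (jets n k) + t"
  proof (cases "same_contraction Q Q'")
    case True
    have "rank Q' (jets n k) \<le> rank Q (jets n k)"
      by (rule rank_antimono[OF Q.mpol_prime_axioms Q'.mpol_prime_axioms True _ finite_jets]) (use sub in blast)
    then show ?thesis by simp
  next
    case False
    then have "pconst -` Q \<subset> pconst -` Q'" using sub unfolding same_contraction_def by blast
    then have "\<not> gain (pconst -` Q) (pconst -` Q') t"
      by (intro bounded prime_pconst_vimage Q.prime_id_axioms Q'.prime_id_axioms)
    then show ?thesis
      using gain_if_rank[OF Q.prime_id_axioms Q'.prime_id_axioms sub finite_jets, of t n k] by linarith
  qed
qed

text \<open>On the tail \<open>b\<close> the contraction is constant, so every strict step adds at
  least 1 to the rank of all large jets. The rank modulo the intersection \<open>L\<close> then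
  exceeds that modulo \<open>b 0\<close> by arbitrarily much, which rules out equal slopes. The
  passages from \<open>c 0\<close> to the tail and from \<open>L\<close> to \<open>p\<close>, where
  the contraction may change, are covered by \<open>slope_antimono\<close>.\<close>

lemma slope_less_if_descending:
  assumes fin: "krull_dim (ring_of_type_algebra :: 'a ring) < \<infinity>"
    and c: "\<And>i. diff_prime n (c i)" and dec: "\<And>i. c (Suc i) \<subseteq> c i"
    and strict: "\<And>i. \<exists>F. F \<in> c i \<and> F \<notin> c (Suc i) \<and> F \<in> polys_in ({..<n} \<times> UNIV)"
    and p: "diff_prime n p" "\<And>i. p \<subseteq> c i"
    and d0: "slope n (c 0) d0" and d: "slope n p d"
  shows "d0 < d"
proof -
  have prime: "prime_id (c i)" for i using c unfolding diff_prime_def by blast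
  have anti: "c j \<subseteq> c i" if "i \<le> j" for i j using lift_Suc_antimono_le[of c, OF dec that] .
  obtain i0 where i0: "\<And>i. i \<ge> i0 \<Longrightarrow> pconst -` c i = pconst -` c i0"
  proof (rule descending_primes_stabilize[OF fin, of "\<lambda>i. pconst -` c i"])
    show "prime_id (pconst -` c i)" for i by (rule prime_pconst_vimage[OF prime])
    show "pconst -` c (Suc i) \<subseteq> pconst -` c i" for i using dec by blast
  qed blast
  define b where "b i = c (i0 + i)" for i
  define L where "L = (\<Inter>i. b i)"
  have same: "same_contraction (b i) (b j)" for i j
  proof -
    have "pconst -` b i = pconst -` b j" using i0[of "i0 + i"] i0[of "i0 + j"] by (simp add: b_def)
    then show ?thesis unfolding same_contraction_def by blast
  qed
  have prime_b: "mpol_prime (b i)" for i unfolding b_def by (rule mpol_primeI[OF prime])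
  have dec_b: "b (Suc i) \<subseteq> b i" for i using dec by (simp add: b_def)
  have prime_L: "mpol_prime L"
    unfolding L_def by (intro mpol_primeI prime_id_Inter_chain dec_b) (simp add: b_def prime)
  have same_L: "same_contraction L (b i)" for i
    using same[of i] unfolding same_contraction_def L_def by blast
  have "diff_prime n L"
    using prime_L c[of "i0 + _"] unfolding diff_prime_def mpol_prime_def L_def b_def by blast
  then obtain dL where dL: "slope n L dL" by (rule ex_slope)
  obtain d1 where d1: "slope n (b 0) d1" using ex_slope[OF c[of i0]] by (auto simp: b_def)
  have "d0 \<le> d1" using slope_antimono[OF c[of i0] _ c[of 0] d0 anti] d1 by (simp add: b_def)
  moreover have "dL \<le> d" by (rule slope_antimono[OF p(1) d \<open>diff_prime n L\<close> dL]) (use p(2) in \<open>auto simp: L_def b_def\<close>)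
  moreover have le_L: "rank (b i) (jets n k) \<le> rank L (jets n k)" for i k
    by (rule rank_antimono[OF prime_L prime_b same_L _ finite_jets]) (auto simp: L_def)
  then have "d1 \<le> dL" by (intro slope_le_if_rank_le[OF d1 dL, of 0]) simp
  moreover have "d1 \<noteq> dL"
  proof
    assume eq: "d1 = dL"
    obtain k0 a a' where a: "\<And>j. rank (b 0) (jets n (k0 + j)) = a + d1 * j"
      and a': "\<And>j. rank L (jets n (k0 + j)) = a' + dL * j"
      using slopeD[OF d1 dL] by metis
    \<comment> \<open>The bound \<open>K\<close> depends on \<open>M\<close>: the element that
      separates two members of the chain may have any order.\<close>
    have "\<exists>K. \<forall>k\<ge>K. rank (b 0) (jets n k) + M \<le> rank (b M) (jets n k)" for M
    proof (induction M)
      case (Suc M)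
      then obtain K where K: "\<forall>k\<ge>K. rank (b 0) (jets n k) + M \<le> rank (b M) (jets n k)" by blast
      from strict[of "i0 + M"] obtain F where F: "F \<in> b M" "F \<notin> b (Suc M)" "F \<in> polys_in ({..<n} \<times> UNIV)"
        unfolding b_def by auto
      obtain K' where K': "F \<in> polys_in (jets n K')" using jets_exhaust[OF F(3)] .
      have "rank (b 0) (jets n k) + Suc M \<le> rank (b (Suc M)) (jets n k)" if k: "k \<ge> max K K'" for k
      proof -
        have "F \<in> polys_in (jets n k)" using K' polys_in_mono[OF jets_mono[of K' k n]] k by auto
        then have "rank (b M) (jets n k) < rank (b (Suc M)) (jets n k)"
          using dec_b by (intro rank_strict_antimono[OF prime_b prime_b same _ finite_jets F(1,2)]) auto
        moreover have "rank (b 0) (jets n k) + M \<le> rank (b M) (jets n k)" using K k by auto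
        ultimately show ?thesis by simp
      qed
      then show ?case by blast
    qed auto
    \<comment> \<open>With equal slopes the two ranks would differ by at most \<open>a'\<close>, so
      \<open>a' + 1\<close> strict steps are too many.\<close>
    then obtain K where K: "\<And>k. k \<ge> K \<Longrightarrow> rank (b 0) (jets n k) + Suc a' \<le> rank (b (Suc a')) (jets n k)" by blast
    have "a + d1 * K + Suc a' \<le> a' + dL * K"
      using K[of "k0 + K"] le_L[of "Suc a'" "k0 + K"] by (simp add: a a')
    then show False using eq by simp
  qed
  ultimately show ?thesis by simp
qed

end

end

section \<open>Differential type and dimension\<close>

text \<open>The indeterminates of \<open>vs\<close> are generic and all others are set to 0, so
  exactly the monomials in \<open>vs\<close> matter.\<close>

lemma gen_vars_augment_iff_lookup:
  fixes F :: "('i, 'a::comm_ring_1) mpol"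
  assumes p: "prime_id p"
  shows "F \<in> gen_vars vs (augment p) \<longleftrightarrow>
    (\<forall>m. keys m \<subseteq> set vs \<longrightarrow> lookup F m \<in> p)"
proof (induction vs arbitrary: F)
  case Nil
  have "mon_eval (\<lambda>_. 0 :: 'a) m = (if m = 0 then 1 else 0)" for m :: "'i \<Rightarrow>\<^sub>0 nat"
    by (auto simp: mon_eval_def in_keys_iff power_0_left)
  then have "peval (\<lambda>c. c) (\<lambda>_. 0) F = lookup F 0"
    by (simp add: peval_def lin_ext_def in_keys_iff if_distrib[of "\<lambda>x. _ * x"] cong: if_cong)
  then show ?case by (simp add: gen_vars_simps augment_def)
next
  case (Cons v vs)
  have "F \<in> gen_vars (v # vs) (augment p) \<longleftrightarrow> (\<forall>i k. keys k \<subseteq> set vs \<longrightarrow>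
      lookup (coeff (to_poly v F) i) k \<in> p)"
    by (simp add: gen_vars_simps gen_var_def coeffs_in_def Cons.IH)
  also have "\<dots> \<longleftrightarrow> (\<forall>m. keys m \<subseteq> set (v # vs) \<longrightarrow> lookup F m \<in> p)"
  proof (intro iffI allI impI)
    fix i and k :: "'i \<Rightarrow>\<^sub>0 nat" assume *: "\<forall>m. keys m \<subseteq> set (v # vs) \<longrightarrow> lookup F m \<in> p"
      "keys k \<subseteq> set vs"
    have "keys (k + single v i) \<subseteq> set (v # vs)"
      using *(2) keys_add[of k "single v i"] by (auto split: if_splits)
    then show "lookup (coeff (to_poly v F) i) k \<in> p"
      using *(1) prime_id.zero[OF p] by (simp add: lookup_coeff_to_poly)
  next
    fix m :: "'i \<Rightarrow>\<^sub>0 nat"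
    assume *: "\<forall>i k. keys k \<subseteq> set vs \<longrightarrow> lookup (coeff (to_poly v F) i) k \<in> p"
      "keys m \<subseteq> set (v # vs)"
    obtain i k where kv: "lookup k v = 0" and m: "m = k + single v i" by (rule monomial_split)
    have "w \<in> set vs" if "w \<in> keys k" for w
    proof -
      have "w \<noteq> v" using that kv by (auto simp: in_keys_iff)
      moreover have "w \<in> keys m" using that unfolding m by (auto simp: in_keys_iff lookup_add)
      ultimately show ?thesis using *(2) by auto
    qed
    then have "lookup (coeff (to_poly v F) i) k \<in> p" using *(1) by blast
    then show "lookup F m \<in> p" using kv m by (simp add: lookup_coeff_to_poly)
  qed
  finally show ?case .
qed

context diff_ring begin

text \<open>If differentiating a monomial produces one in \<open>jets n k\<close>, the monomial was
  already there, because the replaced indeterminate has smaller order than its derivative. So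
  \<open>p\<close> and the indeterminates outside \<open>jets n k\<close> generate a differential
  ideal.\<close>

lemma lookup_\<delta>_mem:
  assumes p: "prime_id p" "D ` p \<subseteq> p"
    and F: "\<And>m. keys m \<subseteq> jets n k \<Longrightarrow> lookup F m \<in> p"
    and m': "keys m' \<subseteq> jets n k"
  shows "lookup (\<delta> F) m' \<in> p"
proof -
  interpret p: prime_id p by (rule p(1))
  have each: "lookup (term_deriv D m (lookup F m)) m' \<in> p" for m
  proof -
    define c where "c = lookup F m"
    have c: "c \<in> p" if "keys m \<subseteq> jets n k" unfolding c_def using F that by blast
    define e where "e v = m - single v 1 + single (shift v) 1" for v
    have "lookup (single m (D c)) m' \<in> p"
      using c p(2) m' p.zero by (auto simp: lookup_single when_def)
    moreover have "lookup (single (e v) (of_nat (lookup m v) * c)) m' \<in> p"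
      if v: "v \<in> keys m" for v
    proof (cases "e v = m'")
      case True
      have "c \<in> p"
      proof (rule c, rule subsetI)
        fix u assume u: "u \<in> keys m"
        show "u \<in> jets n k"
        proof (cases "u = v")
          case True
          have "shift v \<in> keys (e v)" by (simp add: e_def in_keys_iff lookup_add)
          then have "shift v \<in> jets n k" using \<open>e v = m'\<close> m' by blast
          then show ?thesis unfolding True by (auto simp: jets_def shift_def mem_Times_iff)
        next
          case False
          have "lookup (e v) u \<ge> lookup m u"
            using False by (simp add: e_def lookup_add lookup_minus lookup_single)
          then have "u \<in> keys (e v)" using u by (simp add: in_keys_iff)
          then show ?thesis using \<open>e v = m'\<close> m' by blast
        qed
      qed
      then show ?thesis using True by (simp add: p.multl)
    qed (simp add: lookup_single p.zero)
    then have "(\<Sum>v\<in>keys m. lookup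
        (single (e v) (of_nat (lookup m v) * c)) m') \<in> p"
      by (rule p.sum)
    ultimately show ?thesis
      unfolding term_deriv_def c_def[symmetric]
      by (simp add: lookup_add lookup_sum split_def e_def shift_def p.add)
  qed
  show ?thesis unfolding diff_poly_deriv_eq lookup_sum by (rule p.sum) (rule each)
qed

lemma diff_spec_poly_iff:
  "P \<in> diff_spec (diff_poly_ring n) \<delta> \<longleftrightarrow> primeideal P (poly_ring ({..<n} \<times> UNIV)) \<and> (\<forall>F\<in>P. \<delta> F \<in> P)"
  by (auto simp: diff_spec_def diff_poly_ring_def)

text \<open>The members are generated by \<open>p\<close> and the derivatives of order at least
  \<open>k\<close>; the \<open>k\<close>-th derivative of the first indeterminate separates
  consecutive ones.\<close>

lemma ex_descending:
  assumes p: "p \<in> diff_spec ring_of_type_algebra D" and n: "n > 0"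
  obtains P P' c where "P \<in> diff_spec (diff_poly_ring n) \<delta>" "P' \<in> diff_spec (diff_poly_ring n) \<delta>"
    "P' \<subset> P" "descending (diff_spec (diff_poly_ring n) \<delta>) P P' c"
proof -
  let ?I = "{..<n} \<times> (UNIV :: nat set)"
  have p: "prime_id p" "D ` p \<subseteq> p" using p by (auto simp: diff_spec_def primeideal_type_iff)
  define T where "T k = {F :: (nat \<times> nat, 'a) mpol. \<forall>m. keys m \<subseteq> jets n k \<longrightarrow> lookup F m \<in> p}" for k
  have prime_T: "prime_id (T k)" for k
  proof -
    obtain vs where "set vs = jets n k" using finite_list[OF finite_jets] by blast
    then have "T k = gen_vars vs (augment p)" unfolding T_def using gen_vars_augment_iff_lookup[OF p(1), of _ vs] by auto
    then show ?thesis using prime_gen_vars[OF prime_augment[OF p(1)]] by simp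
  qed
  have T_\<delta>: "\<delta> F \<in> T k" if "F \<in> T k" for F k
    using lookup_\<delta>_mem[OF p, of n k F] that unfolding T_def by blast
  have T_dec: "T (Suc k) \<subseteq> T k" for k
    unfolding T_def using jets_mono[of k "Suc k" n] by auto
  define c where "c k = T k \<inter> polys_in ?I" for k
  define P' where "P' = (\<Inter>k. T k) \<inter> polys_in ?I"
  have \<delta>_I: "\<delta> F \<in> polys_in ?I" if "F \<in> polys_in ?I" for F
    using diff_poly_deriv_closed[OF D that] .
  have c: "c k \<in> diff_spec (diff_poly_ring n) \<delta>" for k
    unfolding diff_spec_poly_iff c_def using primeideal_Int[OF prime_T] T_\<delta> \<delta>_I by blast
  have P': "P' \<in> diff_spec (diff_poly_ring n) \<delta>"
    unfolding diff_spec_poly_iff P'_def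
    using primeideal_Int[OF prime_id_Inter_chain[of T, OF prime_T T_dec]] T_\<delta> \<delta>_I by blast
  have strict: "c (Suc k) \<subset> c k" for k
  proof -
    have "(pvar (0, k) :: (nat \<times> nat, 'a) mpol) \<in> T k"
      using prime_id.zero[OF p(1)] by (auto simp: T_def pvar_def lookup_single when_def jets_def split: if_splits)
    moreover have "(pvar (0, k) :: (nat \<times> nat, 'a) mpol) \<notin> T (Suc k)"
      using prime_id.one[OF p(1)] n
      by (auto simp: T_def pvar_def jets_def intro!: exI[of _ "single (0, k) 1"])
    moreover have "(pvar (0, k) :: (nat \<times> nat, 'a) mpol) \<in> polys_in ?I" using n by (intro pvar_in_polys) simp
    ultimately show ?thesis using T_dec[of k] unfolding c_def by blast
  qed
  have sub: "P' \<subseteq> c k" for k by (auto simp: P'_def c_def)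
  have "descending (diff_spec (diff_poly_ring n) \<delta>) (c 0) P' c"
    unfolding descending_def using c strict sub by blast
  moreover have "P' \<subset> c 0" using sub[of 1] strict[of 0] by auto
  ultimately show thesis using that[OF c P'] by blast
qed

lemma gap_ge_1_iff:
  fixes S :: "'b set set"
  assumes "P \<in> S" "P' \<in> S" "P' \<subseteq> P"
  shows "gap_measure S P P' \<ge> 1 \<longleftrightarrow> P \<noteq> P' \<and> (\<exists>c. descending S P P' c)"
  using gap_measure_ge_iff[OF is_gap_measure_gap_measure assms, of 1] by (simp add: one_enat_def)

text \<open>With type 0, \<open>diff_dim\<close> would count steps without any infinite descending
  chain inside.\<close>

lemma diff_type_ge_1:
  assumes "p \<in> diff_spec ring_of_type_algebra D" "n > 0"
  shows "diff_type (diff_poly_ring n) \<delta> \<ge> 1"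
proof -
  obtain P P' c where P: "P \<in> diff_spec (diff_poly_ring n) \<delta>" "P' \<in> diff_spec (diff_poly_ring n) \<delta>"
    "P' \<subset> P" "descending (diff_spec (diff_poly_ring n) \<delta>) P P' c"
    by (rule ex_descending[OF assms])
  then have "1 \<le> gap_measure (diff_spec (diff_poly_ring n) \<delta>) P P'"
    using gap_ge_1_iff[OF P(1,2)] by auto
  also have "\<dots> \<le> diff_type (diff_poly_ring n) \<delta>"
    unfolding diff_type_def by (rule Sup_upper) (use P in auto)
  finally show ?thesis .
qed

text \<open>The contraction to \<open>R\<close> is a differential prime of \<open>R\<close>, so
  standardness supplies characteristic zero.\<close>

lemma diff_prime_extend:
  assumes P: "P \<in> diff_spec (diff_poly_ring n) \<delta>" and standard: "standard_diff_ring D"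
  shows "diff_prime n (extend_prime ({..<n} \<times> UNIV) P)"
proof -
  let ?I = "{..<n} \<times> (UNIV :: nat set)"
  define Q where "Q = extend_prime ?I P"
  from P have P: "primeideal P (poly_ring ?I)" "\<And>F. F \<in> P \<Longrightarrow> \<delta> F \<in> P" by (auto simp: diff_spec_poly_iff)
  have Q: "prime_id Q" unfolding Q_def by (rule prime_extend_prime[OF P(1)])
  have stable: "\<delta> F \<in> Q" if "F \<in> Q" "F \<in> polys_in ?I" for F
    using that P(2) diff_poly_deriv_closed[OF D that(2)] by (simp add: Q_def extend_prime_iff)
  define p where "p = (pconst -` Q :: 'a set)"
  have p: "prime_id p" unfolding p_def by (rule prime_pconst_vimage[OF Q])
  have "D ` p \<subseteq> p"
    using stable[OF _ pconst_in_polys] by (auto simp: p_def \<delta>_pconst[symmetric])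
  with p have "p \<in> diff_spec ring_of_type_algebra D" by (simp add: diff_spec_def primeideal_type_iff)
  then have "char_zero (residue_field p)" using standard by (simp add: standard_diff_ring_def)
  then have char0: "of_nat k \<notin> p" if "k > 0" for k
    using char_zero_residue_field_iff[of p] p that by (simp add: primeideal_type_iff)
  have "pconst (of_nat k) = (of_nat k :: (nat \<times> nat, 'a) mpol)" for k
    by (simp add: pconst_def)
  then have "of_nat k \<notin> Q" if "k > 0" for k using char0[OF that] by (simp add: p_def)
  then show ?thesis using Q stable unfolding diff_prime_def Q_def by blast
qed

lemma diff_dim_le:
  fixes t :: nat
  assumes fin: "krull_dim (ring_of_type_algebra :: 'a ring) < \<infinity>" and standard: "standard_diff_ring D"
    and spec: "diff_spec ring_of_type_algebra D \<noteq> {}" and n: "n > 0"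
    and bounded: "\<And>q p :: 'a set. prime_id q \<Longrightarrow> prime_id p \<Longrightarrow> q \<subset> p \<Longrightarrow> \<not> gain q p t"
  shows "diff_dim (diff_poly_ring n) \<delta> \<le> enat n"
proof -
  define S where "S = diff_spec (diff_poly_ring n) \<delta>"
  let ?I = "{..<n} \<times> (UNIV :: nat set)"
  let ?X = "extend_prime ?I :: (nat \<times> nat, 'a) mpol set \<Rightarrow> _"
  obtain p where "p \<in> diff_spec ring_of_type_algebra D" using spec by blast
  then have type: "diff_type (diff_poly_ring n) \<delta> \<ge> 1" using n by (rule diff_type_ge_1)
  have S_sub: "P \<subseteq> polys_in ?I" if "P \<in> S" for P
    using that primeideal_subset by (auto simp: S_def diff_spec_poly_iff)
  have dp: "diff_prime n (?X P)" if "P \<in> S" for P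
    using that diff_prime_extend[OF _ standard] by (simp add: S_def)
  have X_mono: "?X P \<subseteq> ?X P'" if "P \<subseteq> P'" for P P'
    using that by (auto simp: extend_prime_def)
  show ?thesis
    unfolding diff_dim_def
  proof (rule SUP_least)
    fix k assume "k \<in> {k. \<exists>c :: nat \<Rightarrow> (nat \<times> nat, 'a) mpol set. (\<forall>i\<le>k. c i \<in> diff_spec (diff_poly_ring n) \<delta>) \<and>
      (\<forall>i\<in>{1..k}. c i \<subset> c (i - 1) \<and>
        gap_measure (diff_spec (diff_poly_ring n) \<delta>) (c (i - 1)) (c i) = diff_type (diff_poly_ring n) \<delta>)}"
    then obtain c where c: "\<And>i. i \<le> k \<Longrightarrow> c i \<in> S"
      and gap: "\<And>i. i \<in> {1..k} \<Longrightarrow> c i \<subset> c (i - 1) \<and> gap_measure S (c (i - 1)) (c i) = diff_type (diff_poly_ring n) \<delta>"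
      unfolding S_def by blast
    \<comment> \<open>A gap of measure equal to the type has measure at least 1 and contains an
      infinite descending chain, which makes the slope at its lower end strictly larger.\<close>
    have less: "d < d'" if i: "Suc i \<le> k" and d: "slope n (?X (c i)) d" "slope n (?X (c (Suc i))) d'" for i d d'
    proof -
      have "c (Suc i) \<subset> c i" "gap_measure S (c i) (c (Suc i)) \<ge> 1"
        using gap[of "Suc i"] i type by auto
      then obtain b where b: "descending S (c i) (c (Suc i)) b"
        using gap_ge_1_iff[of "c i" S "c (Suc i)"] c i by auto
      have b0: "b 0 = c i" and bS: "\<And>j. b j \<in> S" and dec: "\<And>j. b (Suc j) \<subset> b j" and sub: "\<And>j. c (Suc i) \<subseteq> b j"
        using b unfolding descending_def by auto
      show ?thesis
      proof (rule slope_less_if_descending[OF bounded fin])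
        show "diff_prime n (?X (b j))" for j by (rule dp[OF bS])
        show "?X (b (Suc j)) \<subseteq> ?X (b j)" for j using dec by (intro X_mono) auto
        show "\<exists>F. F \<in> ?X (b j) \<and> F \<notin> ?X (b (Suc j)) \<and> F \<in> polys_in ?I" for j
          using dec[of j] S_sub[OF bS[of j]] extend_prime_iff[of _ ?I] by blast
        show "diff_prime n (?X (c (Suc i)))" by (rule dp[OF c[OF i]])
        show "?X (c (Suc i)) \<subseteq> ?X (b j)" for j by (rule X_mono[OF sub])
        show "slope n (?X (b 0)) d" using d(1) by (simp add: b0)
      qed (use d(2) in \<open>simp_all add: psubset_eq\<close>)
    qed
    \<comment> \<open>After \<open>i\<close> gaps the slope is at least \<open>i\<close>, while
      \<open>slope_le\<close> bounds it by \<open>n\<close>.\<close>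
    have "i \<le> d" if "i \<le> k" "slope n (?X (c i)) d" for i d
      using that
    proof (induction i arbitrary: d)
      case (Suc i)
      obtain d0 where d0: "slope n (?X (c i)) d0" using ex_slope[OF dp[OF c[of i]]] Suc.prems(1) by auto
      then have "i \<le> d0" using Suc by simp
      then show ?case using less[OF Suc.prems(1) d0 Suc.prems(2)] by simp
    qed simp
    moreover obtain d where d: "slope n (?X (c k)) d" using ex_slope[OF dp[OF c[of k]]] by auto
    moreover have "d \<le> n" by (rule slope_le[OF dp[OF c[of k]] d]) simp
    ultimately show "enat k \<le> enat n" using order_trans[of k d n] by simp
  qed
qed

end

theorem theorem30:
  fixes D :: "'a::comm_ring_1 \<Rightarrow> 'a"
  assumes "derivation D"
    and "diff_spec (ring_of_type_algebra :: 'a ring) D \<noteq> {}"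
    and "standard_diff_ring D"
    and "krull_dim (ring_of_type_algebra :: 'a ring) < \<infinity>"
    and "\<exists>n>0. diff_dim (diff_poly_ring n) (diff_poly_deriv D) > enat n"
  shows "eventual_dim_growth TYPE('a) > 1"
proof (rule eventual_dim_growth_gt_one[OF assms(4)], rule ccontr)
  interpret diff_ring D by unfold_locales (rule assms(1))
  fix t
  assume "\<not> (\<exists>q p :: 'a set. prime_id q \<and> prime_id p \<and> q \<subset> p \<and> gain q p t)"
  then have "\<not> gain q p t" if "prime_id q" "prime_id p" "q \<subset> p" for q p :: "'a set"
    using that by blast
  then have "diff_dim (diff_poly_ring n) (diff_poly_deriv D) \<le> enat n" if "n > 0" for n
    by (rule diff_dim_le[OF assms(4,3,2) that])
  then show False using assms(5) by (meson not_le)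
qed

end
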